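(* Let $J\subseteq I$ and let $\mathsf v$ be a $J$-parameter system. Then $M_{J,\mathsf v}\cong M'_{J,\mathsf v}$ as right $\widetilde{\mathcal H}$-modules, where $M'_{J,\mathsf v}=\mathrm{Ind}_{\mathcal L_J}^{\widetilde{\mathcal H}}(\psi_{J,\mathsf v})$ affords the representation $\pi'_{J,\mathsf v}$. Moreover $$[\pi_{J,\mathsf v}(h)]_{u,v}=[\pi'_{J,\mathsf v}(h)]_{u,v}\quad\text{for all }h\in\widetilde{\mathcal H}\text{ and }u,v\in W^J,$$ where $M_{J,\mathsf v}$ and $M'_{J,\mathsf v}$ are endowed with the bases $\{\mathbf m_u\mid u\in W^J\}$ and $\{\xi_{J,\mathsf v}\otimes X_u\mid u\in W^J\}$ respectively.
   Context: Root system and groups. $\Phi$ is an irreducible, not necessarily reduced, crystallographic root system of rank $n$ in an $n$-dimensional Euclidean space $(V,\langle\cdot,\cdot\rangle)$, with simple roots $\alpha_i$, $i\in I=\{1,\dots,n\}$ (Bourbaki labelling), positive roots $\Phi^+$, highest root $\varphi$, and $\alpha^\vee=2\alpha/\langle\alpha,\alpha\rangle$. If $\Phi$ is not reduced it is of type $BC_n$: $V=\mathbb R^n$, $\alpha_j=e_j-e_{j+1}$ ($j<n$), $\alpha_n=e_n$, $\Phi^+=\{e_i\pm e_j\ (i<j),\ e_k,\ 2e_k\}$. Let $\omega_i\in V$ satisfy $\langle\omega_i,\alpha_j\rangle=\delta_{ij}$, $P=\bigoplus_i\mathbb Z\omega_i$, $Q=\mathbb Z\Phi^\vee\subseteq P$.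 For $\alpha\in\Phi$, $k\in\mathbb Z$: $H_{\alpha,k}=\{x\in V:\langle x,\alpha\rangle=k\}$, $s_{\alpha,k}(x)=x-(\langle x,\alpha\rangle-k)\alpha^\vee$, $s_\alpha=s_{\alpha,0}$, $s_i=s_{\alpha_i}$, $s_0=s_{\varphi,1}$. $W_0=\langle s_1,\dots,s_n\rangle$; $W=Q\rtimes W_0$ is a Coxeter group with generators $s_0,\dots,s_n$ and length $\ell$; $\widetilde W=P\rtimes W_0$, $\lambda\in P$ acting as the translation $t_\lambda$. Each $w\in\widetilde W$ is uniquely $w=t_{\mathrm{wt}(w)}\theta(w)$ with $\mathrm{wt}(w)\in P$, $\theta(w)\in W_0$. $A_0=\{x\in V:0\le\langle x,\alpha\rangle\le1\ \forall\alpha\in\Phi^+\}$; $\Sigma$ is the stabiliser of $A_0$ in $\widetilde W$; $\widetilde W=W\rtimes\Sigma$, $\ell(w\sigma)=\ell(w)$, $\sigma s_i\sigma^{-1}=s_{\sigma(i)}$. The crossing $w\to ws_i$ is positive (resp. negative) if $ws_iA_0$ lies in $\{\langle x,\alpha\rangle\ge k\}$ (resp. $\{\langle x,\alpha\rangle\le k\}$), where $H_{\alpha,k}$ with $\alpha\in\Phi^+$ separates $wA_0$ and $ws_iA_0$. Affine roots are expressions $\alpha+k\delta$ ($\alpha\in\Phi,k\in\mathbb Z$), $\alpha_0=-\varphi+\delta$, $u(\alpha+k\delta)=u\alpha+k\delta$ for $u\in W_0$. Objects attached to $J\subseteq I$. $W_J=\langle s_j:j\in J\rangle$; $W^J$ is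 the set of minimal length representatives of cosets $W_Jw$, $w\in W_0$; $\Phi_J$ is the set of roots in the span of $\{\alpha_j\}_{j\in J}$, $\Phi_J^+=\Phi_J\cap\Phi^+$; $Q_J=\sum_{\alpha\in\Phi_J}\mathbb Z\alpha^\vee$. Write $\theta(w)=\theta_J(w)\theta^J(w)$ with $\theta_J(w)\in W_J$, $\theta^J(w)\in W^J$. $\mathcal A_J=\{x\in V:0\le\langle x,\alpha\rangle\le1\ \forall\alpha\in\Phi_J^+\}$, $\mathbb W^J=\{w\in\widetilde W:wA_0\subseteq\mathcal A_J\}$. Hecke algebra. $\mathsf q_0,\dots,\mathsf q_n$ are commuting invertible indeterminates with $\mathsf q_i=\mathsf q_j$ whenever $s_i,s_j$ are conjugate in $\widetilde W$ (so $\mathsf q_0=\mathsf q_1$ if $\Phi=A_1$, $\mathsf q_0=\mathsf q_n$ if $\Phi=C_n$), $\mathsf R=\mathbb Z[\mathsf q_0^{\pm1},\dots,\mathsf q_n^{\pm1}]$. $\widetilde{\mathcal H}$ is the $\mathsf R$-algebra with basis $\{T_w:w\in\widetilde W\}$, $T_wT_v=T_{wv}$ if $\ell(wv)=\ell(w)+\ell(v)$, $T_wT_{s_i}=T_{ws_i}+(\mathsf q_i-\mathsf q_i^{-1})T_w$ if $\ell(ws_i)=\ell(w)-1$; $T_i=T_{s_i}$. For any expression $w=s_{i_1}\cdots s_{i_\ell}\sigma$ ($\sigma\in\Sigma$), $X_w=T_{i_1}^{\epsilon_1}\cdots T_{i_\ell}^{\epsilon_\ell}T_\sigma$, where $\epsilon_k=\pm1$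 is the sign of the crossing $s_{i_1}\cdots s_{i_{k-1}}\to s_{i_1}\cdots s_{i_k}$ (independent of the expression); $X^\lambda=X_{t_\lambda}$. The $J$-Levi subalgebra $\mathcal L_J$ is the subalgebra generated by $T_j$ ($j\in J$) and $X^\lambda$ ($\lambda\in P$). $J$-parameter system: a family $\mathsf v=(\mathsf v_\alpha)_{\alpha\in\Phi_J}$ in $\mathsf R^\times$ with (1) $\mathsf v_\alpha=\mathsf v_\beta$ if $\beta\in W_J\alpha$; (2) $\mathsf v_{\alpha_j}\in\{\mathsf q_j,-\mathsf q_j^{-1}\}$ for $j\in J$ with $2\alpha_j\notin\Phi_J$; (3) if $\Phi_J$ is not reduced, $\mathsf v_{2\alpha_n}\in\{\mathsf q_0,-\mathsf q_0^{-1}\}$ and $\mathsf v_{\alpha_n}\mathsf v_{2\alpha_n}\in\{\mathsf q_n,-\mathsf q_n^{-1}\}$. Set $\mathsf v_{\alpha+k\delta}=\mathsf v_\alpha$ for $\alpha\in\Phi_J$ and $\mathsf v_\beta=1$ for $\beta\notin\Phi_J+\mathbb Z\delta$. Ring. $\zeta^\lambda=\prod_i\zeta_i^{a_i}$ for $\lambda=\sum a_i\omega_i$; $\mathsf R[\zeta_J]$ is the quotient of $\mathsf R[\zeta_i^{\pm1}:i\in I]$ by the ideal generated by $\zeta^\gamma-1$, $\gamma\in Q_J$; $\zeta_J^\lambda$ is the image of $\zeta^\lambda$. Modules. $(\pi_{J,\mathsf v},M_{J,\mathsf v})$ is the right $\widetilde{\mathcal H}$-module, free over $\mathsf R[\zeta_J]$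 with basis $\{\mathbf m_u:u\in W^J\}$, with $\mathbf m_u\cdot T_\sigma=\zeta_J^{\mathrm{wt}(u\sigma)}\mathbf m_{\theta^J(u\sigma)}$ ($\sigma\in\Sigma$) and, for $i\in\{0\}\cup I$: $\mathbf m_u\cdot T_i=\zeta_J^{\mathrm{wt}(us_i)}\mathbf m_{\theta^J(us_i)}$ if $u\to us_i$ is positive and $us_i\in\mathbb W^J$; $\mathbf m_u\cdot T_i=\zeta_J^{\mathrm{wt}(us_i)}\mathbf m_{\theta^J(us_i)}+(\mathsf q_i-\mathsf q_i^{-1})\mathbf m_u$ if $u\to us_i$ is negative and $us_i\in\mathbb W^J$; $\mathbf m_u\cdot T_i=\mathsf v_{u\alpha_i}\mathsf v_{2u\alpha_i}\mathbf m_u$ if $us_i\notin\mathbb W^J$. The submodule $\mathsf R[\zeta_J]\mathbf m_e$ is $\mathcal L_J$-stable, and $\psi_{J,\mathsf v}:\mathcal L_J\to\mathsf R[\zeta_J]$ is the multiplicative character with $\mathbf m_e\cdot h=\psi_{J,\mathsf v}(h)\mathbf m_e$; explicitly $\psi_{J,\mathsf v}(T_j)=\mathsf v_{\alpha_j}\mathsf v_{2\alpha_j}$ and $\psi_{J,\mathsf v}(X^\lambda)=\zeta_J^\lambda\prod_{\alpha\in\Phi_J^+}\mathsf v_\alpha^{\langle\lambda,\alpha\rangle}$. Let $\mathsf R[\zeta_J]\xi_{J,\mathsf v}$ be the rank one right $\mathcal L_J$-module with $\xi_{J,\mathsf v}\cdot h=\psi_{J,\mathsf v}(h)\xi_{J,\mathsf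 v}$, and $M'_{J,\mathsf v}=(\mathsf R[\zeta_J]\xi_{J,\mathsf v})\otimes_{\mathcal L_J}\widetilde{\mathcal H}$; it is free over $\mathsf R[\zeta_J]$ with basis $\{\xi_{J,\mathsf v}\otimes X_u:u\in W^J\}$. For a basis $(b_u)$, matrix entries are defined by $b_u\cdot h=\sum_v[\pi(h)]_{u,v}b_v$. *)

theory Defs
  imports "HOL-Analysis.Analysis" "HOL-Library.Poly_Mapping"
    "HOL-Computational_Algebra.Group_Closure"
begin

section \<open>Root systems\<close>

definition coroot :: "'v::euclidean_space \<Rightarrow> 'v" where
  "coroot \<beta> = (2 / (\<beta> \<bullet> \<beta>)) *\<^sub>R \<beta>"

definition affine_reflection :: "'v::euclidean_space \<Rightarrow> int \<Rightarrow> 'v \<Rightarrow> 'v" where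
  "affine_reflection \<beta> k x = x - (x \<bullet> \<beta> - of_int k) *\<^sub>R coroot \<beta>"

definition root_system :: "'v::euclidean_space set \<Rightarrow> bool" where
  "root_system \<Phi> \<longleftrightarrow> finite \<Phi> \<and> 0 \<notin> \<Phi> \<and> span \<Phi> = UNIV \<and>
     (\<forall>\<beta>\<in>\<Phi>. affine_reflection \<beta> 0 ` \<Phi> = \<Phi>) \<and>
     (\<forall>\<beta>\<in>\<Phi>. \<forall>\<gamma>\<in>\<Phi>. \<gamma> \<bullet> coroot \<beta> \<in> \<int>)"

definition irreducible_roots :: "'v::euclidean_space set \<Rightarrow> bool" where
  "irreducible_roots \<Phi> \<longleftrightarrow> \<Phi> \<noteq> {} \<and>
     \<not> (\<exists>A B. A \<noteq> {} \<and> B \<noteq> {} \<and> A \<union> B = \<Phi> \<and> (\<forall>a\<in>A. \<forall>b\<in>B. a \<bullet> b = 0))"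

definition reduced_roots :: "'v::euclidean_space set \<Rightarrow> bool" where
  "reduced_roots \<Phi> \<longleftrightarrow> (\<forall>\<beta>\<in>\<Phi>. \<forall>c. c *\<^sub>R \<beta> \<in> \<Phi> \<longrightarrow> c = 1 \<or> c = -1)"

definition nonneg_comb :: "('i::finite \<Rightarrow> 'v::euclidean_space) \<Rightarrow> 'v \<Rightarrow> bool" where
  "nonneg_comb \<alpha> x \<longleftrightarrow> (\<exists>c :: 'i \<Rightarrow> nat. x = (\<Sum>i\<in>UNIV. of_nat (c i) *\<^sub>R \<alpha> i))"

definition pos_roots :: "'v::euclidean_space set \<Rightarrow> ('i::finite \<Rightarrow> 'v) \<Rightarrow> 'v set" where
  "pos_roots \<Phi> \<alpha> = {\<beta>\<in>\<Phi>. nonneg_comb \<alpha> \<beta>}"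

definition simple_roots :: "'v::euclidean_space set \<Rightarrow> ('i::finite \<Rightarrow> 'v) \<Rightarrow> bool" where
  "simple_roots \<Phi> \<alpha> \<longleftrightarrow> inj \<alpha> \<and> independent (range \<alpha>) \<and> range \<alpha> \<subseteq> \<Phi> \<and>
     (\<forall>\<beta>\<in>\<Phi>. nonneg_comb \<alpha> \<beta> \<or> nonneg_comb \<alpha> (- \<beta>))"

definition highest_root :: "'v::euclidean_space set \<Rightarrow> ('i::finite \<Rightarrow> 'v) \<Rightarrow> 'v" where
  "highest_root \<Phi> \<alpha> = (THE \<phi>. \<phi> \<in> \<Phi> \<and> (\<forall>\<beta>\<in>\<Phi>. nonneg_comb \<alpha> (\<phi> - \<beta>)))"

text \<open>The index set \<open>I = {1, \<dots>, n}\<close> is the finite linearly ordered type \<open>'i\<close>, so that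
  \<open>n = CARD('i) = DIM('v)\<close> and the label \<open>n\<close> is the greatest element.\<close>

definition last_index :: "'i::{finite,linorder}" where
  "last_index = Max UNIV"

definition next_index :: "'i::{finite,linorder} \<Rightarrow> 'i" where
  "next_index j = Min {j<..}"

text \<open>The standard realisation of type \<open>BC\<^sub>n\<close>, for an orthonormal basis \<open>e\<close>.\<close>

definition standard_BC :: "'v::euclidean_space set \<Rightarrow> ('i::{finite,linorder} \<Rightarrow> 'v) \<Rightarrow> bool" where
  "standard_BC \<Phi> \<alpha> \<longleftrightarrow> (\<exists>e :: 'i \<Rightarrow> 'v.
     (\<forall>i j. e i \<bullet> e j = (if i = j then 1 else 0)) \<and>
     (\<forall>j < last_index. \<alpha> j = e j - e (next_index j)) \<and> \<alpha> last_index = e last_index \<and>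
     pos_roots \<Phi> \<alpha> = {e i - e j | i j. i < j} \<union> {e i + e j | i j. i < j} \<union>
       range e \<union> range (\<lambda>k. 2 *\<^sub>R e k))"

text \<open>In the reduced case the labelling of the simple roots by \<open>I\<close> is left arbitrary, since nothing
  below depends on it.\<close>

definition based_root_system :: "'v::euclidean_space set \<Rightarrow> ('i::{finite,linorder} \<Rightarrow> 'v) \<Rightarrow> bool" where
  "based_root_system \<Phi> \<alpha> \<longleftrightarrow> root_system \<Phi> \<and> irreducible_roots \<Phi> \<and> simple_roots \<Phi> \<alpha> \<and>
     (\<not> reduced_roots \<Phi> \<longrightarrow> standard_BC \<Phi> \<alpha>)"

definition fund_coweight :: "('i::finite \<Rightarrow> 'v::euclidean_space) \<Rightarrow> 'i \<Rightarrow> 'v" where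
  "fund_coweight \<alpha> i = (THE w. \<forall>j. w \<bullet> \<alpha> j = (if i = j then 1 else 0))"

definition coweight_lattice :: "('i::finite \<Rightarrow> 'v::euclidean_space) \<Rightarrow> 'v set" where
  "coweight_lattice \<alpha> = {\<Sum>i\<in>UNIV. of_int (a i) *\<^sub>R fund_coweight \<alpha> i | a :: 'i \<Rightarrow> int. True}"


section \<open>Weyl groups\<close>

text \<open>All groups consist of affine maps of \<open>V\<close> under composition.\<close>

inductive_set generated_group :: "('v \<Rightarrow> 'v) set \<Rightarrow> ('v \<Rightarrow> 'v) set" for S :: "('v \<Rightarrow> 'v) set" where
  "id \<in> generated_group S"
| "w \<in> generated_group S \<Longrightarrow> x \<in> S \<Longrightarrow> w \<circ> x \<in> generated_group S"
| "w \<in> generated_group S \<Longrightarrow> x \<in> S \<Longrightarrow> w \<circ> inv x \<in> generated_group S"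

definition translation :: "'v::euclidean_space \<Rightarrow> 'v \<Rightarrow> 'v" where
  "translation \<mu> x = \<mu> + x"

text \<open>Affine indices \<open>{0} \<union> I\<close> are rendered as \<open>'i option\<close>, with \<open>None\<close> for \<open>0\<close>.\<close>

fun gen :: "'v::euclidean_space set \<Rightarrow> ('i::finite \<Rightarrow> 'v) \<Rightarrow> 'i option \<Rightarrow> 'v \<Rightarrow> 'v" where
  "gen \<Phi> \<alpha> None = affine_reflection (highest_root \<Phi> \<alpha>) 1"
| "gen \<Phi> \<alpha> (Some i) = affine_reflection (\<alpha> i) 0"

definition parabolic :: "('i::finite \<Rightarrow> 'v::euclidean_space) \<Rightarrow> 'i set \<Rightarrow> ('v \<Rightarrow> 'v) set" where
  "parabolic \<alpha> J = generated_group ((\<lambda>j. affine_reflection (\<alpha> j) 0) ` J)"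

abbreviation finite_weyl :: "('i::finite \<Rightarrow> 'v::euclidean_space) \<Rightarrow> ('v \<Rightarrow> 'v) set" where
  "finite_weyl \<alpha> \<equiv> parabolic \<alpha> UNIV"

definition ext_weyl :: "('i::finite \<Rightarrow> 'v::euclidean_space) \<Rightarrow> ('v \<Rightarrow> 'v) set" where
  "ext_weyl \<alpha> = {translation \<mu> \<circ> u | \<mu> u. \<mu> \<in> coweight_lattice \<alpha> \<and> u \<in> finite_weyl \<alpha>}"

text \<open>As \<open>W\<^sub>0\<close> acts linearly, the decomposition \<open>w = t\<^bsub>wt(w)\<^esub> \<theta>(w)\<close> is read off from the image of
  the origin.\<close>

definition wt :: "('v::euclidean_space \<Rightarrow> 'v) \<Rightarrow> 'v" where
  "wt w = w 0"

definition linear_part :: "('v::euclidean_space \<Rightarrow> 'v) \<Rightarrow> 'v \<Rightarrow> 'v" where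
  "linear_part w x = w x - w 0"

definition fund_alcove :: "'v::euclidean_space set \<Rightarrow> ('i::finite \<Rightarrow> 'v) \<Rightarrow> 'v set" where
  "fund_alcove \<Phi> \<alpha> = {x. \<forall>\<beta>\<in>pos_roots \<Phi> \<alpha>. 0 \<le> x \<bullet> \<beta> \<and> x \<bullet> \<beta> \<le> 1}"

definition alcove_stabilizer :: "'v::euclidean_space set \<Rightarrow> ('i::finite \<Rightarrow> 'v) \<Rightarrow> ('v \<Rightarrow> 'v) set" where
  "alcove_stabilizer \<Phi> \<alpha> = {\<sigma>\<in>ext_weyl \<alpha>. \<sigma> ` fund_alcove \<Phi> \<alpha> = fund_alcove \<Phi> \<alpha>}"

definition word_prod :: "'v::euclidean_space set \<Rightarrow> ('i::finite \<Rightarrow> 'v) \<Rightarrow> 'i option list \<Rightarrow> 'v \<Rightarrow> 'v" where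
  "word_prod \<Phi> \<alpha> is = foldr (\<lambda>i w. gen \<Phi> \<alpha> i \<circ> w) is id"

text \<open>The length on \<open>W\<close> extended by \<open>\<ell>(w\<sigma>) = \<ell>(w)\<close>.\<close>

definition len :: "'v::euclidean_space set \<Rightarrow> ('i::finite \<Rightarrow> 'v) \<Rightarrow> ('v \<Rightarrow> 'v) \<Rightarrow> nat" where
  "len \<Phi> \<alpha> w = (LEAST k. \<exists>is \<sigma>. length is = k \<and> \<sigma> \<in> alcove_stabilizer \<Phi> \<alpha> \<and>
     w = word_prod \<Phi> \<alpha> is \<circ> \<sigma>)"

definition separates :: "'v::euclidean_space \<Rightarrow> int \<Rightarrow> 'v set \<Rightarrow> 'v set \<Rightarrow> bool" where
  "separates \<beta> k A B \<longleftrightarrow>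
     (A \<subseteq> {x. x \<bullet> \<beta> \<le> of_int k} \<and> B \<subseteq> {x. x \<bullet> \<beta> \<ge> of_int k}) \<or>
     (A \<subseteq> {x. x \<bullet> \<beta> \<ge> of_int k} \<and> B \<subseteq> {x. x \<bullet> \<beta> \<le> of_int k})"

definition positive_crossing ::
    "'v::euclidean_space set \<Rightarrow> ('i::finite \<Rightarrow> 'v) \<Rightarrow> ('v \<Rightarrow> 'v) \<Rightarrow> 'i option \<Rightarrow> bool" where
  "positive_crossing \<Phi> \<alpha> w i \<longleftrightarrow> (\<exists>\<beta>\<in>pos_roots \<Phi> \<alpha>. \<exists>k.
     separates \<beta> k (w ` fund_alcove \<Phi> \<alpha>) ((w \<circ> gen \<Phi> \<alpha> i) ` fund_alcove \<Phi> \<alpha>) \<and>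
     (w \<circ> gen \<Phi> \<alpha> i) ` fund_alcove \<Phi> \<alpha> \<subseteq> {x. x \<bullet> \<beta> \<ge> of_int k})"

definition negative_crossing ::
    "'v::euclidean_space set \<Rightarrow> ('i::finite \<Rightarrow> 'v) \<Rightarrow> ('v \<Rightarrow> 'v) \<Rightarrow> 'i option \<Rightarrow> bool" where
  "negative_crossing \<Phi> \<alpha> w i \<longleftrightarrow> (\<exists>\<beta>\<in>pos_roots \<Phi> \<alpha>. \<exists>k.
     separates \<beta> k (w ` fund_alcove \<Phi> \<alpha>) ((w \<circ> gen \<Phi> \<alpha> i) ` fund_alcove \<Phi> \<alpha>) \<and>
     (w \<circ> gen \<Phi> \<alpha> i) ` fund_alcove \<Phi> \<alpha> \<subseteq> {x. x \<bullet> \<beta> \<le> of_int k})"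


section \<open>Objects attached to a subset of the index set\<close>

definition roots_J :: "'v::euclidean_space set \<Rightarrow> ('i::finite \<Rightarrow> 'v) \<Rightarrow> 'i set \<Rightarrow> 'v set" where
  "roots_J \<Phi> \<alpha> J = \<Phi> \<inter> span (\<alpha> ` J)"

definition coroot_lattice_J :: "'v::euclidean_space set \<Rightarrow> ('i::finite \<Rightarrow> 'v) \<Rightarrow> 'i set \<Rightarrow> 'v set" where
  "coroot_lattice_J \<Phi> \<alpha> J = group_closure (coroot ` roots_J \<Phi> \<alpha> J)"

definition min_reps ::
    "'v::euclidean_space set \<Rightarrow> ('i::finite \<Rightarrow> 'v) \<Rightarrow> 'i set \<Rightarrow> ('v \<Rightarrow> 'v) set" where
  "min_reps \<Phi> \<alpha> J =
     {u\<in>finite_weyl \<alpha>. \<forall>x\<in>parabolic \<alpha> J. len \<Phi> \<alpha> u \<le> len \<Phi> \<alpha> (x \<circ> u)}"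

definition theta_rep ::
    "'v::euclidean_space set \<Rightarrow> ('i::finite \<Rightarrow> 'v) \<Rightarrow> 'i set \<Rightarrow> ('v \<Rightarrow> 'v) \<Rightarrow> 'v \<Rightarrow> 'v" where
  "theta_rep \<Phi> \<alpha> J w =
     (THE u. u \<in> min_reps \<Phi> \<alpha> J \<and> (\<exists>x\<in>parabolic \<alpha> J. linear_part w = x \<circ> u))"

definition strip_J :: "'v::euclidean_space set \<Rightarrow> ('i::finite \<Rightarrow> 'v) \<Rightarrow> 'i set \<Rightarrow> 'v set" where
  "strip_J \<Phi> \<alpha> J = {x. \<forall>\<beta>\<in>roots_J \<Phi> \<alpha> J \<inter> pos_roots \<Phi> \<alpha>. 0 \<le> x \<bullet> \<beta> \<and> x \<bullet> \<beta> \<le> 1}"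

definition strip_elements ::
    "'v::euclidean_space set \<Rightarrow> ('i::finite \<Rightarrow> 'v) \<Rightarrow> 'i set \<Rightarrow> ('v \<Rightarrow> 'v) set" where
  "strip_elements \<Phi> \<alpha> J = {w\<in>ext_weyl \<alpha>. w ` fund_alcove \<Phi> \<alpha> \<subseteq> strip_J \<Phi> \<alpha> J}"


section \<open>Coefficient rings\<close>

text \<open>The ring \<open>\<int>[q\<^sub>0\<^sup>\<plusminus>\<^sup>1, \<dots>, q\<^sub>n\<^sup>\<plusminus>\<^sup>1]\<close> with the prescribed coincidences among the \<open>q\<^sub>i\<close> is the
  integral group ring of the free abelian group on the type \<open>'c\<close> of classes of affine indices,
  where the classes are those of conjugacy of the generators in the extended affine Weyl group.\<close>

type_synonym 'c qring = "('c \<Rightarrow>\<^sub>0 int) \<Rightarrow>\<^sub>0 int"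

definition class_map ::
    "'v::euclidean_space set \<Rightarrow> ('i::finite \<Rightarrow> 'v) \<Rightarrow> ('i option \<Rightarrow> 'c) \<Rightarrow> bool" where
  "class_map \<Phi> \<alpha> cls \<longleftrightarrow> surj cls \<and>
     (\<forall>i j. cls i = cls j \<longleftrightarrow>
        (\<exists>w\<in>ext_weyl \<alpha>. gen \<Phi> \<alpha> j = w \<circ> gen \<Phi> \<alpha> i \<circ> inv w))"

definition qpar :: "('a \<Rightarrow> 'c) \<Rightarrow> 'a \<Rightarrow> 'c qring" where
  "qpar cls i = Poly_Mapping.single (Poly_Mapping.single (cls i) 1) 1"

definition qpar_inv :: "('a \<Rightarrow> 'c) \<Rightarrow> 'a \<Rightarrow> 'c qring" where
  "qpar_inv cls i = Poly_Mapping.single (Poly_Mapping.single (cls i) (- 1)) 1"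

text \<open>\<open>R[\<zeta>\<^sub>i\<^sup>\<plusminus>\<^sup>1 : i \<in> I]\<close>\<close>

type_synonym ('i, 'c) zring = "('i \<Rightarrow>\<^sub>0 int) \<Rightarrow>\<^sub>0 'c qring"

text \<open>For \<open>\<mu> = \<Sum>\<^sub>i a\<^sub>i \<omega>\<^sub>i\<close> in the coweight lattice one has \<open>a\<^sub>i = \<langle>\<mu>, \<alpha>\<^sub>i\<rangle>\<close>.\<close>

definition zeta :: "('i::finite \<Rightarrow> 'v::euclidean_space) \<Rightarrow> 'v \<Rightarrow> ('i, 'c) zring" where
  "zeta \<alpha> \<mu> = (\<Prod>i\<in>UNIV. Poly_Mapping.single (Poly_Mapping.single i \<lfloor>\<mu> \<bullet> \<alpha> i\<rfloor>) 1)"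

text \<open>The map \<open>\<pi>\<close> presents \<open>'z\<close> as \<open>R[\<zeta>\<^sub>J]\<close>: it is a surjective ring homomorphism whose kernel is
  the ideal generated by the elements \<open>\<zeta>\<^sup>\<gamma> - 1\<close> with \<open>\<gamma> \<in> Q\<^sub>J\<close>.\<close>

definition zeta_quotient ::
    "'v::euclidean_space set \<Rightarrow> ('i::finite \<Rightarrow> 'v) \<Rightarrow> 'i set \<Rightarrow>
     (('i, 'c) zring \<Rightarrow> 'z::comm_ring_1) \<Rightarrow> bool" where
  "zeta_quotient \<Phi> \<alpha> J \<pi> \<longleftrightarrow>
     \<pi> 1 = 1 \<and> (\<forall>a b. \<pi> (a + b) = \<pi> a + \<pi> b) \<and> (\<forall>a b. \<pi> (a * b) = \<pi> a * \<pi> b) \<and> surj \<pi> \<and>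
     {a. \<pi> a = 0} = module.span times {zeta \<alpha> \<gamma> - 1 | \<gamma>. \<gamma> \<in> coroot_lattice_J \<Phi> \<alpha> J}"

definition zconst :: "(('i, 'c) zring \<Rightarrow> 'z) \<Rightarrow> 'c qring \<Rightarrow> 'z" where
  "zconst \<pi> r = \<pi> (Poly_Mapping.single 0 r)"


section \<open>The extended affine Hecke algebra\<close>

definition free_basis ::
    "('r::comm_ring_1 \<Rightarrow> 'm::ab_group_add \<Rightarrow> 'm) \<Rightarrow> 'b set \<Rightarrow> ('b \<Rightarrow> 'm) \<Rightarrow> bool" where
  "free_basis smul A b \<longleftrightarrow> module smul \<and> inj_on b A \<and>
     \<not> module.dependent smul (b ` A) \<and> module.span smul (b ` A) = UNIV"

definition hecke_algebra ::
    "'v::euclidean_space set \<Rightarrow> ('i::finite \<Rightarrow> 'v) \<Rightarrow> ('i option \<Rightarrow> 'c) \<Rightarrow>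
     ('c qring \<Rightarrow> 'h::ring_1 \<Rightarrow> 'h) \<Rightarrow> (('v \<Rightarrow> 'v) \<Rightarrow> 'h) \<Rightarrow> bool" where
  "hecke_algebra \<Phi> \<alpha> cls smul T \<longleftrightarrow>
     module smul \<and>
     (\<forall>r x y. smul r (x * y) = smul r x * y \<and> smul r (x * y) = x * smul r y) \<and>
     free_basis smul (ext_weyl \<alpha>) T \<and>
     (\<forall>w\<in>ext_weyl \<alpha>. \<forall>x\<in>ext_weyl \<alpha>.
        len \<Phi> \<alpha> (w \<circ> x) = len \<Phi> \<alpha> w + len \<Phi> \<alpha> x \<longrightarrow> T w * T x = T (w \<circ> x)) \<and>
     (\<forall>w\<in>ext_weyl \<alpha>. \<forall>i.
        len \<Phi> \<alpha> w = len \<Phi> \<alpha> (w \<circ> gen \<Phi> \<alpha> i) + 1 \<longrightarrow>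
        T w * T (gen \<Phi> \<alpha> i) = T (w \<circ> gen \<Phi> \<alpha> i) + smul (qpar cls i - qpar_inv cls i) (T w))"

definition ring_inverse :: "'h::ring_1 \<Rightarrow> 'h" where
  "ring_inverse x = (THE y. x * y = 1 \<and> y * x = 1)"

primrec walk ::
    "'v::euclidean_space set \<Rightarrow> ('i::finite \<Rightarrow> 'v) \<Rightarrow> (('v \<Rightarrow> 'v) \<Rightarrow> 'h::ring_1) \<Rightarrow>
     ('v \<Rightarrow> 'v) \<Rightarrow> 'i option list \<Rightarrow> 'h" where
  "walk \<Phi> \<alpha> T w [] = 1"
| "walk \<Phi> \<alpha> T w (i # is) =
     (if positive_crossing \<Phi> \<alpha> w i then T (gen \<Phi> \<alpha> i) else ring_inverse (T (gen \<Phi> \<alpha> i))) *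
     walk \<Phi> \<alpha> T (w \<circ> gen \<Phi> \<alpha> i) is"

text \<open>\<open>X\<^sub>w\<close> is the common value of \<open>T\<^sub>i\<^sub>1\<^sup>\<epsilon>\<^sup>1 \<cdots> T\<^sub>i\<^sub>\<ell>\<^sup>\<epsilon>\<^sup>\<ell> T\<^sub>\<sigma>\<close> over all expressions of \<open>w\<close>.\<close>

definition X_elt ::
    "'v::euclidean_space set \<Rightarrow> ('i::finite \<Rightarrow> 'v) \<Rightarrow> (('v \<Rightarrow> 'v) \<Rightarrow> 'h::ring_1) \<Rightarrow>
     ('v \<Rightarrow> 'v) \<Rightarrow> 'h" where
  "X_elt \<Phi> \<alpha> T w = (THE x. \<exists>is \<sigma>. \<sigma> \<in> alcove_stabilizer \<Phi> \<alpha> \<and>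
     w = word_prod \<Phi> \<alpha> is \<circ> \<sigma> \<and> x = walk \<Phi> \<alpha> T id is * T \<sigma>)"

inductive_set generated_subalgebra ::
    "('r::comm_ring_1 \<Rightarrow> 'h::ring_1 \<Rightarrow> 'h) \<Rightarrow> 'h set \<Rightarrow> 'h set"
  for smul :: "'r \<Rightarrow> 'h \<Rightarrow> 'h" and G :: "'h set" where
  "1 \<in> generated_subalgebra smul G"
| "g \<in> G \<Longrightarrow> g \<in> generated_subalgebra smul G"
| "x \<in> generated_subalgebra smul G \<Longrightarrow> smul r x \<in> generated_subalgebra smul G"
| "x \<in> generated_subalgebra smul G \<Longrightarrow> y \<in> generated_subalgebra smul G \<Longrightarrow>
   x + y \<in> generated_subalgebra smul G"
| "x \<in> generated_subalgebra smul G \<Longrightarrow> y \<in> generated_subalgebra smul G \<Longrightarrow>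
   x * y \<in> generated_subalgebra smul G"

definition levi ::
    "'v::euclidean_space set \<Rightarrow> ('i::finite \<Rightarrow> 'v) \<Rightarrow> 'i set \<Rightarrow>
     ('r::comm_ring_1 \<Rightarrow> 'h::ring_1 \<Rightarrow> 'h) \<Rightarrow> (('v \<Rightarrow> 'v) \<Rightarrow> 'h) \<Rightarrow> 'h set" where
  "levi \<Phi> \<alpha> J smul T = generated_subalgebra smul
     ((\<lambda>j. T (gen \<Phi> \<alpha> (Some j))) ` J \<union>
      (\<lambda>\<mu>. X_elt \<Phi> \<alpha> T (translation \<mu>)) ` coweight_lattice \<alpha>)"


section \<open>Parameter systems\<close>

definition parameter_system ::
    "'v::euclidean_space set \<Rightarrow> ('i::{finite,linorder} \<Rightarrow> 'v) \<Rightarrow> ('i option \<Rightarrow> 'c) \<Rightarrow> 'i set \<Rightarrow>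
     ('v \<Rightarrow> 'c qring) \<Rightarrow> bool" where
  "parameter_system \<Phi> \<alpha> cls J v \<longleftrightarrow>
     (\<forall>\<beta>\<in>roots_J \<Phi> \<alpha> J. v \<beta> dvd 1) \<and>
     (\<forall>\<beta>\<in>roots_J \<Phi> \<alpha> J. \<forall>x\<in>parabolic \<alpha> J. v (x \<beta>) = v \<beta>) \<and>
     (\<forall>j\<in>J. 2 *\<^sub>R \<alpha> j \<notin> roots_J \<Phi> \<alpha> J \<longrightarrow> v (\<alpha> j) \<in> {qpar cls (Some j), - qpar_inv cls (Some j)}) \<and>
     (\<not> reduced_roots (roots_J \<Phi> \<alpha> J) \<longrightarrow>
        v (2 *\<^sub>R \<alpha> last_index) \<in> {qpar cls None, - qpar_inv cls None} \<and>
        v (\<alpha> last_index) * v (2 *\<^sub>R \<alpha> last_index) \<in>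
          {qpar cls (Some last_index), - qpar_inv cls (Some last_index)})"

text \<open>The affine root \<open>\<beta> + k\<delta>\<close> is the pair \<open>(\<beta>, k)\<close>.\<close>

fun affine_simple_root ::
    "'v::euclidean_space set \<Rightarrow> ('i::finite \<Rightarrow> 'v) \<Rightarrow> 'i option \<Rightarrow> 'v \<times> int" where
  "affine_simple_root \<Phi> \<alpha> None = (- highest_root \<Phi> \<alpha>, 1)"
| "affine_simple_root \<Phi> \<alpha> (Some i) = (\<alpha> i, 0)"

definition affine_root_act :: "('v \<Rightarrow> 'v) \<Rightarrow> 'v \<times> int \<Rightarrow> 'v \<times> int" where
  "affine_root_act u a = (u (fst a), snd a)"

definition affine_root_double :: "'v::euclidean_space \<times> int \<Rightarrow> 'v \<times> int" where
  "affine_root_double a = (2 *\<^sub>R fst a, 2 * snd a)"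

definition affine_param ::
    "'v::euclidean_space set \<Rightarrow> ('i::finite \<Rightarrow> 'v) \<Rightarrow> 'i set \<Rightarrow>
     ('v \<Rightarrow> 'c qring) \<Rightarrow> 'v \<times> int \<Rightarrow> 'c qring" where
  "affine_param \<Phi> \<alpha> J v a = (if fst a \<in> roots_J \<Phi> \<alpha> J then v (fst a) else 1)"


section \<open>Modules\<close>

text \<open>A right module over the algebra \<open>'h\<close> which is a \<open>'z\<close>-module with \<open>'z\<close>-linear action; the two
  resulting structures over the ground ring \<open>'r\<close> agree through \<open>\<iota>\<close>.\<close>

definition right_module ::
    "('r::comm_ring_1 \<Rightarrow> 'h::ring_1 \<Rightarrow> 'h) \<Rightarrow> ('r \<Rightarrow> 'z::comm_ring_1) \<Rightarrow>
     ('z \<Rightarrow> 'm::ab_group_add \<Rightarrow> 'm) \<Rightarrow> ('m \<Rightarrow> 'h \<Rightarrow> 'm) \<Rightarrow> bool" where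
  "right_module scaleH \<iota> smul act \<longleftrightarrow> module smul \<and>
     (\<forall>x y h. act (x + y) h = act x h + act y h) \<and>
     (\<forall>x h k. act x (h + k) = act x h + act x k) \<and>
     (\<forall>x h k. act x (h * k) = act (act x h) k) \<and>
     (\<forall>x. act x 1 = x) \<and>
     (\<forall>z x h. act (smul z x) h = smul z (act x h)) \<and>
     (\<forall>r x h. act x (scaleH r h) = smul (\<iota> r) (act x h))"

definition module_M ::
    "'v::euclidean_space set \<Rightarrow> ('i::{finite,linorder} \<Rightarrow> 'v) \<Rightarrow> ('i option \<Rightarrow> 'c) \<Rightarrow> 'i set \<Rightarrow>
     ('v \<Rightarrow> 'c qring) \<Rightarrow> ('c qring \<Rightarrow> 'h::ring_1 \<Rightarrow> 'h) \<Rightarrow> (('v \<Rightarrow> 'v) \<Rightarrow> 'h) \<Rightarrow>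
     (('i, 'c) zring \<Rightarrow> 'z::comm_ring_1) \<Rightarrow> ('z \<Rightarrow> 'm::ab_group_add \<Rightarrow> 'm) \<Rightarrow>
     ('m \<Rightarrow> 'h \<Rightarrow> 'm) \<Rightarrow> (('v \<Rightarrow> 'v) \<Rightarrow> 'm) \<Rightarrow> bool" where
  "module_M \<Phi> \<alpha> cls J v scaleH T \<pi> smul act m \<longleftrightarrow>
     right_module scaleH (zconst \<pi>) smul act \<and>
     free_basis smul (min_reps \<Phi> \<alpha> J) m \<and>
     (\<forall>u\<in>min_reps \<Phi> \<alpha> J. \<forall>\<sigma>\<in>alcove_stabilizer \<Phi> \<alpha>.
        act (m u) (T \<sigma>) = smul (\<pi> (zeta \<alpha> (wt (u \<circ> \<sigma>)))) (m (theta_rep \<Phi> \<alpha> J (u \<circ> \<sigma>)))) \<and>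
     (\<forall>u\<in>min_reps \<Phi> \<alpha> J. \<forall>i.
        (u \<circ> gen \<Phi> \<alpha> i \<in> strip_elements \<Phi> \<alpha> J \<and> positive_crossing \<Phi> \<alpha> u i \<longrightarrow>
           act (m u) (T (gen \<Phi> \<alpha> i)) =
             smul (\<pi> (zeta \<alpha> (wt (u \<circ> gen \<Phi> \<alpha> i)))) (m (theta_rep \<Phi> \<alpha> J (u \<circ> gen \<Phi> \<alpha> i)))) \<and>
        (u \<circ> gen \<Phi> \<alpha> i \<in> strip_elements \<Phi> \<alpha> J \<and> negative_crossing \<Phi> \<alpha> u i \<longrightarrow>
           act (m u) (T (gen \<Phi> \<alpha> i)) =
             smul (\<pi> (zeta \<alpha> (wt (u \<circ> gen \<Phi> \<alpha> i)))) (m (theta_rep \<Phi> \<alpha> J (u \<circ> gen \<Phi> \<alpha> i))) +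
             smul (zconst \<pi> (qpar cls i - qpar_inv cls i)) (m u)) \<and>
        (u \<circ> gen \<Phi> \<alpha> i \<notin> strip_elements \<Phi> \<alpha> J \<longrightarrow>
           act (m u) (T (gen \<Phi> \<alpha> i)) =
             smul (zconst \<pi>
               (let a = affine_root_act u (affine_simple_root \<Phi> \<alpha> i)
                in affine_param \<Phi> \<alpha> J v a * affine_param \<Phi> \<alpha> J v (affine_root_double a)))
             (m u)))"

text \<open>On the Levi subalgebra, \<open>\<psi>\<^bsub>J,v\<^esub>(h)\<close> is the scalar by which \<open>h\<close> acts on \<open>m\<^sub>e\<close>.\<close>

definition psi ::
    "('z::comm_ring_1 \<Rightarrow> 'm::ab_group_add \<Rightarrow> 'm) \<Rightarrow> ('m \<Rightarrow> 'h \<Rightarrow> 'm) \<Rightarrow>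
     (('v \<Rightarrow> 'v) \<Rightarrow> 'm) \<Rightarrow> 'h \<Rightarrow> 'z" where
  "psi smul act m h = (THE c. act (m id) h = smul c (m id))"

text \<open>Generators of the relations that define \<open>N \<otimes>\<^sub>L H\<close> as a quotient of the free abelian group on
  \<open>N \<times> H\<close>, where \<open>L\<close> is a subring of \<open>H\<close> acting on \<open>N\<close> from the right by \<open>ract\<close>.\<close>

definition tensor_relations ::
    "'h::ring_1 set \<Rightarrow> ('n::ab_group_add \<Rightarrow> 'h \<Rightarrow> 'n) \<Rightarrow> (('n \<times> 'h) \<Rightarrow>\<^sub>0 int) set" where
  "tensor_relations L ract =
     (let g = (\<lambda>n h. Poly_Mapping.single (n, h) (1::int)) in
       {g (n + n') h - g n h - g n' h | n n' h. True} \<union>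
       {g n (h + h') - g n h - g n h' | n h h'. True} \<union>
       {g (ract n l) h - g n (l * h) | n l h. l \<in> L})"

definition is_tensor_product ::
    "'h::ring_1 set \<Rightarrow> ('n::ab_group_add \<Rightarrow> 'h \<Rightarrow> 'n) \<Rightarrow> ('n \<Rightarrow> 'h \<Rightarrow> 't::ab_group_add) \<Rightarrow> bool" where
  "is_tensor_product L ract \<tau> \<longleftrightarrow>
     (\<exists>F :: (('n \<times> 'h) \<Rightarrow>\<^sub>0 int) \<Rightarrow> 't. Modules.additive F \<and>
        (\<forall>n h. F (Poly_Mapping.single (n, h) 1) = \<tau> n h) \<and> surj F \<and>
        {x. F x = 0} = group_closure (tensor_relations L ract))"

text \<open>The module induced from the rank one module \<open>'z \<xi>\<close> on which \<open>L\<close> acts through \<open>\<psi>\<close>. The element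
  \<open>z \<xi>\<close> is identified with \<open>z\<close>, so that \<open>\<tau> z h\<close> stands for \<open>z \<xi> \<otimes> h\<close>.\<close>

definition induced_module ::
    "'h::ring_1 set \<Rightarrow> ('h \<Rightarrow> 'z::comm_ring_1) \<Rightarrow> ('z \<Rightarrow> 't::ab_group_add \<Rightarrow> 't) \<Rightarrow>
     ('t \<Rightarrow> 'h \<Rightarrow> 't) \<Rightarrow> ('z \<Rightarrow> 'h \<Rightarrow> 't) \<Rightarrow> bool" where
  "induced_module L \<psi> smul act \<tau> \<longleftrightarrow>
     is_tensor_product L (\<lambda>z l. z * \<psi> l) \<tau> \<and>
     (\<forall>z. Modules.additive (smul z)) \<and> (\<forall>z z' h. smul z (\<tau> z' h) = \<tau> (z * z') h) \<and>
     (\<forall>h. Modules.additive (\<lambda>x. act x h)) \<and> (\<forall>z h h'. act (\<tau> z h) h' = \<tau> z (h * h'))"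

definition matrix_entry ::
    "('z::comm_ring_1 \<Rightarrow> 'm::ab_group_add \<Rightarrow> 'm) \<Rightarrow> ('m \<Rightarrow> 'h \<Rightarrow> 'm) \<Rightarrow> 'b set \<Rightarrow> ('b \<Rightarrow> 'm) \<Rightarrow>
     'h \<Rightarrow> 'b \<Rightarrow> 'b \<Rightarrow> 'z" where
  "matrix_entry smul act A b h u =
     (THE c. (\<forall>w. w \<notin> A \<longrightarrow> c w = 0) \<and> act (b u) h = (\<Sum>w\<in>A. smul (c w) (b w)))"

definition right_module_iso ::
    "('m::ab_group_add \<Rightarrow> 'h \<Rightarrow> 'm) \<Rightarrow> ('n::ab_group_add \<Rightarrow> 'h \<Rightarrow> 'n) \<Rightarrow> ('m \<Rightarrow> 'n) \<Rightarrow> bool" where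
  "right_module_iso actM actN f \<longleftrightarrow>
     Modules.additive f \<and> bij f \<and> (\<forall>x h. f (actM x h) = actN (f x) h)"

end

theory Submission
  imports Defs
begin

text \<open>Write \<open>e\<close> for the identity, \<open>t\<^sub>\<mu>\<close> for the translation by \<open>\<mu>\<close>, and \<open>\<theta>(w)\<close> for the minimal representative of the
  coset of the linear part of \<open>w\<close> modulo \<open>W\<^sub>J\<close>. The isomorphism is the inverse of the map from the
  induced module to \<open>M\<close> that sends \<open>z \<xi> \<otimes> h\<close> to \<open>z m\<^sub>e h\<close>. Two computations with alcove walks show
  that this map is well defined and bijective.

  The line spanned by \<open>m\<^sub>e\<close> is stable under the Levi subalgebra (lemma \<open>levi_stable\<close>). Indeed, following
  a walk from \<open>e\<close> to \<open>w\<close> one sees that \<open>m\<^sub>e X\<^sub>w\<close> is a multiple of \<open>m\<close> at \<open>\<theta>(w)\<close>. Let the linear part of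
  \<open>w\<close> be \<open>x u\<close> with \<open>x \<in> W\<^sub>J\<close> and \<open>u = \<theta>(w)\<close>, and let \<open>\<gamma>\<close> be the gradient of the wall of \<open>u A\<^sub>0\<close> that is crossed
  by \<open>s\<^sub>i\<close>. If \<open>\<gamma> \<notin> \<Phi>\<^sub>J\<close>, then \<open>x\<close> preserves the sign of \<open>\<gamma>\<close>, so that the crossings at \<open>w\<close> and at \<open>u\<close> have the
  same sign, and the factor \<open>T\<^sub>i\<close> or its inverse prescribed by this sign moves \<open>m\<^sub>u\<close> to a multiple of \<open>m\<close>
  at \<open>\<theta>(w s\<^sub>i)\<close> (lemma \<open>crossing_within\<close>). If \<open>\<gamma> \<in> \<Phi>\<^sub>J\<close>, the step does not leave the coset and \<open>m\<^sub>u\<close> is an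
  eigenvector of \<open>T\<^sub>i\<close> (lemma \<open>fold_at_wall\<close>). A walk to a translation thus ends on the line of \<open>m\<^sub>e\<close>. For
  a walk along a reduced word of \<open>u \<in> W\<^sup>J\<close> all scalars are \<open>1\<close>, and \<open>m\<^sub>e X\<^sub>u = m\<^sub>u\<close> (lemma \<open>act_X_min_rep\<close>).

  The elements \<open>X\<^sub>w\<close> span the Hecke algebra (lemma \<open>span_X\<close>), and for \<open>w = t\<^sub>\<mu> x u\<close> with \<open>x \<in> W\<^sub>J\<close> and
  \<open>u \<in> W\<^sup>J\<close> one has \<open>X\<^sub>w = X\<^bsup>\<mu>\<^esup> X\<^sub>x X\<^sub>u\<close> with \<open>X\<^bsup>\<mu>\<^esup> X\<^sub>x\<close> in the Levi subalgebra (lemma \<open>X_factor\<close>). Hence the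
  elements \<open>\<xi> \<otimes> X\<^sub>u\<close> span the induced module. Their images are the basis vectors \<open>m\<^sub>u\<close>, so the map is
  bijective and carries one basis to the other; the equality of matrix entries follows.

  Behind this stands the independence of \<open>X\<^sub>w\<close> of the chosen word. Inside the dominant chamber a
  crossing is positive exactly when it increases the length (lemma \<open>deep_crossing\<close>). Translating a walk
  by \<open>t = t\<^bsub>k\<rho>\<^esub>\<close> does not change the signs of its crossings, and for large \<open>k\<close> it brings the walk into this
  chamber, where the relations of the Hecke algebra give \<open>T\<^sub>t X\<^sub>w = T\<^bsub>t w\<^esub>\<close>. As \<open>T\<^sub>t\<close> is invertible, this
  identity characterises \<open>X\<^sub>w\<close> without any appeal to words.

  The relation between length and walls is the exchange condition. It is derived from a single
  geometric fact (lemma \<open>single_wall_crossed\<close>): an affine root that changes sign between a point in the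
  interior of the fundamental alcove and its image under \<open>s\<^sub>i\<close> is a multiple of the wall of \<open>s\<^sub>i\<close>. The case \<open>i = 0\<close> of this
  fact rests on the existence of the highest root, the only place where irreducibility enters.\<close>

section \<open>Root systems with a base\<close>

locale based_roots =
  fixes \<Phi> :: "'v::euclidean_space set" and \<alpha> :: "'i::{finite,linorder} \<Rightarrow> 'v"
  assumes based: "based_root_system \<Phi> \<alpha>"
begin

abbreviation "P \<equiv> pos_roots \<Phi> \<alpha>"
abbreviation "\<omega> \<equiv> fund_coweight \<alpha>"
abbreviation reflect :: "'v \<Rightarrow> 'v \<Rightarrow> 'v" where "reflect \<beta> \<equiv> affine_reflection \<beta> 0"

lemma finite_roots: "finite \<Phi>" and zero_not_root: "0 \<notin> \<Phi>" and span_roots: "span \<Phi> = UNIV"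
  and refl_image: "\<beta> \<in> \<Phi> \<Longrightarrow> reflect \<beta> ` \<Phi> = \<Phi>"
  and coroot_int: "\<beta> \<in> \<Phi> \<Longrightarrow> \<gamma> \<in> \<Phi> \<Longrightarrow> \<gamma> \<bullet> coroot \<beta> \<in> \<int>"
  using based unfolding based_root_system_def root_system_def by auto

lemma inj_simple: "inj \<alpha>" and indep_simple: "independent (range \<alpha>)" and simple_in: "\<alpha> i \<in> \<Phi>"
  and root_sign: "\<beta> \<in> \<Phi> \<Longrightarrow> nonneg_comb \<alpha> \<beta> \<or> nonneg_comb \<alpha> (- \<beta>)"
  using based unfolding based_root_system_def simple_roots_def by auto

lemma refl_root: "\<beta> \<in> \<Phi> \<Longrightarrow> \<gamma> \<in> \<Phi> \<Longrightarrow> reflect \<beta> \<gamma> \<in> \<Phi>"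
  using refl_image by blast

lemma refl_eq: "reflect \<beta> x = x - (x \<bullet> \<beta>) *\<^sub>R coroot \<beta>"
  by (simp add: affine_reflection_def)

lemma refl_eq': "reflect \<beta> x = x - (x \<bullet> coroot \<beta>) *\<^sub>R \<beta>"
  by (simp add: affine_reflection_def coroot_def)

lemma coroot_inner_self: "\<beta> \<noteq> 0 \<Longrightarrow> \<beta> \<bullet> coroot \<beta> = 2"
  by (simp add: coroot_def)

lemma refl_self: "\<beta> \<noteq> 0 \<Longrightarrow> reflect \<beta> \<beta> = - \<beta>"
  by (simp add: refl_eq' coroot_inner_self scaleR_2)

lemma neg_root: "\<beta> \<in> \<Phi> \<Longrightarrow> - \<beta> \<in> \<Phi>"
  using refl_root[of \<beta> \<beta>] refl_self[of \<beta>] zero_not_root by metis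

lemma linear_refl: "linear (reflect \<beta>)"
  by (rule linearI) (simp_all add: refl_eq algebra_simps)

lemma orthogonal_refl: "\<beta> \<noteq> 0 \<Longrightarrow> orthogonal_transformation (reflect \<beta>)"
  unfolding orthogonal_transformation_def
  by (auto simp: linear_refl refl_eq coroot_def algebra_simps inner_commute power2_eq_square)

lemma refl_refl: "\<beta> \<noteq> 0 \<Longrightarrow> reflect \<beta> (reflect \<beta> x) = x"
  by (simp add: refl_eq coroot_def algebra_simps)

lemma refl_adjoint: "reflect \<beta> x \<bullet> y = x \<bullet> reflect \<beta> y"
  by (simp add: refl_eq coroot_def algebra_simps inner_commute)

lemma refl_scale: "c \<noteq> 0 \<Longrightarrow> reflect (c *\<^sub>R \<beta>) = reflect \<beta>"
  by (rule ext) (simp add: refl_eq coroot_def)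

lemma span_simple: "span (range \<alpha>) = UNIV"
proof -
  have nn: "x \<in> span (range \<alpha>)" if "nonneg_comb \<alpha> x" for x
    using that unfolding nonneg_comb_def by (auto intro!: span_sum span_scale[OF span_base])
  have "\<beta> \<in> span (range \<alpha>)" if "\<beta> \<in> \<Phi>" for \<beta>
    using root_sign[OF that]
  proof
    assume "nonneg_comb \<alpha> (- \<beta>)"
    from nn[OF this] have "- (- \<beta>) \<in> span (range \<alpha>)" by (rule span_neg)
    then show ?thesis by (simp only: minus_minus)
  qed (rule nn)
  then have "span \<Phi> \<subseteq> span (range \<alpha>)" by (intro span_minimal subspace_span subsetI)
  then show ?thesis using span_roots by auto
qed

lemma coweight_ex: "\<exists>!w. \<forall>j. w \<bullet> \<alpha> j = (if i = j then 1 else 0)"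
proof -
  obtain g :: "'v \<Rightarrow> real" where g: "linear g" "\<forall>x\<in>range \<alpha>. g x = (if x = \<alpha> i then 1 else 0)"
    using linear_independent_extend[OF indep_simple, of "\<lambda>x. if x = \<alpha> i then 1 else 0"] by auto
  define w where "w = adjoint g 1"
  have w: "w \<bullet> \<alpha> j = (if i = j then 1 else 0)" for j
    using g adjoint_works[OF g(1), of "\<alpha> j" 1] inj_simple
    by (auto simp: w_def inner_commute inj_def)
  show ?thesis
  proof (rule ex1I[of _ w])
    fix y assume y: "\<forall>j. y \<bullet> \<alpha> j = (if i = j then 1 else 0)"
    have "(y - w) \<bullet> x = 0" if "x \<in> span (range \<alpha>)" for x
      using that
    proof (rule span_induct)
      show "subspace {x. (y - w) \<bullet> x = 0}" by (auto simp: subspace_def inner_right_distrib)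
    qed (use y w in \<open>auto simp: inner_diff_left\<close>)
    then have "(y - w) \<bullet> (y - w) = 0" using span_simple by auto
    then show "y = w" by simp
  qed (use w in auto)
qed

lemma coweight_simple: "\<omega> i \<bullet> \<alpha> j = (if i = j then 1 else 0)"
  using theI'[OF coweight_ex[of i]] unfolding fund_coweight_def by blast

lemma simple_coweight: "\<alpha> j \<bullet> \<omega> i = (if i = j then 1 else 0)"
  using coweight_simple by (simp add: inner_commute)

text \<open>The simple roots and the fundamental coweights are dual bases. All statements about positivity are
  read off from the coordinates \<open>x \<bullet> \<omega> i\<close>.\<close>

lemma coords: "x = (\<Sum>i\<in>UNIV. (x \<bullet> \<omega> i) *\<^sub>R \<alpha> i)"
proof -
  have "x \<in> span (range \<alpha>)" using span_simple by auto
  then show ?thesis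
  proof (rule span_induct)
    have *: "linear (\<lambda>x. x - (\<Sum>i\<in>UNIV. (x \<bullet> \<omega> i) *\<^sub>R \<alpha> i))"
      by (rule linearI)
        (simp_all add: inner_left_distrib scaleR_left_distrib sum.distrib scaleR_right_diff_distrib scaleR_sum_right)
    show "subspace {x. x = (\<Sum>i\<in>UNIV. (x \<bullet> \<omega> i) *\<^sub>R \<alpha> i)}"
      using linear_subspace_kernel[OF *] by simp
    fix x assume "x \<in> range \<alpha>"
    then show "x = (\<Sum>i\<in>UNIV. (x \<bullet> \<omega> i) *\<^sub>R \<alpha> i)"
      by (auto simp: simple_coweight if_distrib[of "\<lambda>c. c *\<^sub>R _"] cong: if_cong)
  qed
qed

lemma inner_coords: "y \<bullet> x = (\<Sum>i\<in>UNIV. (x \<bullet> \<omega> i) * (y \<bullet> \<alpha> i))"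
  by (subst coords[of x]) (simp add: inner_sum_right)

lemma nonneg_comb_iff: "nonneg_comb \<alpha> x \<longleftrightarrow> (\<forall>i. x \<bullet> \<omega> i \<in> \<nat>)"
proof
  assume "nonneg_comb \<alpha> x"
  then obtain c :: "'i \<Rightarrow> nat" where "x = (\<Sum>i\<in>UNIV. of_nat (c i) *\<^sub>R \<alpha> i)"
    unfolding nonneg_comb_def by auto
  then have "x \<bullet> \<omega> i = of_nat (c i)" for i
    by (simp add: inner_sum_left simple_coweight if_distrib[of "\<lambda>c. _ * c"] cong: if_cong)
  then show "\<forall>i. x \<bullet> \<omega> i \<in> \<nat>" by auto
next
  assume "\<forall>i. x \<bullet> \<omega> i \<in> \<nat>"
  then have "\<forall>i. \<exists>n. x \<bullet> \<omega> i = of_nat n" by (auto simp: Nats_def)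
  then obtain c where "\<And>i. x \<bullet> \<omega> i = of_nat (c i)" by metis
  then have "(\<Sum>i\<in>UNIV. (x \<bullet> \<omega> i) *\<^sub>R \<alpha> i) = (\<Sum>i\<in>UNIV. of_nat (c i) *\<^sub>R \<alpha> i)" by simp
  then show "nonneg_comb \<alpha> x"
    unfolding nonneg_comb_def using coords[of x] by metis
qed

lemma Nats_nonneg: "(x::real) \<in> \<nat> \<Longrightarrow> 0 \<le> x" by (auto simp: Nats_def)

lemma eq_by_coords: "(\<And>i. x \<bullet> \<omega> i = y \<bullet> \<omega> i) \<Longrightarrow> x = y"
  by (subst coords[of x], subst coords[of y]) simp

lemma pos_iff: "\<beta> \<in> P \<longleftrightarrow> \<beta> \<in> \<Phi> \<and> (\<forall>i. \<beta> \<bullet> \<omega> i \<in> \<nat>)"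
  by (simp add: pos_roots_def nonneg_comb_iff)

lemma pos_coord: "\<beta> \<in> P \<Longrightarrow> 0 \<le> \<beta> \<bullet> \<omega> i"
  by (auto simp: pos_iff intro: Nats_nonneg)

lemma pos_root: "\<beta> \<in> P \<Longrightarrow> \<beta> \<in> \<Phi>"
  by (simp add: pos_iff)

lemma simple_pos: "\<alpha> i \<in> P"
  by (simp add: pos_iff simple_in simple_coweight)

lemma pos_or_neg: "\<beta> \<in> \<Phi> \<Longrightarrow> \<beta> \<in> P \<or> - \<beta> \<in> P"
  using root_sign[of \<beta>] neg_root by (auto simp: pos_roots_def)

definition "\<rho> = (\<Sum>i\<in>UNIV. \<omega> i)"

lemma rho_simple: "\<rho> \<bullet> \<alpha> i = 1"
  by (simp add: \<rho>_def inner_sum_left coweight_simple)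

lemma rho_inner: "\<rho> \<bullet> x = (\<Sum>i\<in>UNIV. x \<bullet> \<omega> i)"
  by (simp add: \<rho>_def inner_sum_right inner_commute[of _ x])

text \<open>The pairing with \<open>\<rho>\<close> is the height, which detects the sign of a root by a single number.\<close>

lemma rho_pos: assumes "\<beta> \<in> P" shows "1 \<le> \<rho> \<bullet> \<beta>"
proof -
  have "(\<Sum>i\<in>K. \<beta> \<bullet> \<omega> i) \<in> \<nat>" if "finite K" for K
    using that by induction (use assms in \<open>auto simp: pos_iff\<close>)
  then have n: "\<rho> \<bullet> \<beta> \<in> \<nat>" unfolding rho_inner by simp
  moreover have "\<rho> \<bullet> \<beta> \<noteq> 0"
  proof
    assume "\<rho> \<bullet> \<beta> = 0"
    then have "\<forall>i. \<beta> \<bullet> \<omega> i = 0"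
      unfolding rho_inner using pos_coord[OF assms] by (subst (asm) sum_nonneg_eq_0_iff) auto
    then have "\<beta> = 0" using eq_by_coords[of \<beta> 0] by simp
    then show False using assms zero_not_root pos_root by auto
  qed
  ultimately show ?thesis by (auto simp: Nats_def)
qed

lemma pos_by_rho: assumes "\<beta> \<in> \<Phi>" shows "\<beta> \<in> P \<longleftrightarrow> 0 < \<rho> \<bullet> \<beta>"
  using pos_or_neg[OF assms] rho_pos[of \<beta>] rho_pos[of "-\<beta>"] by fastforce

lemma not_pos_iff: "\<beta> \<in> \<Phi> \<Longrightarrow> \<beta> \<notin> P \<longleftrightarrow> - \<beta> \<in> P"
  using pos_by_rho[of \<beta>] pos_by_rho[of "-\<beta>"] neg_root[of \<beta>] pos_or_neg by auto

text \<open>The coordinates of a root all have the same sign, so one positive coordinate decides.\<close>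

lemma pos_by_coord: assumes "\<beta> \<in> \<Phi>" "0 < \<beta> \<bullet> \<omega> i" shows "\<beta> \<in> P"
  using assms pos_or_neg[of \<beta>] pos_coord[of "-\<beta>" i] by auto

lemma refl_simple_coord: "j \<noteq> i \<Longrightarrow> reflect (\<alpha> i) x \<bullet> \<omega> j = x \<bullet> \<omega> j"
  by (simp add: refl_eq' inner_diff_left simple_coweight)

text \<open>A simple reflection changes one coordinate only. A positive root that becomes negative therefore
  has no other nonzero coordinate.\<close>

lemma pos_refl_neg:
  assumes "\<beta> \<in> P" "reflect (\<alpha> i) \<beta> \<notin> P"
  shows "\<exists>c>0. \<beta> = c *\<^sub>R \<alpha> i"
proof -
  have 0: "\<beta> \<bullet> \<omega> j = 0" if "j \<noteq> i" for j
  proof (rule ccontr)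
    assume "\<beta> \<bullet> \<omega> j \<noteq> 0"
    then have "0 < \<beta> \<bullet> \<omega> j" using pos_coord[OF assms(1), of j] by auto
    then show False
      using pos_by_coord[of "reflect (\<alpha> i) \<beta>" j] refl_root[OF simple_in pos_root[OF assms(1)]]
        refl_simple_coord[OF that] assms(2) by auto
  qed
  have "\<beta> = (\<beta> \<bullet> \<omega> i) *\<^sub>R \<alpha> i"
    by (rule eq_by_coords) (use 0 in \<open>auto simp: simple_coweight\<close>)
  moreover have "\<beta> \<bullet> \<omega> i \<noteq> 0" using calculation assms pos_root zero_not_root by auto
  ultimately show ?thesis using pos_coord[OF assms(1), of i] by (intro exI[of _ "\<beta> \<bullet> \<omega> i"]) auto
qed

text \<open>Otherwise the reflection of one simple root in the other would have coordinates of both signs.\<close>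

lemma simple_inner_nonpos: assumes "i \<noteq> j" shows "\<alpha> i \<bullet> \<alpha> j \<le> 0"
proof (rule ccontr)
  assume n: "\<not> \<alpha> i \<bullet> \<alpha> j \<le> 0"
  let ?b = "reflect (\<alpha> i) (\<alpha> j)"
  have b: "?b \<in> \<Phi>" using refl_root simple_in by auto
  have "?b \<in> P"
    by (rule pos_by_coord[OF b, of j]) (use assms in \<open>auto simp: refl_simple_coord simple_coweight\<close>)
  from pos_coord[OF this, of i] have "\<alpha> j \<bullet> coroot (\<alpha> i) \<le> 0"
    using assms by (simp add: refl_eq' inner_diff_left simple_coweight)
  moreover have "0 < \<alpha> i \<bullet> \<alpha> i" using simple_in[of i] zero_not_root by auto
  ultimately show False using n
    by (simp add: coroot_def inner_commute divide_le_0_iff)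
qed

text \<open>Expand \<open>\<beta> \<bullet> \<beta> > 0\<close> in coordinates: some term must be positive.\<close>

lemma ex_simple_pos_inner:
  assumes "\<beta> \<in> P" shows "\<exists>i. 0 < \<beta> \<bullet> \<omega> i \<and> 0 < \<beta> \<bullet> \<alpha> i"
proof (rule ccontr)
  assume n: "\<not> ?thesis"
  have "(\<beta> \<bullet> \<omega> i) * (\<beta> \<bullet> \<alpha> i) \<le> 0" for i
  proof (cases "0 < \<beta> \<bullet> \<omega> i")
    case True
    then have "\<beta> \<bullet> \<alpha> i \<le> 0" using n not_less by blast
    then show ?thesis using True by (simp add: mult_nonneg_nonpos)
  next
    case False
    then have "\<beta> \<bullet> \<omega> i = 0" using pos_coord[OF assms, of i] by simp
    then show ?thesis by simp
  qed
  then have "(\<Sum>i\<in>UNIV. (\<beta> \<bullet> \<omega> i) * (\<beta> \<bullet> \<alpha> i)) \<le> 0" by (intro sum_nonpos)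
  then have "\<beta> \<bullet> \<beta> \<le> 0" by (simp only: inner_coords[symmetric])
  then have "\<beta> \<bullet> \<beta> = 0" using inner_ge_zero[of \<beta>] by linarith
  then show False using pos_root[OF assms] zero_not_root by simp
qed

lemma reflect_lowers_height:
  assumes "\<beta> \<in> P" "0 < \<beta> \<bullet> \<alpha> i" "\<nexists>c. 0 < c \<and> \<beta> = c *\<^sub>R \<alpha> i"
  shows "reflect (\<alpha> i) \<beta> \<in> P" "\<rho> \<bullet> reflect (\<alpha> i) \<beta> \<le> \<rho> \<bullet> \<beta> - 1"
proof -
  show "reflect (\<alpha> i) \<beta> \<in> P" using pos_refl_neg assms by blast
  have a: "0 < \<alpha> i \<bullet> \<alpha> i" using simple_in[of i] zero_not_root by auto
  have "0 < \<beta> \<bullet> coroot (\<alpha> i)" using assms(2) a by (simp add: coroot_def)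
  moreover have "\<beta> \<bullet> coroot (\<alpha> i) \<in> \<int>" using coroot_int simple_in pos_root assms by auto
  ultimately have "1 \<le> \<beta> \<bullet> coroot (\<alpha> i)" by (auto elim!: Ints_cases)
  then show "\<rho> \<bullet> reflect (\<alpha> i) \<beta> \<le> \<rho> \<bullet> \<beta> - 1"
    by (simp add: refl_eq' inner_diff_right rho_simple)
qed

text \<open>Every positive root is brought to a multiple of a simple root by simple reflections that lower its
  height and keep it positive. Multiples have to be allowed because the root system need not be
  reduced.\<close>

lemma pos_descent_induct [consumes 1, case_names multiple descent]:
  assumes "\<beta> \<in> P"
    and mult: "\<And>i c. 0 < c \<Longrightarrow> c *\<^sub>R \<alpha> i \<in> P \<Longrightarrow> Q (c *\<^sub>R \<alpha> i)"
    and desc: "\<And>\<beta> i. \<beta> \<in> P \<Longrightarrow> 0 < \<beta> \<bullet> \<omega> i \<Longrightarrow> 0 < \<beta> \<bullet> \<alpha> i \<Longrightarrow> reflect (\<alpha> i) \<beta> \<in> P \<Longrightarrow> Q (reflect (\<alpha> i) \<beta>) \<Longrightarrow> Q \<beta>"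
  shows "Q \<beta>"
  using assms(1)
proof (induction "nat \<lceil>\<rho> \<bullet> \<beta>\<rceil>" arbitrary: \<beta> rule: less_induct)
  case less
  obtain i where i: "0 < \<beta> \<bullet> \<omega> i" "0 < \<beta> \<bullet> \<alpha> i" using ex_simple_pos_inner[OF less.prems] by auto
  show ?case
  proof (cases "\<exists>c>0. \<beta> = c *\<^sub>R \<alpha> i")
    case True then show ?thesis using mult less.prems by auto
  next
    case False
    then have r: "reflect (\<alpha> i) \<beta> \<in> P" "\<rho> \<bullet> reflect (\<alpha> i) \<beta> \<le> \<rho> \<bullet> \<beta> - 1"
      using reflect_lowers_height[OF less.prems i(2)] by auto
    then have "nat \<lceil>\<rho> \<bullet> reflect (\<alpha> i) \<beta>\<rceil> < nat \<lceil>\<rho> \<bullet> \<beta>\<rceil>"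
      using rho_pos[OF less.prems] by linarith
    then show ?thesis using less.hyps r i desc[OF less.prems] by blast
  qed
qed

text \<open>If the base splits into two orthogonal parts, every root lies in the span of one of them. This is
  proved by descent: a positive root \<open>\<beta>\<close> whose reflection in \<open>\<alpha> i\<close> has lost its part on the side of \<open>i\<close> would
  have this part equal to a multiple of \<open>\<alpha> i\<close>, which the reflection turns into its negative instead of
  zero. Hence the roots themselves split, against irreducibility.\<close>

lemma irreducible_base:
  assumes S: "S \<noteq> {}" "S \<noteq> UNIV"
  shows "\<exists>i\<in>S. \<exists>j\<in>-S. \<alpha> i \<bullet> \<alpha> j \<noteq> 0"
proof (rule ccontr)
  assume "\<not> ?thesis"
  then have orth: "\<And>i j. i \<in> S \<Longrightarrow> j \<notin> S \<Longrightarrow> \<alpha> i \<bullet> \<alpha> j = 0" by auto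
  have one_side: "(\<forall>i\<in>S. \<beta> \<bullet> \<omega> i = 0) \<or> (\<forall>i\<in>-S. \<beta> \<bullet> \<omega> i = 0)" if "\<beta> \<in> P" for \<beta>
    using that
  proof (induction rule: pos_descent_induct)
    case (multiple i c) then show ?case by (auto simp: simple_coweight)
  next
    case (descent \<beta> i)
    \<comment> \<open>\<open>K\<close> is the side of the decomposition that contains \<open>i\<close>\<close>
    have fix_half: "\<beta> \<bullet> \<omega> k = 0" if K: "i \<in> K" "\<And>j. j \<notin> K \<Longrightarrow> \<alpha> j \<bullet> \<alpha> i = 0"
      and z: "\<forall>j\<in>K. reflect (\<alpha> i) \<beta> \<bullet> \<omega> j = 0" and k: "k \<in> K" for K k
    proof (rule ccontr)
      have zj: "\<beta> \<bullet> \<omega> j = 0" if "j \<in> K" "j \<noteq> i" for j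
        using z that refl_simple_coord[of j i \<beta>] by auto
      have "\<alpha> i \<bullet> \<beta> = (\<Sum>j\<in>UNIV. (\<beta> \<bullet> \<omega> j) * (\<alpha> i \<bullet> \<alpha> j))" by (rule inner_coords)
      also have "\<dots> = (\<Sum>j\<in>UNIV. if j = i then (\<beta> \<bullet> \<omega> i) * (\<alpha> i \<bullet> \<alpha> i) else 0)"
        by (rule sum.cong) (use zj K in \<open>auto simp: inner_commute\<close>)
      finally have e: "\<beta> \<bullet> \<alpha> i = (\<beta> \<bullet> \<omega> i) * (\<alpha> i \<bullet> \<alpha> i)" by (simp add: inner_commute)
      have "\<alpha> i \<noteq> 0" using simple_in[of i] zero_not_root by auto
      then have "\<beta> \<bullet> coroot (\<alpha> i) = 2 * (\<beta> \<bullet> \<omega> i)" by (simp add: coroot_def e)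
      then have "reflect (\<alpha> i) \<beta> \<bullet> \<omega> i = - (\<beta> \<bullet> \<omega> i)"
        by (simp add: refl_eq' inner_diff_left simple_coweight)
      then show False using z K(1) descent.hyps(2) by auto
    qed
    show ?case
    proof (cases "i \<in> S")
      case True
      have o: "\<alpha> j \<bullet> \<alpha> i = 0" if "j \<notin> S" for j
        using orth[OF True that] by (simp add: inner_commute)
      have "\<not> (\<forall>j\<in>S. reflect (\<alpha> i) \<beta> \<bullet> \<omega> j = 0)"
        using fix_half[OF True o _ True] descent.hyps(2) by (metis less_irrefl)
      then have z: "\<forall>j\<in>-S. reflect (\<alpha> i) \<beta> \<bullet> \<omega> j = 0" using descent.IH by blast
      have "\<beta> \<bullet> \<omega> j = 0" if "j \<in> -S" for j
        using z that True refl_simple_coord[of j i \<beta>] by fastforce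
      then show ?thesis by blast
    next
      case False
      then have F: "i \<in> -S" by simp
      have o: "\<alpha> j \<bullet> \<alpha> i = 0" if "j \<notin> -S" for j
        using orth[of j i] that F by simp
      have "\<not> (\<forall>j\<in>-S. reflect (\<alpha> i) \<beta> \<bullet> \<omega> j = 0)"
        using fix_half[OF F o _ F] descent.hyps(2) by (metis less_irrefl)
      then have z: "\<forall>j\<in>S. reflect (\<alpha> i) \<beta> \<bullet> \<omega> j = 0" using descent.IH by blast
      have "\<beta> \<bullet> \<omega> j = 0" if "j \<in> S" for j
        using z that False refl_simple_coord[of j i \<beta>] by fastforce
      then show ?thesis by blast
    qed
  qed
  have one_side': "(\<forall>i\<in>S. \<beta> \<bullet> \<omega> i = 0) \<or> (\<forall>i\<in>-S. \<beta> \<bullet> \<omega> i = 0)" if "\<beta> \<in> \<Phi>" for \<beta>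
    using pos_or_neg[OF that] one_side[of \<beta>] one_side[of "-\<beta>"] by auto
  define A where "A = {\<beta>\<in>\<Phi>. \<forall>i\<in>-S. \<beta> \<bullet> \<omega> i = 0}"
  define B where "B = {\<beta>\<in>\<Phi>. \<forall>i\<in>S. \<beta> \<bullet> \<omega> i = 0}"
  have "a \<bullet> b = 0" if "a \<in> A" "b \<in> B" for a b
  proof -
    have "a \<bullet> b = (\<Sum>j\<in>UNIV. (b \<bullet> \<omega> j) * (a \<bullet> \<alpha> j))" by (rule inner_coords)
    also have "\<dots> = 0"
    proof (rule sum.neutral, rule ballI)
      fix j show "(b \<bullet> \<omega> j) * (a \<bullet> \<alpha> j) = 0"
      proof (cases "j \<in> S")
        case False
        have "\<alpha> j \<bullet> a = (\<Sum>i\<in>UNIV. (a \<bullet> \<omega> i) * (\<alpha> j \<bullet> \<alpha> i))" by (rule inner_coords)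
        also have "\<dots> = 0"
          by (rule sum.neutral) (use that orth False in \<open>auto simp: A_def inner_commute\<close>)
        finally show ?thesis by (simp add: inner_commute)
      qed (use that in \<open>auto simp: B_def\<close>)
    qed
    finally show ?thesis .
  qed
  moreover obtain i j where "i \<in> S" "j \<notin> S" using S by auto
  then have "\<alpha> i \<in> A" "\<alpha> j \<in> B" by (auto simp: A_def B_def simple_in simple_coweight)
  moreover have "A \<union> B = \<Phi>" using one_side' by (auto simp: A_def B_def)
  ultimately show False
    using based unfolding based_root_system_def irreducible_roots_def by blast
qed

section \<open>The highest root\<close>

lemma refl_coord_diff: "\<rho> \<bullet> (x - reflect (\<alpha> i) x) = x \<bullet> coroot (\<alpha> i)"
  by (simp add: refl_eq' inner_diff_right rho_simple)

lemma simple_norm_pos: "0 < \<alpha> i \<bullet> \<alpha> i"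
  using simple_in[of i] zero_not_root by auto

lemma reflect_raises_height:
  assumes "\<beta> \<in> \<Phi>" "\<beta> \<bullet> \<alpha> i < 0"
  shows "reflect (\<alpha> i) \<beta> \<in> \<Phi>" "\<rho> \<bullet> \<beta> < \<rho> \<bullet> reflect (\<alpha> i) \<beta>"
proof -
  show "reflect (\<alpha> i) \<beta> \<in> \<Phi>" using refl_root simple_in assms by blast
  have "\<beta> \<bullet> coroot (\<alpha> i) < 0"
    using assms(2) simple_norm_pos[of i] by (simp add: coroot_def divide_neg_pos mult_pos_neg)
  then show "\<rho> \<bullet> \<beta> < \<rho> \<bullet> reflect (\<alpha> i) \<beta>"
    using refl_coord_diff[of \<beta> i] by (simp add: inner_diff_right)
qed

definition dominant :: "'v \<Rightarrow> bool" where
  "dominant x \<longleftrightarrow> (\<forall>i. 0 \<le> x \<bullet> \<alpha> i)"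

lemma Ints_coord: "\<beta> \<in> \<Phi> \<Longrightarrow> \<beta> \<bullet> \<omega> i \<in> \<int>"
proof -
  assume b: "\<beta> \<in> \<Phi>"
  from pos_or_neg[OF b] show "\<beta> \<bullet> \<omega> i \<in> \<int>"
  proof
    assume "\<beta> \<in> P"
    then show ?thesis using Nats_subset_Ints by (auto simp: pos_iff)
  next
    assume "- \<beta> \<in> P"
    then have "- (\<beta> \<bullet> \<omega> i) \<in> \<nat>" by (auto simp: pos_iff)
    then have "- (\<beta> \<bullet> \<omega> i) \<in> \<int>" using Nats_subset_Ints by blast
    then show ?thesis by simp
  qed
qed

text \<open>Let \<open>S\<close> be the support of \<open>\<beta>\<close>. A simple root outside \<open>S\<close> has inner products at most zero with those in
  \<open>S\<close>, and dominance forces them to vanish, so \<open>S\<close> would split off from the base.\<close>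

lemma dominant_full_support:
  assumes "\<beta> \<in> P" "dominant \<beta>" shows "0 < \<beta> \<bullet> \<omega> i"
proof -
  define S where "S = {i. \<beta> \<bullet> \<omega> i \<noteq> 0}"
  have "S \<noteq> {}"
  proof
    assume "S = {}"
    then have "\<beta> = 0" by (intro eq_by_coords) (auto simp: S_def)
    then show False using pos_root[OF assms(1)] zero_not_root by simp
  qed
  have "S = UNIV"
  proof (rule ccontr)
    assume "S \<noteq> UNIV"
    with \<open>S \<noteq> {}\<close> obtain i j where ij: "i \<in> S" "j \<in> - S" "\<alpha> i \<bullet> \<alpha> j \<noteq> 0"
      using irreducible_base by blast
    have "\<alpha> j \<bullet> \<beta> = (\<Sum>k\<in>UNIV. (\<beta> \<bullet> \<omega> k) * (\<alpha> j \<bullet> \<alpha> k))" by (rule inner_coords)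
    also have "\<dots> < (\<Sum>k\<in>(UNIV::'i set). 0)"
    proof (rule sum_strict_mono_ex1)
      show "\<forall>k\<in>UNIV. (\<beta> \<bullet> \<omega> k) * (\<alpha> j \<bullet> \<alpha> k) \<le> 0"
      proof
        fix k show "(\<beta> \<bullet> \<omega> k) * (\<alpha> j \<bullet> \<alpha> k) \<le> 0"
        proof (cases "k = j")
          case True then show ?thesis using ij by (simp add: S_def)
        next
          case False
          then show ?thesis using simple_inner_nonpos[of j k] pos_coord[OF assms(1), of k]
            by (simp add: mult_nonneg_nonpos)
        qed
      qed
      have "\<alpha> j \<bullet> \<alpha> i < 0" using ij simple_inner_nonpos[of j i] by (cases "i = j") (auto simp: inner_commute)
      moreover have "0 < \<beta> \<bullet> \<omega> i" using ij pos_coord[OF assms(1), of i] by (simp add: S_def less_le)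
      ultimately show "\<exists>k\<in>UNIV. (\<beta> \<bullet> \<omega> k) * (\<alpha> j \<bullet> \<alpha> k) < 0" by (intro bexI[of _ i] mult_pos_neg) auto
    qed simp
    finally have "\<beta> \<bullet> \<alpha> j < 0" by (simp add: inner_commute)
    then show False using assms(2) by (auto simp: dominant_def not_le[symmetric])
  qed
  then have "i \<in> S" by simp
  then show ?thesis using pos_coord[OF assms(1), of i] by (simp add: S_def)
qed

lemma dominant_inner_pos:
  assumes "\<beta> \<in> P" "dominant \<beta>" "\<gamma> \<in> P" "dominant \<gamma>" shows "0 < \<beta> \<bullet> \<gamma>"
proof -
  obtain i where i: "0 < \<beta> \<bullet> \<alpha> i" using ex_simple_pos_inner[OF assms(1)] by blast
  have "0 < (\<Sum>i\<in>UNIV. (\<gamma> \<bullet> \<omega> i) * (\<beta> \<bullet> \<alpha> i))"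
    using assms(2) dominant_full_support[OF assms(3,4)] i
    by (intro sum_pos2[of _ i]) (auto simp: dominant_def intro: mult_pos_pos mult_nonneg_nonneg less_imp_le)
  then show ?thesis by (simp only: inner_coords[symmetric])
qed

text \<open>Of the two Cartan integers of a nonproportional acute pair one equals \<open>1\<close>, because their product is
  less than \<open>4\<close> by the Cauchy--Schwarz inequality; the corresponding reflection yields the difference.\<close>

lemma acute_pair:
  assumes "\<beta> \<in> \<Phi>" "\<gamma> \<in> \<Phi>" "0 < \<beta> \<bullet> \<gamma>"
  shows "\<beta> - \<gamma> \<in> \<Phi> \<or> (\<exists>c>0. \<beta> = c *\<^sub>R \<gamma>)"
proof (cases "\<beta> - \<gamma> \<in> \<Phi>")
  case False
  have z: "\<beta> \<noteq> 0" "\<gamma> \<noteq> 0" using assms zero_not_root by auto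
  then have nn: "0 < \<beta> \<bullet> \<beta>" "0 < \<gamma> \<bullet> \<gamma>" by auto
  define a where "a = \<beta> \<bullet> coroot \<gamma>"
  define b where "b = \<gamma> \<bullet> coroot \<beta>"
  have ab: "a \<in> \<int>" "b \<in> \<int>" using coroot_int assms by (auto simp: a_def b_def)
  have pos: "0 < a" "0 < b" using assms(3) nn by (auto simp: a_def b_def coroot_def inner_commute)
  have "a \<noteq> 1"
    using refl_root[OF assms(2,1)] False by (auto simp: refl_eq' a_def)
  moreover have "b \<noteq> 1"
  proof
    assume "b = 1"
    then have "\<gamma> - \<beta> \<in> \<Phi>" using refl_root[OF assms(1,2)] by (simp add: refl_eq' b_def)
    then have "- (\<gamma> - \<beta>) \<in> \<Phi>" by (rule neg_root)
    then show False using False by simp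
  qed
  ultimately have "2 \<le> a" "2 \<le> b" using ab pos by (auto elim!: Ints_cases)
  then have "2 * 2 \<le> a * b" using pos by (intro mult_mono) auto
  moreover have "a * b = 4 * (\<beta> \<bullet> \<gamma>)\<^sup>2 / ((\<beta> \<bullet> \<beta>) * (\<gamma> \<bullet> \<gamma>))"
    by (simp add: a_def b_def coroot_def power2_eq_square inner_commute)
  ultimately have "(\<beta> \<bullet> \<beta>) * (\<gamma> \<bullet> \<gamma>) \<le> (\<beta> \<bullet> \<gamma>)\<^sup>2"
    using nn by (simp add: field_simps)
  then have "(\<beta> \<bullet> \<beta>) * (\<gamma> \<bullet> \<gamma>) = (\<beta> \<bullet> \<gamma>)\<^sup>2"
    using Cauchy_Schwarz_ineq[of \<beta> \<gamma>] by linarith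
  then have e: "(\<beta> \<bullet> \<gamma>) * (\<beta> \<bullet> \<gamma>) = (\<beta> \<bullet> \<beta>) * (\<gamma> \<bullet> \<gamma>)" by (simp add: power2_eq_square)
  define c where "c = (\<beta> \<bullet> \<gamma>) / (\<gamma> \<bullet> \<gamma>)"
  have "(\<beta> - c *\<^sub>R \<gamma>) \<bullet> (\<beta> - c *\<^sub>R \<gamma>) = \<beta> \<bullet> \<beta> - 2 * c * (\<beta> \<bullet> \<gamma>) + c * c * (\<gamma> \<bullet> \<gamma>)"
    by (simp add: inner_diff_left inner_diff_right inner_commute)
  also have "c * c * (\<gamma> \<bullet> \<gamma>) = c * (\<beta> \<bullet> \<gamma>)" using nn by (simp add: c_def)
  also have "c * (\<beta> \<bullet> \<gamma>) = \<beta> \<bullet> \<beta>" using nn e by (simp add: c_def)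
  also have "2 * c * (\<beta> \<bullet> \<gamma>) = 2 * (\<beta> \<bullet> \<beta>)" using \<open>c * (\<beta> \<bullet> \<gamma>) = \<beta> \<bullet> \<beta>\<close> by simp
  finally have "\<beta> - c *\<^sub>R \<gamma> = 0" by simp
  then have "\<beta> = c *\<^sub>R \<gamma>" by simp
  moreover have "0 < c" using nn assms(3) by (simp add: c_def)
  ultimately show ?thesis by blast
qed simp

text \<open>Two dominant positive roots have positive inner product, so they are comparable: their difference is
  a root or they are proportional.\<close>

lemma dominant_below_highest:
  assumes "\<phi> \<in> P" "dominant \<phi>" "\<And>\<beta>. \<beta> \<in> \<Phi> \<Longrightarrow> \<rho> \<bullet> \<beta> \<le> \<rho> \<bullet> \<phi>" "\<gamma> \<in> P" "dominant \<gamma>"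
  shows "0 \<le> (\<phi> - \<gamma>) \<bullet> \<omega> i"
proof -
  have "0 < \<gamma> \<bullet> \<phi>" using dominant_inner_pos assms by blast
  then consider "\<gamma> - \<phi> \<in> \<Phi>" | c where "0 < c" "\<gamma> = c *\<^sub>R \<phi>"
    using acute_pair[OF pos_root[OF assms(4)] pos_root[OF assms(1)]] by blast
  then show ?thesis
  proof cases
    case 1
    have "\<rho> \<bullet> (\<gamma> - \<phi>) \<le> 0" using assms(3)[OF pos_root[OF assms(4)]] by (simp add: inner_diff_right)
    then have "\<gamma> - \<phi> \<notin> P" using rho_pos[of "\<gamma> - \<phi>"] by auto
    then have "- (\<gamma> - \<phi>) \<in> P" using pos_or_neg[OF 1] by blast
    then show ?thesis using pos_coord[of "-(\<gamma> - \<phi>)" i] by simp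
  next
    case 2
    have "c * (\<rho> \<bullet> \<phi>) \<le> 1 * (\<rho> \<bullet> \<phi>)" using assms(3)[OF pos_root[OF assms(4)]] 2 by simp
    then have "c \<le> 1" using rho_pos[OF assms(1)] by simp
    then have "c * (\<phi> \<bullet> \<omega> i) \<le> 1 * (\<phi> \<bullet> \<omega> i)" using pos_coord[OF assms(1), of i] by (intro mult_right_mono)
    then show ?thesis using 2 by (simp add: inner_diff_left)
  qed
qed

text \<open>A root of maximal height among those above \<open>\<beta>\<close> is dominant, since a simple reflection at an obtuse
  angle would raise it further. It is positive because a dominant negative root would have negative
  norm.\<close>

lemma below_dominant:
  assumes "\<beta> \<in> \<Phi>"
  shows "\<exists>\<gamma>\<in>P. dominant \<gamma> \<and> (\<forall>i. \<beta> \<bullet> \<omega> i \<le> \<gamma> \<bullet> \<omega> i)"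
proof -
  define U where "U = {\<gamma> \<in> \<Phi>. \<forall>i. \<beta> \<bullet> \<omega> i \<le> \<gamma> \<bullet> \<omega> i}"
  have U: "finite U" "U \<noteq> {}" using finite_roots assms by (auto simp: U_def)
  obtain \<gamma> where g: "\<gamma> \<in> U" "\<And>\<delta>. \<delta> \<in> U \<Longrightarrow> \<rho> \<bullet> \<delta> \<le> \<rho> \<bullet> \<gamma>"
    using finite_has_maximal[of "(\<lambda>\<gamma>. \<rho> \<bullet> \<gamma>) ` U"] U by (force simp: image_iff)
  have gR: "\<gamma> \<in> \<Phi>" using g(1) by (simp add: U_def)
  have "dominant \<gamma>"
    unfolding dominant_def
  proof (rule ccontr)
    assume "\<not> (\<forall>i. 0 \<le> \<gamma> \<bullet> \<alpha> i)"
    then obtain i where i: "\<gamma> \<bullet> \<alpha> i < 0" by (auto simp: not_le)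
    note r = reflect_raises_height[OF gR i]
    have "\<gamma> \<bullet> \<omega> j \<le> reflect (\<alpha> i) \<gamma> \<bullet> \<omega> j" for j
    proof (cases "j = i")
      case True
      have "\<gamma> \<bullet> coroot (\<alpha> i) \<le> 0"
        using r(2) refl_coord_diff[of \<gamma> i] by (simp add: inner_diff_right)
      then show ?thesis by (simp add: True refl_eq' inner_diff_left simple_coweight)
    qed (simp add: refl_simple_coord)
    then have "reflect (\<alpha> i) \<gamma> \<in> U" using r(1) g(1) by (auto simp: U_def intro: order_trans)
    then show False using g(2) r(2) by fastforce
  qed
  moreover have "\<gamma> \<in> P"
  proof (rule ccontr)
    assume "\<gamma> \<notin> P"
    then have n: "- \<gamma> \<in> P" using pos_or_neg[OF gR] by blast
    have "0 \<le> (\<Sum>i\<in>UNIV. (- \<gamma> \<bullet> \<omega> i) * (\<gamma> \<bullet> \<alpha> i))"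
      using \<open>dominant \<gamma>\<close> pos_coord[OF n] by (intro sum_nonneg mult_nonneg_nonneg) (auto simp: dominant_def)
    then have "0 \<le> \<gamma> \<bullet> - \<gamma>" by (simp only: inner_coords[symmetric])
    then have "\<gamma> \<bullet> \<gamma> = 0" using inner_ge_zero[of \<gamma>] by (simp only: inner_minus_right)
    then show False using gR zero_not_root by simp
  qed
  ultimately show ?thesis using g(1) by (auto simp: U_def)
qed

abbreviation "\<phi> \<equiv> highest_root \<Phi> \<alpha>"

text \<open>A dominant positive root of maximal height lies above all dominant positive roots and hence above
  all roots.\<close>

lemma highest: "\<phi> \<in> \<Phi>" "\<beta> \<in> \<Phi> \<Longrightarrow> nonneg_comb \<alpha> (\<phi> - \<beta>)"
proof -
  obtain \<psi> where m: "\<psi> \<in> \<Phi>" "\<And>\<beta>. \<beta> \<in> \<Phi> \<Longrightarrow> \<rho> \<bullet> \<beta> \<le> \<rho> \<bullet> \<psi>"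
    using finite_has_maximal[of "(\<lambda>\<gamma>. \<rho> \<bullet> \<gamma>) ` \<Phi>"] finite_roots simple_in by (force simp: image_iff)
  obtain \<mu> where c: "\<mu> \<in> P" "dominant \<mu>" "\<And>i. \<psi> \<bullet> \<omega> i \<le> \<mu> \<bullet> \<omega> i"
    using below_dominant[OF m(1)] by blast
  have "\<rho> \<bullet> \<psi> \<le> \<rho> \<bullet> \<mu>" unfolding rho_inner by (intro sum_mono c(3))
  then have mc: "\<And>\<beta>. \<beta> \<in> \<Phi> \<Longrightarrow> \<rho> \<bullet> \<beta> \<le> \<rho> \<bullet> \<mu>" using m(2) order_trans by blast
  have top: "nonneg_comb \<alpha> (\<mu> - \<beta>)" if b: "\<beta> \<in> \<Phi>" for \<beta>
    unfolding nonneg_comb_iff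
  proof
    fix i
    obtain \<gamma> where "\<gamma> \<in> P" "dominant \<gamma>" "\<beta> \<bullet> \<omega> i \<le> \<gamma> \<bullet> \<omega> i" using below_dominant[OF b] by blast
    then have "0 \<le> (\<mu> - \<beta>) \<bullet> \<omega> i" using dominant_below_highest[OF c(1,2) mc, of \<gamma> i] by (simp add: inner_diff_left)
    moreover have "(\<mu> - \<beta>) \<bullet> \<omega> i \<in> \<int>"
      using Ints_coord[OF b, of i] Ints_coord[OF pos_root[OF c(1)], of i] by (simp add: inner_diff_left)
    ultimately show "(\<mu> - \<beta>) \<bullet> \<omega> i \<in> \<nat>" by (simp add: Nats_altdef2)
  qed
  have "\<exists>!\<phi>. \<phi> \<in> \<Phi> \<and> (\<forall>\<beta>\<in>\<Phi>. nonneg_comb \<alpha> (\<phi> - \<beta>))"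
  proof (rule ex1I[of _ \<mu>])
    show "\<mu> \<in> \<Phi> \<and> (\<forall>\<beta>\<in>\<Phi>. nonneg_comb \<alpha> (\<mu> - \<beta>))" using top pos_root[OF c(1)] by blast
    fix \<eta> assume e: "\<eta> \<in> \<Phi> \<and> (\<forall>\<beta>\<in>\<Phi>. nonneg_comb \<alpha> (\<eta> - \<beta>))"
    show "\<eta> = \<mu>"
    proof (rule eq_by_coords)
      fix i
      have "nonneg_comb \<alpha> (\<eta> - \<mu>)" "nonneg_comb \<alpha> (\<mu> - \<eta>)" using e top pos_root[OF c(1)] by blast+
      then have "0 \<le> (\<eta> - \<mu>) \<bullet> \<omega> i" "0 \<le> (\<mu> - \<eta>) \<bullet> \<omega> i" by (auto simp: nonneg_comb_iff intro: Nats_nonneg)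
      then show "\<eta> \<bullet> \<omega> i = \<mu> \<bullet> \<omega> i" by (simp add: inner_diff_left)
    qed
  qed
  from theI'[OF this] show "\<phi> \<in> \<Phi>" "\<beta> \<in> \<Phi> \<Longrightarrow> nonneg_comb \<alpha> (\<phi> - \<beta>)"
    unfolding highest_root_def by blast+
qed

lemma highest_coord: "\<beta> \<in> \<Phi> \<Longrightarrow> \<beta> \<bullet> \<omega> i \<le> \<phi> \<bullet> \<omega> i"
  using highest(2)[of \<beta>] Nats_nonneg[of "(\<phi> - \<beta>) \<bullet> \<omega> i"] by (simp add: nonneg_comb_iff inner_diff_left)

lemma highest_coord_pos: "1 \<le> \<phi> \<bullet> \<omega> i"
  using highest_coord[OF simple_in, of i i] by (simp add: simple_coweight)

lemma highest_pos: "\<phi> \<in> P"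
  by (rule pos_by_coord[OF highest(1), of undefined]) (use highest_coord_pos[of undefined] in linarith)

lemma highest_dominant: "dominant \<phi>"
  unfolding dominant_def
proof
  fix i
  have "0 \<le> (\<phi> - reflect (\<alpha> i) \<phi>) \<bullet> \<omega> i"
    using highest_coord[OF refl_root[OF simple_in[of i] highest(1)], of i] by (simp add: inner_diff_left)
  then have "0 \<le> \<phi> \<bullet> coroot (\<alpha> i)" by (simp add: refl_eq' simple_coweight)
  then show "0 \<le> \<phi> \<bullet> \<alpha> i" using simple_norm_pos[of i] by (simp add: coroot_def zero_le_divide_iff)
qed

text \<open>If the Cartan integer were at least \<open>2\<close>, the negative of the reflected root would exceed \<open>\<phi>\<close>.\<close>

lemma highest_coroot:
  assumes "\<beta> \<in> P" "\<beta> \<noteq> \<phi>" shows "\<beta> \<bullet> coroot \<phi> = 0 \<or> \<beta> \<bullet> coroot \<phi> = 1"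
proof -
  have z: "0 < \<phi> \<bullet> \<phi>" using highest(1) zero_not_root by auto
  let ?n = "\<beta> \<bullet> coroot \<phi>"
  have i: "?n \<in> \<int>" using coroot_int highest(1) pos_root assms(1) by blast
  have "0 \<le> (\<Sum>i\<in>UNIV. (\<beta> \<bullet> \<omega> i) * (\<phi> \<bullet> \<alpha> i))"
    using highest_dominant pos_coord[OF assms(1)]
    by (intro sum_nonneg mult_nonneg_nonneg) (auto simp: dominant_def)
  then have "0 \<le> \<phi> \<bullet> \<beta>" by (simp only: inner_coords[symmetric])
  then have "0 \<le> ?n" using z by (simp add: coroot_def inner_commute)
  moreover have "\<not> 2 \<le> ?n"
  proof
    assume n: "2 \<le> ?n"
    have "- reflect \<phi> \<beta> \<in> \<Phi>" by (intro neg_root refl_root highest(1) pos_root assms(1))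
    then have r: "(?n *\<^sub>R \<phi> - \<beta>) \<in> \<Phi>" by (simp add: refl_eq')
    have "\<beta> = \<phi>"
    proof (rule eq_by_coords)
      fix i
      have "?n * (\<phi> \<bullet> \<omega> i) - \<beta> \<bullet> \<omega> i \<le> \<phi> \<bullet> \<omega> i"
        using highest_coord[OF r, of i] by (simp add: inner_diff_left)
      moreover have "2 * (\<phi> \<bullet> \<omega> i) \<le> ?n * (\<phi> \<bullet> \<omega> i)"
        using n highest_coord_pos[of i] by (intro mult_right_mono) auto
      ultimately show "\<beta> \<bullet> \<omega> i = \<phi> \<bullet> \<omega> i" using highest_coord[OF pos_root[OF assms(1)], of i] by linarith
    qed
    then show False using assms(2) by blast
  qed
  ultimately show ?thesis using i by (auto elim!: Ints_cases)
qed

section \<open>Weyl groups\<close>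

abbreviation "W0 \<equiv> finite_weyl \<alpha>"
abbreviation "We \<equiv> ext_weyl \<alpha>"
abbreviation "\<Sigma> \<equiv> alcove_stabilizer \<Phi> \<alpha>"
abbreviation "s \<equiv> gen \<Phi> \<alpha>"

lemma simple_nz: "\<alpha> i \<noteq> 0"
  using simple_in[of i] zero_not_root by auto

lemma reflect_reflect_comp: "\<beta> \<noteq> 0 \<Longrightarrow> reflect \<beta> \<circ> reflect \<beta> = id"
  by (rule ext) (simp add: refl_refl)

lemma inv_reflect: "\<beta> \<noteq> 0 \<Longrightarrow> inv (reflect \<beta>) = reflect \<beta>"
  by (rule inv_unique_comp) (rule reflect_reflect_comp, assumption)+

lemma parabolic_id: "id \<in> parabolic \<alpha> J"
  unfolding parabolic_def by (rule generated_group.intros)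

lemma parabolic_step: "w \<in> parabolic \<alpha> J \<Longrightarrow> j \<in> J \<Longrightarrow> w \<circ> reflect (\<alpha> j) \<in> parabolic \<alpha> J"
  unfolding parabolic_def by (rule generated_group.intros) auto

lemma parabolic_induct [consumes 1, case_names id step]:
  assumes "w \<in> parabolic \<alpha> J" "Q id"
    "\<And>w j. w \<in> parabolic \<alpha> J \<Longrightarrow> Q w \<Longrightarrow> j \<in> J \<Longrightarrow> Q (w \<circ> reflect (\<alpha> j))"
  shows "Q w"
  using assms(1) unfolding parabolic_def
proof induction
  case 1 show ?case using assms(2) by (simp add: id_def)
next
  case (2 w x)
  then show ?case using assms(3)[of w] unfolding parabolic_def by (auto simp: comp_def)
next
  case (3 w x)
  then obtain j where j: "j \<in> J" "x = reflect (\<alpha> j)" by blast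
  then have "Q (w \<circ> inv x)" using 3 assms(3)[of w j] inv_reflect[OF simple_nz[of j]] unfolding parabolic_def by simp
  then show ?case by (simp add: comp_def)
qed

lemma parabolic_comp: "x \<in> parabolic \<alpha> J \<Longrightarrow> w \<in> parabolic \<alpha> J \<Longrightarrow> x \<circ> w \<in> parabolic \<alpha> J"
proof -
  assume x: "x \<in> parabolic \<alpha> J" and w: "w \<in> parabolic \<alpha> J"
  from w show ?thesis
  proof (induction rule: parabolic_induct)
    case (step w j)
    then show ?case using parabolic_step[of "x \<circ> w" J j] by (simp only: o_assoc)
  qed (simp add: x)
qed

lemma parabolic_gen: "j \<in> J \<Longrightarrow> reflect (\<alpha> j) \<in> parabolic \<alpha> J"
  using parabolic_step[OF parabolic_id] by simp

lemma parabolic_mono: "w \<in> parabolic \<alpha> J \<Longrightarrow> J \<subseteq> K \<Longrightarrow> w \<in> parabolic \<alpha> K"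
  by (induction rule: parabolic_induct) (auto simp: parabolic_id parabolic_step)

lemma W0_orthogonal: "w \<in> W0 \<Longrightarrow> orthogonal_transformation w"
proof (induction rule: parabolic_induct)
  case (step w j)
  show ?case by (rule orthogonal_transformation_compose[OF step.IH orthogonal_refl[OF simple_nz]])
qed (simp add: id_def orthogonal_transformation_id)

lemma W0_roots: "w \<in> W0 \<Longrightarrow> w ` \<Phi> = \<Phi>"
proof (induction rule: parabolic_induct)
  case (step w j)
  then show ?case using refl_image[OF simple_in[of j]] by (simp only: image_comp[symmetric])
qed simp

lemma W0_root: "w \<in> W0 \<Longrightarrow> \<beta> \<in> \<Phi> \<Longrightarrow> w \<beta> \<in> \<Phi>"
  using W0_roots by blast

lemma W0_bij: "w \<in> W0 \<Longrightarrow> bij w"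
  using W0_orthogonal orthogonal_transformation_bij by blast

lemma parabolic_W0: "w \<in> parabolic \<alpha> J \<Longrightarrow> w \<in> W0"
  using parabolic_mono by blast

lemma parabolic_inv: "w \<in> parabolic \<alpha> J \<Longrightarrow> inv w \<in> parabolic \<alpha> J"
proof (induction rule: parabolic_induct)
  case id show ?case unfolding inv_id by (rule parabolic_id)
next
  case (step w j)
  have "inv (w \<circ> reflect (\<alpha> j)) = reflect (\<alpha> j) \<circ> inv w"
    using W0_bij[OF parabolic_W0[OF step.hyps(1)]] W0_bij[OF parabolic_gen[of j UNIV]]
    by (simp add: o_inv_distrib inv_reflect simple_nz)
  then show ?case using parabolic_comp[OF parabolic_gen[OF step.hyps(2)] step.IH] by (simp only:)
qed

lemma W0_linear: "w \<in> W0 \<Longrightarrow> linear w"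
  using W0_orthogonal orthogonal_transformation_linear by blast

lemma W0_zero: "w \<in> W0 \<Longrightarrow> w 0 = 0"
  using W0_linear linear_0 by blast

lemma W0_inner: "w \<in> W0 \<Longrightarrow> w x \<bullet> w y = x \<bullet> y"
  using W0_orthogonal by (simp add: orthogonal_transformation_def)

lemma inv_f_f': "bij w \<Longrightarrow> inv w (w x) = x" and f_inv_f': "bij w \<Longrightarrow> w (inv w x) = x"
  by (simp_all add: bij_is_inj bij_is_surj inv_f_f surj_f_inv_f)

lemma W0_adjoint: "w \<in> W0 \<Longrightarrow> w x \<bullet> y = x \<bullet> inv w y"
  using W0_inner[of w x "inv w y"] f_inv_f'[OF W0_bij, of w y] by simp

lemma reflect_conj: "orthogonal_transformation z \<Longrightarrow> reflect (z \<beta>) (z x) = z (reflect \<beta> x)"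
  by (simp add: refl_eq coroot_def orthogonal_transformation_def linear_diff linear_scale)

lemma span_J_iff: "x \<in> span (\<alpha> ` J) \<longleftrightarrow> (\<forall>i. i \<notin> J \<longrightarrow> x \<bullet> \<omega> i = 0)"
proof
  assume "x \<in> span (\<alpha> ` J)"
  then show "\<forall>i. i \<notin> J \<longrightarrow> x \<bullet> \<omega> i = 0"
  proof (rule span_induct)
    show "subspace {x. \<forall>i. i \<notin> J \<longrightarrow> x \<bullet> \<omega> i = 0}" by (auto simp: subspace_def inner_left_distrib)
  qed (auto simp: simple_coweight)
next
  assume z: "\<forall>i. i \<notin> J \<longrightarrow> x \<bullet> \<omega> i = 0"
  have "(\<Sum>i\<in>UNIV. (x \<bullet> \<omega> i) *\<^sub>R \<alpha> i) \<in> span (\<alpha> ` J)"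
  proof (rule span_sum)
    fix i show "(x \<bullet> \<omega> i) *\<^sub>R \<alpha> i \<in> span (\<alpha> ` J)"
      by (cases "i \<in> J") (use z in \<open>auto intro: span_scale span_base span_zero\<close>)
  qed
  then show "x \<in> span (\<alpha> ` J)" by (simp only: coords[symmetric])
qed

text \<open>By descent on the root: \<open>W\<^sub>J\<close> conjugates the reflection to one in a multiple of a simple root in \<open>J\<close>.\<close>

lemma reflection_parabolic:
  assumes "\<beta> \<in> roots_J \<Phi> \<alpha> J" shows "reflect \<beta> \<in> parabolic \<alpha> J"
proof -
  have pos: "\<gamma> \<in> span (\<alpha> ` J) \<longrightarrow> reflect \<gamma> \<in> parabolic \<alpha> J" if "\<gamma> \<in> P" for \<gamma>
    using that
  proof (induction rule: pos_descent_induct)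
    case (multiple i c)
    show ?case
    proof
      assume "c *\<^sub>R \<alpha> i \<in> span (\<alpha> ` J)"
      then have "i \<in> J" using multiple(1) by (auto simp: span_J_iff simple_coweight)
      then show "reflect (c *\<^sub>R \<alpha> i) \<in> parabolic \<alpha> J"
        using multiple(1) by (simp add: refl_scale parabolic_gen)
    qed
  next
    case (descent \<beta> i)
    show ?case
    proof
      assume b: "\<beta> \<in> span (\<alpha> ` J)"
      then have i: "i \<in> J" using descent(2) by (auto simp: span_J_iff)
      have "reflect (\<alpha> i) \<beta> \<in> span (\<alpha> ` J)"
        unfolding refl_eq' using b i by (intro span_diff span_scale) (auto intro: span_base)
      then have r: "reflect (reflect (\<alpha> i) \<beta>) \<in> parabolic \<alpha> J" using descent by blast
      have "reflect \<beta> = reflect (\<alpha> i) \<circ> reflect (reflect (\<alpha> i) \<beta>) \<circ> reflect (\<alpha> i)"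
        using reflect_conj[OF orthogonal_refl[OF simple_nz[of i]], of \<beta>]
        by (intro ext) (simp add: refl_refl simple_nz)
      then show "reflect \<beta> \<in> parabolic \<alpha> J"
        using parabolic_comp parabolic_gen[OF i] r by simp
    qed
  qed
  have b: "\<beta> \<in> \<Phi>" "\<beta> \<in> span (\<alpha> ` J)" using assms by (auto simp: roots_J_def)
  from pos_or_neg[OF b(1)] show ?thesis
  proof
    assume "- \<beta> \<in> P"
    then have "reflect (- \<beta>) \<in> parabolic \<alpha> J" using pos[of "-\<beta>"] span_neg[OF b(2)] by blast
    then show ?thesis using refl_scale[of "-1" \<beta>] by simp
  qed (use pos b in blast)
qed

lemma roots_J_UNIV: "roots_J \<Phi> \<alpha> UNIV = \<Phi>"
  using span_simple by (simp add: roots_J_def)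

lemma reflection_W0: "\<beta> \<in> \<Phi> \<Longrightarrow> reflect \<beta> \<in> W0"
  using reflection_parabolic[of \<beta> UNIV] by (simp add: roots_J_UNIV)

lemma parabolic_span: assumes "x \<in> parabolic \<alpha> J"
  shows "\<beta> \<in> span (\<alpha> ` J) \<Longrightarrow> x \<beta> \<in> span (\<alpha> ` J)"
  using assms
proof (induction arbitrary: \<beta> rule: parabolic_induct)
  case (step w j)
  have "reflect (\<alpha> j) \<beta> \<in> span (\<alpha> ` J)"
    unfolding refl_eq' using step.hyps step.prems by (intro span_diff span_scale) (auto intro: span_base)
  then show ?case using step.IH by simp
qed simp

lemma parabolic_roots_J: "x \<in> parabolic \<alpha> J \<Longrightarrow> \<beta> \<in> roots_J \<Phi> \<alpha> J \<Longrightarrow> x \<beta> \<in> roots_J \<Phi> \<alpha> J"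
  using parabolic_span W0_root parabolic_W0 by (auto simp: roots_J_def)

text \<open>An element of \<open>W\<^sub>J\<close> does not change the coordinates outside \<open>J\<close>, and for a root outside \<open>\<Phi>\<^sub>J\<close> one of
  these is nonzero and gives its sign.\<close>

lemma parabolic_pos_iff:
  assumes "x \<in> parabolic \<alpha> J" "\<beta> \<in> \<Phi>" "\<beta> \<notin> roots_J \<Phi> \<alpha> J"
  shows "x \<beta> \<in> P \<longleftrightarrow> \<beta> \<in> P"
proof -
  have c: "x \<gamma> \<bullet> \<omega> i = \<gamma> \<bullet> \<omega> i" if "i \<notin> J" for i \<gamma>
    using assms(1)
  proof (induction arbitrary: \<gamma> rule: parabolic_induct)
    case (step w j)
    then show ?case using that refl_simple_coord[of i j \<gamma>] by auto
  qed simp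
  obtain i where i: "i \<notin> J" "\<beta> \<bullet> \<omega> i \<noteq> 0"
    using assms(2,3) by (auto simp: roots_J_def span_J_iff)
  have pc: "\<gamma> \<in> P \<longleftrightarrow> 0 < \<gamma> \<bullet> \<omega> i" if "\<gamma> \<in> \<Phi>" "\<gamma> \<bullet> \<omega> i \<noteq> 0" for \<gamma>
    using pos_by_coord[OF that(1)] pos_coord[of \<gamma> i] that(2) by fastforce
  have "x \<beta> \<in> \<Phi>" using W0_root[OF parabolic_W0[OF assms(1)] assms(2)] .
  then show ?thesis using pc[of \<beta>] pc[of "x \<beta>"] c[OF i(1), of \<beta>] i(2) assms(2) by simp
qed

lemma eq_by_simple: assumes "\<And>i. x \<bullet> \<alpha> i = y \<bullet> \<alpha> i" shows "x = y"
proof -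
  have "(x - y) \<bullet> (x - y) = (\<Sum>i\<in>UNIV. ((x - y) \<bullet> \<omega> i) * ((x - y) \<bullet> \<alpha> i))" by (rule inner_coords)
  also have "\<dots> = 0" using assms by (simp add: inner_diff_left)
  finally show ?thesis by simp
qed

text \<open>The coweight lattice is described by integrality against all roots, which is visibly invariant
  under \<open>W\<^sub>0\<close>.\<close>

lemma lattice_iff: "\<mu> \<in> coweight_lattice \<alpha> \<longleftrightarrow> (\<forall>\<beta>\<in>\<Phi>. \<mu> \<bullet> \<beta> \<in> \<int>)"
proof
  assume "\<mu> \<in> coweight_lattice \<alpha>"
  then obtain a :: "'i \<Rightarrow> int" where m: "\<mu> = (\<Sum>i\<in>UNIV. of_int (a i) *\<^sub>R \<omega> i)"
    by (auto simp: coweight_lattice_def)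
  show "\<forall>\<beta>\<in>\<Phi>. \<mu> \<bullet> \<beta> \<in> \<int>"
  proof
    fix \<beta> assume b: "\<beta> \<in> \<Phi>"
    have "\<mu> \<bullet> \<beta> = (\<Sum>i\<in>UNIV. of_int (a i) * (\<beta> \<bullet> \<omega> i))"
      by (simp add: m inner_sum_left inner_commute[of \<beta>])
    also have "\<dots> \<in> \<int>" by (intro Ints_sum Ints_mult Ints_coord[OF b]) auto
    finally show "\<mu> \<bullet> \<beta> \<in> \<int>" .
  qed
next
  assume "\<forall>\<beta>\<in>\<Phi>. \<mu> \<bullet> \<beta> \<in> \<int>"
  then have "\<forall>i. \<exists>n. \<mu> \<bullet> \<alpha> i = of_int n" using simple_in by (auto elim!: Ints_cases)
  then obtain a where a: "\<And>i. \<mu> \<bullet> \<alpha> i = of_int (a i)" by metis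
  have "\<mu> = (\<Sum>i\<in>UNIV. of_int (a i) *\<^sub>R \<omega> i)"
    by (rule eq_by_simple)
      (simp add: a inner_sum_left coweight_simple if_distrib[of "\<lambda>c. _ * c"] cong: if_cong)
  then show "\<mu> \<in> coweight_lattice \<alpha>" by (auto simp: coweight_lattice_def)
qed

lemma lattice_add: "\<mu> \<in> coweight_lattice \<alpha> \<Longrightarrow> \<nu> \<in> coweight_lattice \<alpha> \<Longrightarrow> \<mu> + \<nu> \<in> coweight_lattice \<alpha>"
  by (simp add: lattice_iff inner_left_distrib)

lemma lattice_minus: "\<mu> \<in> coweight_lattice \<alpha> \<Longrightarrow> - \<mu> \<in> coweight_lattice \<alpha>"
  by (simp add: lattice_iff)

lemma lattice_zero: "0 \<in> coweight_lattice \<alpha>"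
  by (simp add: lattice_iff)

lemma lattice_W0: "\<mu> \<in> coweight_lattice \<alpha> \<Longrightarrow> w \<in> W0 \<Longrightarrow> w \<mu> \<in> coweight_lattice \<alpha>"
  using W0_root[OF parabolic_inv] by (auto simp: lattice_iff W0_adjoint)

lemma ext_weyl_form:
  assumes "w \<in> We"
  shows "wt w \<in> coweight_lattice \<alpha>" "linear_part w \<in> W0" "w x = wt w + linear_part w x"
proof -
  obtain \<mu> u where w: "\<mu> \<in> coweight_lattice \<alpha>" "u \<in> W0" "w = translation \<mu> \<circ> u"
    using assms by (auto simp: ext_weyl_def)
  then have "wt w = \<mu>" "linear_part w = u"
    by (auto simp: wt_def linear_part_def translation_def W0_zero fun_eq_iff)
  then show "wt w \<in> coweight_lattice \<alpha>" "linear_part w \<in> W0" "w x = wt w + linear_part w x"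
    using w by (auto simp: translation_def)
qed

lemma ext_weylI: "\<mu> \<in> coweight_lattice \<alpha> \<Longrightarrow> u \<in> W0 \<Longrightarrow> translation \<mu> \<circ> u \<in> We"
  by (auto simp: ext_weyl_def)

lemma ext_weyl_decomp: "w \<in> We \<Longrightarrow> w = translation (wt w) \<circ> linear_part w"
  by (rule ext) (simp add: translation_def wt_def linear_part_def)

lemma translation_ext: "\<mu> \<in> coweight_lattice \<alpha> \<Longrightarrow> translation \<mu> \<in> We"
  using ext_weylI[OF _ parabolic_id] by simp

lemma W0_ext: "u \<in> W0 \<Longrightarrow> u \<in> We"
  using ext_weylI[OF lattice_zero, of u] by (simp add: translation_def comp_def)

lemma linear_part_W0: "u \<in> W0 \<Longrightarrow> linear_part u = u"
  by (simp add: linear_part_def W0_zero fun_eq_iff)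

lemma ext_comp: assumes "w \<in> We" "w' \<in> We" shows "w \<circ> w' \<in> We"
proof -
  have "w \<circ> w' = translation (wt w + linear_part w (wt w')) \<circ> (linear_part w \<circ> linear_part w')"
    using ext_weyl_form(3)[OF assms(1)] ext_weyl_form(3)[OF assms(2)]
      linear_add[OF W0_linear[OF ext_weyl_form(2)[OF assms(1)]]]
    by (intro ext) (simp add: translation_def)
  then show ?thesis
    using ext_weylI lattice_add lattice_W0 parabolic_comp ext_weyl_form(1,2) assms by metis
qed

lemma linear_part_comp: assumes "w \<in> We" "w' \<in> We"
  shows "linear_part (w \<circ> w') = linear_part w \<circ> linear_part w'"
  using ext_weyl_form(3)[OF assms(1)] linear_diff[OF W0_linear[OF ext_weyl_form(2)[OF assms(1)]]]
  by (intro ext) (simp add: linear_part_def)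

lemma linear_part_translation: "linear_part (translation \<mu>) = id"
  by (intro ext) (simp add: linear_part_def translation_def)

lemma ext_bij: assumes "w \<in> We" shows "bij w"
proof -
  have "bij (translation (wt w))"
    by (rule o_bij[of "translation (- wt w)"]) (auto simp: translation_def fun_eq_iff)
  then show ?thesis
    using ext_weyl_decomp[OF assms] W0_bij[OF ext_weyl_form(2)[OF assms]] bij_comp by metis
qed

lemma ext_inv: assumes "w \<in> We" shows "inv w \<in> We"
proof -
  let ?u = "linear_part w"
  have u: "?u \<in> W0" "inv ?u \<in> W0" using ext_weyl_form(2)[OF assms] parabolic_inv by auto
  have "inv w = translation (inv ?u (- wt w)) \<circ> inv ?u"
  proof (rule inv_unique_comp)
    show "w \<circ> (translation (inv ?u (- wt w)) \<circ> inv ?u) = id"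
      using f_inv_f'[OF W0_bij[OF u(1)]]
      by (intro ext) (simp add: ext_weyl_form(3)[OF assms] translation_def linear_add[OF W0_linear[OF u(1)]])
    show "translation (inv ?u (- wt w)) \<circ> inv ?u \<circ> w = id"
      using inv_f_f'[OF W0_bij[OF u(1)]]
      by (intro ext) (simp add: ext_weyl_form(3)[OF assms] translation_def linear_add[OF W0_linear[OF u(2)]]
          linear_neg[OF W0_linear[OF u(2)]])
  qed
  then show ?thesis
    using ext_weylI lattice_W0 lattice_minus ext_weyl_form(1)[OF assms] u(2) by metis
qed

section \<open>Walls and crossings\<close>

definition grad :: "'i option \<Rightarrow> 'v" where
  "grad i = fst (affine_simple_root \<Phi> \<alpha> i)"

text \<open>The affine functional of the simple affine root: it is nonnegative on the fundamental alcove and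
  vanishes on the hyperplane of the reflection \<open>s i\<close>.\<close>

definition wall :: "'i option \<Rightarrow> 'v \<Rightarrow> real" where
  "wall i x = x \<bullet> grad i + of_int (snd (affine_simple_root \<Phi> \<alpha> i))"

lemma grad_simps [simp]: "grad None = - \<phi>" "grad (Some i) = \<alpha> i"
  by (simp_all add: grad_def)

lemma wall_simps [simp]: "wall None x = 1 - x \<bullet> \<phi>" "wall (Some i) x = x \<bullet> \<alpha> i"
  by (simp_all add: wall_def flip: grad_def)

lemma grad_root: "grad i \<in> \<Phi>"
  by (cases i) (auto simp: simple_in highest(1) neg_root)

lemma grad_nz: "grad i \<noteq> 0"
  using grad_root[of i] zero_not_root by auto

lemma coroot_minus: "coroot (- x) = - coroot x"
  by (simp add: coroot_def)

lemma gen_eq: "s i x = x - wall i x *\<^sub>R coroot (grad i)"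
  by (cases i) (simp_all add: affine_reflection_def coroot_minus algebra_simps)

lemma wall_gen: "wall i (s i x) = - wall i x"
  using coroot_inner_self[OF grad_nz[of i]]
  by (simp add: wall_def gen_eq inner_diff_left inner_commute[of "coroot _"])

lemma gen_gen: "s i (s i x) = x"
  by (simp add: gen_eq[of i "s i x"] wall_gen) (simp add: gen_eq)

lemma gen_gen_comp: "s i \<circ> s i = id"
  by (rule ext) (simp add: gen_gen)

lemma coroot_lattice: "\<beta> \<in> \<Phi> \<Longrightarrow> coroot \<beta> \<in> coweight_lattice \<alpha>"
  using coroot_int by (simp add: lattice_iff inner_commute)

lemma gen_decomp: "s i = translation (s i 0) \<circ> reflect (grad i)"
  by (rule ext) (simp add: gen_eq wall_def translation_def refl_eq algebra_simps)

lemma gen_ext: "s i \<in> We"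
proof -
  have "s i 0 \<in> coweight_lattice \<alpha>"
    using coroot_lattice[OF grad_root[of i]] coroot_lattice[OF highest(1)] by (cases i) (simp_all add: gen_eq lattice_zero coroot_minus lattice_minus del: gen.simps)
  then show ?thesis using gen_decomp[of i] ext_weylI reflection_W0[OF grad_root[of i]] by metis
qed

lemma linear_part_gen: "linear_part (s i) = reflect (grad i)"
  by (rule ext) (simp add: linear_part_def gen_eq wall_def refl_eq algebra_simps)

lemma gen_Some_W0: "s (Some i) \<in> W0"
  using parabolic_gen[of i UNIV] by simp

text \<open>Affine roots are taken as functions, so that the groups act on them by composition.\<close>

definition affine_root :: "('v \<Rightarrow> real) \<Rightarrow> bool" where
  "affine_root f \<longleftrightarrow> (\<exists>\<gamma>\<in>\<Phi>. \<exists>k::int. f = (\<lambda>x. x \<bullet> \<gamma> + of_int k))"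

lemma affine_rootI: "\<gamma> \<in> \<Phi> \<Longrightarrow> affine_root (\<lambda>x. x \<bullet> \<gamma> + of_int k)"
  by (auto simp: affine_root_def)

lemma affine_root_wall: "affine_root (wall i)"
  using affine_rootI[OF grad_root[of i], of "snd (affine_simple_root \<Phi> \<alpha> i)"]
  by (simp add: wall_def[abs_def])

lemma pullback:
  assumes "w \<in> We" "\<gamma> \<in> \<Phi>"
  obtains k' :: int where "\<And>x. w x \<bullet> \<gamma> + of_int k = x \<bullet> inv (linear_part w) \<gamma> + of_int k'"
proof -
  obtain n :: int where n: "wt w \<bullet> \<gamma> = of_int n"
    using ext_weyl_form(1)[OF assms(1)] assms(2) by (auto simp: lattice_iff elim!: Ints_cases)
  have "w x \<bullet> \<gamma> + of_int k = x \<bullet> inv (linear_part w) \<gamma> + of_int (k + n)" for x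
    using ext_weyl_form(3)[OF assms(1), of x] W0_adjoint[OF ext_weyl_form(2)[OF assms(1)]]
    by (simp add: inner_left_distrib n)
  then show thesis by (rule that)
qed

lemma affine_root_comp:
  assumes "affine_root f" "w \<in> We" shows "affine_root (f \<circ> w)"
proof -
  obtain \<gamma> and k :: int where f: "\<gamma> \<in> \<Phi>" "f = (\<lambda>x. x \<bullet> \<gamma> + of_int k)"
    using assms(1) by (auto simp: affine_root_def)
  obtain k' :: int where "\<And>x. w x \<bullet> \<gamma> + of_int k = x \<bullet> inv (linear_part w) \<gamma> + of_int k'"
    using pullback[OF assms(2) f(1)] by blast
  then have "f \<circ> w = (\<lambda>x. x \<bullet> inv (linear_part w) \<gamma> + of_int k')" by (auto simp: f(2))
  moreover have "inv (linear_part w) \<gamma> \<in> \<Phi>"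
    using W0_root[OF parabolic_inv[OF ext_weyl_form(2)[OF assms(2)]] f(1)] .
  ultimately show ?thesis using affine_rootI by metis
qed

lemma affine_root_neg: assumes "affine_root f" shows "affine_root (\<lambda>x. - f x)"
proof -
  obtain \<gamma> and k :: int where f: "\<gamma> \<in> \<Phi>" "f = (\<lambda>x. x \<bullet> \<gamma> + of_int k)"
    using assms(1) by (auto simp: affine_root_def)
  have "(\<lambda>x. - f x) = (\<lambda>x. x \<bullet> (- \<gamma>) + of_int (- k))" by (auto simp: f(2))
  then show ?thesis using affine_rootI[OF neg_root[OF f(1)]] by metis
qed

definition interior :: "'v \<Rightarrow> bool" where
  "interior x \<longleftrightarrow> (\<forall>\<beta>\<in>P. 0 < x \<bullet> \<beta> \<and> x \<bullet> \<beta> < 1)"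

text \<open>A point in the interior of the fundamental alcove. The alcove \<open>w A\<^sub>0\<close> is traced by the
  point \<open>w a0\<close>: an affine root never vanishes there, so the side on which the alcove lies is a sign.\<close>

definition a0 :: 'v where
  "a0 = (1 / (1 + \<rho> \<bullet> \<phi>)) *\<^sub>R \<rho>"

lemma interior_a0: "interior a0"
  unfolding interior_def
proof
  fix \<beta> assume b: "\<beta> \<in> P"
  have "\<rho> \<bullet> \<beta> \<le> \<rho> \<bullet> \<phi>"
    unfolding rho_inner by (intro sum_mono highest_coord[OF pos_root[OF b]])
  then show "0 < a0 \<bullet> \<beta> \<and> a0 \<bullet> \<beta> < 1" using rho_pos[OF b] by (simp add: a0_def)
qed

lemma affine_root_form:
  assumes "affine_root f"
  obtains \<beta> and k :: int where "\<beta> \<in> P" "f = (\<lambda>x. x \<bullet> \<beta> + of_int k)"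
    | \<beta> and k :: int where "\<beta> \<in> P" "f = (\<lambda>x. of_int k - x \<bullet> \<beta>)"
proof -
  obtain \<gamma> and k :: int where f: "\<gamma> \<in> \<Phi>" "f = (\<lambda>x. x \<bullet> \<gamma> + of_int k)"
    using assms(1) by (auto simp: affine_root_def)
  from pos_or_neg[OF f(1)] show thesis
  proof
    assume "- \<gamma> \<in> P" then show thesis using f by (intro that(2)[of "-\<gamma>" k]) (auto simp: fun_eq_iff)
  qed (use that f in blast)
qed

text \<open>The roots take values strictly between \<open>-1\<close> and \<open>1\<close> on the interior, so adding an integer yields a
  constant sign.\<close>

lemma affine_root_sign_interior:
  assumes "affine_root f" "interior x"
  shows "0 < f x \<and> (\<forall>y. interior y \<longrightarrow> 0 < f y) \<and> (\<forall>y\<in>fund_alcove \<Phi> \<alpha>. 0 \<le> f y) \<or>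
    f x < 0 \<and> (\<forall>y. interior y \<longrightarrow> f y < 0) \<and> (\<forall>y\<in>fund_alcove \<Phi> \<alpha>. f y \<le> 0)"
  using assms(1)
proof (cases rule: affine_root_form)
  case (1 \<beta> k)
  have i: "0 < y \<bullet> \<beta>" "y \<bullet> \<beta> < 1" if "interior y" for y using that 1 by (auto simp: interior_def)
  have c: "0 \<le> y \<bullet> \<beta>" "y \<bullet> \<beta> \<le> 1" if "y \<in> fund_alcove \<Phi> \<alpha>" for y using that 1 by (auto simp: fund_alcove_def)
  have "(0::real) \<le> of_int k \<or> of_int k \<le> (-1::real)" by (cases "0 \<le> k") simp_all
  then show ?thesis
  proof
    assume "(0::real) \<le> of_int k"
    then have "0 < f x \<and> (\<forall>y. interior y \<longrightarrow> 0 < f y) \<and> (\<forall>y\<in>fund_alcove \<Phi> \<alpha>. 0 \<le> f y)"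
      unfolding 1(2) using i c assms(2) by (force intro: add_pos_nonneg)
    then show ?thesis by blast
  next
    assume k: "of_int k \<le> (-1::real)"
    have "f x < 0 \<and> (\<forall>y. interior y \<longrightarrow> f y < 0) \<and> (\<forall>y\<in>fund_alcove \<Phi> \<alpha>. f y \<le> 0)"
      unfolding 1(2) using i(2) c(2) k assms(2) by force
    then show ?thesis by blast
  qed
next
  case (2 \<beta> k)
  have i: "0 < y \<bullet> \<beta>" "y \<bullet> \<beta> < 1" if "interior y" for y using that 2 by (auto simp: interior_def)
  have c: "0 \<le> y \<bullet> \<beta>" "y \<bullet> \<beta> \<le> 1" if "y \<in> fund_alcove \<Phi> \<alpha>" for y using that 2 by (auto simp: fund_alcove_def)
  have "(1::real) \<le> of_int k \<or> of_int k \<le> (0::real)" by (cases "1 \<le> k") simp_all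
  then show ?thesis
  proof
    assume k: "(1::real) \<le> of_int k"
    have "0 < f x \<and> (\<forall>y. interior y \<longrightarrow> 0 < f y) \<and> (\<forall>y\<in>fund_alcove \<Phi> \<alpha>. 0 \<le> f y)"
      unfolding 2(2) using i(2) c(2) k assms(2) by force
    then show ?thesis by blast
  next
    assume k: "of_int k \<le> (0::real)"
    have "f x < 0 \<and> (\<forall>y. interior y \<longrightarrow> f y < 0) \<and> (\<forall>y\<in>fund_alcove \<Phi> \<alpha>. f y \<le> 0)"
      unfolding 2(2) using i(1) c(1) k assms(2) by force
    then show ?thesis by blast
  qed
qed

text \<open>Coordinatewise, a positive root lies between a simple root and the highest root.\<close>

lemma interior_iff_walls: "interior x \<longleftrightarrow> (\<forall>i. 0 < wall i x)"
proof
  assume "interior x"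
  then show "\<forall>i. 0 < wall i x"
    using simple_pos highest_pos by (intro allI, case_tac i) (auto simp: interior_def)
next
  assume "\<forall>i. 0 < wall i x"
  then have w: "0 < x \<bullet> \<alpha> i" "x \<bullet> \<phi> < 1" for i
    using wall_simps(2)[of i x] wall_simps(1)[of x] by (metis, smt (verit))
  show "interior x"
    unfolding interior_def
  proof
    fix \<beta> assume b: "\<beta> \<in> P"
    obtain i where i: "0 < \<beta> \<bullet> \<omega> i" using ex_simple_pos_inner[OF b] by blast
    have "0 < (\<Sum>i\<in>UNIV. (\<beta> \<bullet> \<omega> i) * (x \<bullet> \<alpha> i))"
      using w pos_coord[OF b] i
      by (intro sum_pos2[of _ i]) (auto intro: mult_pos_pos mult_nonneg_nonneg less_imp_le)
    moreover have "(\<Sum>i\<in>UNIV. (\<beta> \<bullet> \<omega> i) * (x \<bullet> \<alpha> i)) \<le> (\<Sum>i\<in>UNIV. (\<phi> \<bullet> \<omega> i) * (x \<bullet> \<alpha> i))"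
      using w by (intro sum_mono mult_right_mono highest_coord[OF pos_root[OF b]]) (auto intro: less_imp_le)
    ultimately have "0 < x \<bullet> \<beta>" "x \<bullet> \<beta> \<le> x \<bullet> \<phi>" by (simp_all only: inner_coords[symmetric])
    then show "0 < x \<bullet> \<beta> \<and> x \<bullet> \<beta> < 1" using w(2) by simp
  qed
qed

lemma interior_le_highest:
  assumes "interior x" "\<beta> \<in> P" shows "x \<bullet> \<beta> \<le> x \<bullet> \<phi>"
proof -
  have "(\<Sum>i\<in>UNIV. (\<beta> \<bullet> \<omega> i) * (x \<bullet> \<alpha> i)) \<le> (\<Sum>i\<in>UNIV. (\<phi> \<bullet> \<omega> i) * (x \<bullet> \<alpha> i))"
    using assms simple_pos
    by (intro sum_mono mult_right_mono highest_coord[OF pos_root[OF assms(2)]])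
      (auto simp: interior_def intro: less_imp_le)
  then show ?thesis by (simp only: inner_coords[symmetric])
qed

lemma interior_reflect_bound:
  assumes "interior x" "\<beta> \<in> \<Phi>" shows "-1 < x \<bullet> \<beta>" "x \<bullet> \<beta> < 1"
proof -
  have "-1 < x \<bullet> \<beta> \<and> x \<bullet> \<beta> < 1"
    using pos_or_neg[OF assms(2)]
  proof
    assume "\<beta> \<in> P"
    then have "0 < x \<bullet> \<beta> \<and> x \<bullet> \<beta> < 1" using assms(1) unfolding interior_def by blast
    then show ?thesis by linarith
  next
    assume "- \<beta> \<in> P"
    then have "0 < x \<bullet> - \<beta> \<and> x \<bullet> - \<beta> < 1" using assms(1) unfolding interior_def by blast
    then show ?thesis by simp
  qed
  then show "-1 < x \<bullet> \<beta>" "x \<bullet> \<beta> < 1" by auto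
qed

text \<open>The only hyperplane between the fundamental alcove and its image under \<open>s i\<close> is the common wall. For a
  simple reflection this holds because it permutes the positive roots that are not multiples of
  \<open>\<alpha> j\<close>. For the reflection in the highest root it holds because the other positive roots have Cartan
  integer \<open>0\<close> or \<open>1\<close> with it.\<close>

lemma single_wall_crossed:
  assumes f: "affine_root f" and x: "interior x" and "0 < f x" "f (s i x) < 0"
  shows "\<exists>c>0. f = (\<lambda>y. c * wall i y)"
proof (cases i)
  case None
  \<comment> \<open>the reflection moves \<open>x\<close> by \<open>d\<close> times the coroot of \<open>\<phi>\<close>\<close>
  define d where "d = 1 - x \<bullet> \<phi>"
  have d: "0 < d" using x highest_pos by (auto simp: d_def interior_def)
  have sx: "s i x \<bullet> \<beta> = x \<bullet> \<beta> + d * (\<beta> \<bullet> coroot \<phi>)" for \<beta>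
    unfolding gen_eq None by (simp add: d_def coroot_minus inner_left_distrib inner_commute[of "coroot \<phi>"])
  have "\<phi> \<noteq> 0" using highest(1) zero_not_root by auto
  then have two: "\<phi> \<bullet> coroot \<phi> = 2" by (rule coroot_inner_self)
  from f show ?thesis
  proof (cases rule: affine_root_form)
    case (1 \<beta> k)
    have b: "0 < x \<bullet> \<beta>" "x \<bullet> \<beta> < 1" using x 1(1) by (auto simp: interior_def)
    then have "-1 < (of_int k :: real)" using assms(3) 1(2) by simp
    then have k: "0 \<le> (of_int k :: real)" by simp
    have "0 \<le> \<beta> \<bullet> coroot \<phi>" using highest_coroot[OF 1(1)] two by (cases "\<beta> = \<phi>") auto
    then have "0 \<le> d * (\<beta> \<bullet> coroot \<phi>)" using d by simp
    then show ?thesis using assms(4) b k unfolding 1(2) sx by linarith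
  next
    case (2 \<beta> k)
    have b: "0 < x \<bullet> \<beta>" "x \<bullet> \<beta> < 1" using x 2(1) by (auto simp: interior_def)
    then have "0 < (of_int k :: real)" using assms(3) 2(2) by simp
    then have k: "1 \<le> (of_int k :: real)" by simp
    show ?thesis
    proof (cases "\<beta> = \<phi>")
      case True
      have "of_int k < (2 :: real)" using assms(4) b unfolding 2(2) sx True two d_def by (simp add: algebra_simps)
      then have "k = 1" using k by simp
      then show ?thesis using 2(2) True None by (intro exI[of _ 1]) auto
    next
      case False
      have "\<beta> \<bullet> coroot \<phi> \<le> 1" using highest_coroot[OF 2(1) False] by auto
      then have "d * (\<beta> \<bullet> coroot \<phi>) \<le> d * 1" using d by (intro mult_left_mono) auto
      then show ?thesis using assms(4) k interior_le_highest[OF x 2(1)] d_def unfolding 2(2) sx by linarith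
    qed
  qed
next
  case (Some j)
  have sx: "s i x \<bullet> \<beta> = x \<bullet> reflect (\<alpha> j) \<beta>" for \<beta> by (simp add: Some refl_adjoint)
  have R: "reflect (\<alpha> j) \<beta> \<in> \<Phi>" if "\<beta> \<in> P" for \<beta> using refl_root[OF simple_in pos_root[OF that]] .
  from f show ?thesis
  proof (cases rule: affine_root_form)
    case (1 \<beta> k)
    have b: "0 < x \<bullet> \<beta>" "x \<bullet> \<beta> < 1" using x 1(1) by (auto simp: interior_def)
    then have "-1 < (of_int k :: real)" using assms(3) 1(2) by simp
    then have k: "0 \<le> (of_int k :: real)" by simp
    have l: "x \<bullet> reflect (\<alpha> j) \<beta> + of_int k < 0" using assms(4) unfolding 1(2) sx .
    have "reflect (\<alpha> j) \<beta> \<notin> P"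
    proof
      assume "reflect (\<alpha> j) \<beta> \<in> P"
      then have "0 < x \<bullet> reflect (\<alpha> j) \<beta>" using x unfolding interior_def by blast
      then show False using l k by linarith
    qed
    then obtain c where c: "0 < c" "\<beta> = c *\<^sub>R \<alpha> j" using pos_refl_neg[OF 1(1)] by blast
    have "of_int k < (1 :: real)" using l interior_reflect_bound(1)[OF x R[OF 1(1)]] by linarith
    then have "k = 0" using k by simp
    then show ?thesis using c 1(2) Some by (intro exI[of _ c]) auto
  next
    case (2 \<beta> k)
    have b: "0 < x \<bullet> \<beta>" "x \<bullet> \<beta> < 1" using x 2(1) by (auto simp: interior_def)
    then have "0 < (of_int k :: real)" using assms(3) 2(2) by simp
    then have k: "1 \<le> (of_int k :: real)" by simp
    have "of_int k - x \<bullet> reflect (\<alpha> j) \<beta> < 0" using assms(4) unfolding 2(2) sx .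
    then show ?thesis using k interior_reflect_bound(2)[OF x R[OF 2(1)]] by linarith
  qed
qed

lemma affine_root_nz: "affine_root f \<Longrightarrow> interior x \<Longrightarrow> f x \<noteq> 0"
  using affine_root_sign_interior[of f x] by auto

lemma affine_root_nz_orbit: "affine_root f \<Longrightarrow> w \<in> We \<Longrightarrow> interior x \<Longrightarrow> f (w x) \<noteq> 0"
  using affine_root_nz[OF affine_root_comp] by simp

lemma affine_root_pos_iff: "affine_root f \<Longrightarrow> interior x \<Longrightarrow> interior y \<Longrightarrow> 0 < f x \<longleftrightarrow> 0 < f y"
  using affine_root_sign_interior[of f x] by fastforce

lemma a0_alcove: "a0 \<in> fund_alcove \<Phi> \<alpha>"
  using interior_a0 by (auto simp: interior_def fund_alcove_def)

lemma wall_alcove: "a \<in> fund_alcove \<Phi> \<alpha> \<Longrightarrow> 0 \<le> wall i a"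
  using simple_pos highest_pos by (cases i) (auto simp: fund_alcove_def)

lemma wall_a0: "0 < wall i a0"
  using interior_a0 interior_iff_walls by blast

lemma affine_functional_unique:
  assumes "\<And>y. y \<bullet> \<beta> + b = c * (y \<bullet> \<gamma> + d)" shows "\<beta> = c *\<^sub>R \<gamma>"
proof -
  have "y \<bullet> (\<beta> - c *\<^sub>R \<gamma>) = 0" for y
    using assms[of y] assms[of 0] by (simp add: inner_diff_right algebra_simps)
  from this[of "\<beta> - c *\<^sub>R \<gamma>"] show ?thesis by simp
qed

lemma wall_pull:
  assumes "w \<in> We"
  obtains k :: int where "\<And>x. wall i x = w x \<bullet> linear_part w (grad i) + of_int k"
proof -
  let ?g = "linear_part w (grad i)"
  have "?g \<in> \<Phi>" using W0_root[OF ext_weyl_form(2)[OF assms] grad_root] .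
  then obtain n :: int where n: "wt w \<bullet> ?g = of_int n"
    using ext_weyl_form(1)[OF assms(1)] by (auto simp: lattice_iff elim!: Ints_cases)
  have "wall i x = w x \<bullet> ?g + of_int (snd (affine_simple_root \<Phi> \<alpha> i) - n)" for x
    using ext_weyl_form(3)[OF assms(1), of x] W0_inner[OF ext_weyl_form(2)[OF assms(1)], of x "grad i"]
    by (simp add: inner_left_distrib n wall_def)
  then show thesis by (rule that)
qed

text \<open>The hyperplane that separates \<open>w A\<^sub>0\<close> from \<open>w s\<^sub>i A\<^sub>0\<close> is the image of the wall of \<open>s\<^sub>i\<close> under \<open>w\<close>.\<close>

lemma crossing_gradient:
  assumes w: "w \<in> We" and f: "affine_root (\<lambda>y. y \<bullet> \<beta> + b)" "0 \<le> w a0 \<bullet> \<beta> + b" "w (s i a0) \<bullet> \<beta> + b \<le> 0"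
  shows "\<exists>c>0. \<beta> = c *\<^sub>R linear_part w (grad i)"
proof -
  let ?f = "\<lambda>y. y \<bullet> \<beta> + b"
  have "?f (w a0) \<noteq> 0" "?f ((w \<circ> s i) a0) \<noteq> 0"
    using affine_root_nz_orbit[OF f(1) w interior_a0] affine_root_nz_orbit[OF f(1) ext_comp[OF w gen_ext[of i]] interior_a0]
    by auto
  then have "0 < (?f \<circ> w) a0" "(?f \<circ> w) (s i a0) < 0" using f(2,3) by auto
  then obtain c where c: "0 < c" "?f \<circ> w = (\<lambda>y. c * wall i y)"
    using single_wall_crossed[OF affine_root_comp[OF f(1) w] interior_a0] by blast
  obtain k :: int where k: "\<And>x. wall i x = w x \<bullet> linear_part w (grad i) + of_int k" using wall_pull[OF w] by blast
  have "y \<bullet> \<beta> + b = c * (y \<bullet> linear_part w (grad i) + of_int k)" for y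
    using fun_cong[OF c(2), of "inv w y"] k[of "inv w y"] f_inv_f'[OF ext_bij[OF w], of y] by simp
  then have "\<beta> = c *\<^sub>R linear_part w (grad i)" by (rule affine_functional_unique)
  then show ?thesis using c(1) by (intro exI[of _ c]) simp
qed

lemma pos_scale: "0 < c \<Longrightarrow> c *\<^sub>R \<gamma> \<in> P \<Longrightarrow> \<gamma> \<in> \<Phi> \<Longrightarrow> \<gamma> \<in> P"
  using pos_by_rho[of \<gamma>] rho_pos[of "c *\<^sub>R \<gamma>"] zero_less_mult_pos[of "\<rho> \<bullet> \<gamma>" c] 
  by (metis inner_scaleR_right less_le_trans zero_less_mult_pos zero_less_one)

lemma lin_grad_root: "w \<in> We \<Longrightarrow> linear_part w (grad i) \<in> \<Phi>"
  using W0_root[OF ext_weyl_form(2) grad_root] .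

text \<open>The alcove \<open>w A\<^sub>0\<close> lies on the nonnegative side of the image of the wall, whose gradient is the image
  of \<open>grad i\<close>. So the sign of a crossing depends on the linear part of \<open>w\<close> alone; in
  particular it is invariant under translations.\<close>

lemma positive_crossing_iff:
  assumes w: "w \<in> We"
  shows "positive_crossing \<Phi> \<alpha> w i \<longleftrightarrow> linear_part w (grad i) \<notin> P"
proof
  let ?\<gamma> = "linear_part w (grad i)"
  assume "positive_crossing \<Phi> \<alpha> w i"
  then obtain \<beta> k where b: "\<beta> \<in> P"
    "separates \<beta> k (w ` fund_alcove \<Phi> \<alpha>) ((w \<circ> s i) ` fund_alcove \<Phi> \<alpha>)"
    "\<And>a. a \<in> fund_alcove \<Phi> \<alpha> \<Longrightarrow> of_int k \<le> w (s i a) \<bullet> \<beta>"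
    unfolding positive_crossing_def by fastforce
  have ar: "affine_root (\<lambda>y. y \<bullet> - \<beta> + of_int k)" using affine_rootI[OF neg_root[OF pos_root[OF b(1)]]] .
  have "w (s i a0) \<bullet> \<beta> \<noteq> of_int k"
    using affine_root_nz_orbit[OF ar ext_comp[OF w gen_ext[of i]] interior_a0] by simp
  then have "w a0 \<bullet> \<beta> \<le> of_int k"
    using b(2) b(3)[OF a0_alcove] a0_alcove unfolding separates_def by fastforce
  then obtain c where c: "0 < c" "- \<beta> = c *\<^sub>R ?\<gamma>"
    using crossing_gradient[OF w ar, of i] b(3)[OF a0_alcove] by auto
  have "\<rho> \<bullet> - \<beta> = c * (\<rho> \<bullet> ?\<gamma>)" by (simp add: c(2))
  then have "c * (\<rho> \<bullet> ?\<gamma>) < 0" using rho_pos[OF b(1)] by simp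
  then have "\<not> 0 < \<rho> \<bullet> ?\<gamma>" using c(1) by (simp add: mult_less_0_iff)
  then show "?\<gamma> \<notin> P" using rho_pos by fastforce
next
  let ?\<gamma> = "linear_part w (grad i)"
  assume "?\<gamma> \<notin> P"
  then have p: "- ?\<gamma> \<in> P" using not_pos_iff[OF lin_grad_root[OF w]] by blast
  obtain k :: int where k: "\<And>x. wall i x = w x \<bullet> ?\<gamma> + of_int k" using wall_pull[OF w] by blast
  have "w a \<bullet> - ?\<gamma> \<le> of_int k" "of_int k \<le> w (s i a) \<bullet> - ?\<gamma>" if "a \<in> fund_alcove \<Phi> \<alpha>" for a
    using wall_alcove[OF that, of i] wall_gen[of i a] k[of a] k[of "s i a"] by auto
  then show "positive_crossing \<Phi> \<alpha> w i"
    unfolding positive_crossing_def separates_def by (intro bexI[OF _ p] exI[of _ k]) auto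
qed

lemma negative_crossing_iff:
  assumes w: "w \<in> We"
  shows "negative_crossing \<Phi> \<alpha> w i \<longleftrightarrow> linear_part w (grad i) \<in> P"
proof
  let ?\<gamma> = "linear_part w (grad i)"
  assume "negative_crossing \<Phi> \<alpha> w i"
  then obtain \<beta> k where b: "\<beta> \<in> P"
    "separates \<beta> k (w ` fund_alcove \<Phi> \<alpha>) ((w \<circ> s i) ` fund_alcove \<Phi> \<alpha>)"
    "\<And>a. a \<in> fund_alcove \<Phi> \<alpha> \<Longrightarrow> w (s i a) \<bullet> \<beta> \<le> of_int k"
    unfolding negative_crossing_def by fastforce
  have ar: "affine_root (\<lambda>y. y \<bullet> \<beta> + of_int (- k))" using affine_rootI[OF pos_root[OF b(1)]] .
  have "w (s i a0) \<bullet> \<beta> \<noteq> of_int k"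
    using affine_root_nz_orbit[OF ar ext_comp[OF w gen_ext[of i]] interior_a0] by simp
  then have "of_int k \<le> w a0 \<bullet> \<beta>"
    using b(2) b(3)[OF a0_alcove] a0_alcove unfolding separates_def by fastforce
  then obtain c where c: "0 < c" "\<beta> = c *\<^sub>R ?\<gamma>"
    using crossing_gradient[OF w ar, of i] b(3)[OF a0_alcove] by auto
  then show "?\<gamma> \<in> P" using pos_scale b(1) lin_grad_root[OF w] by blast
next
  let ?\<gamma> = "linear_part w (grad i)"
  assume p: "?\<gamma> \<in> P"
  obtain k :: int where k: "\<And>x. wall i x = w x \<bullet> ?\<gamma> + of_int k" using wall_pull[OF w] by blast
  have "of_int (- k) \<le> w a \<bullet> ?\<gamma>" "w (s i a) \<bullet> ?\<gamma> \<le> of_int (- k)" if "a \<in> fund_alcove \<Phi> \<alpha>" for a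
    using wall_alcove[OF that, of i] wall_gen[of i a] k[of a] k[of "s i a"] by auto
  then show "negative_crossing \<Phi> \<alpha> w i"
    unfolding negative_crossing_def separates_def by (intro bexI[OF _ p] exI[of _ "-k"]) auto
qed

lemma interior_inv:
  assumes w: "w \<in> We" and "interior (w a0)" shows "interior (inv w a0)"
  unfolding interior_iff_walls
proof
  fix i
  have f: "affine_root (wall i \<circ> inv w)" using affine_root_comp[OF affine_root_wall ext_inv[OF w]] .
  have "0 < (wall i \<circ> inv w) (w a0)" using inv_f_f'[OF ext_bij[OF w]] wall_a0 by simp
  then show "0 < wall i (inv w a0)" using affine_root_pos_iff[OF f assms(2) interior_a0] by simp
qed

lemma alcove_subset:
  assumes w: "w \<in> We" and "interior (w a0)" shows "w ` fund_alcove \<Phi> \<alpha> \<subseteq> fund_alcove \<Phi> \<alpha>"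
proof
  fix y assume "y \<in> w ` fund_alcove \<Phi> \<alpha>"
  then obtain a where a: "a \<in> fund_alcove \<Phi> \<alpha>" "y = w a" by blast
  have nn: "0 \<le> f y" if f: "affine_root f" and p: "0 < f (w a0)" for f
  proof -
    have "0 < (f \<circ> w) a0" using p by simp
    then have "0 \<le> (f \<circ> w) a"
      using affine_root_sign_interior[OF affine_root_comp[OF f w] interior_a0] a(1) by (auto dest: less_asym)
    then show ?thesis by (simp add: a(2))
  qed
  show "y \<in> fund_alcove \<Phi> \<alpha>"
    unfolding fund_alcove_def
  proof (intro CollectI ballI)
    fix \<beta> assume b: "\<beta> \<in> P"
    have i: "0 < w a0 \<bullet> \<beta>" "w a0 \<bullet> \<beta> < 1" using assms(2) b by (auto simp: interior_def)
    show "0 \<le> y \<bullet> \<beta> \<and> y \<bullet> \<beta> \<le> 1"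
      using nn[OF affine_rootI[OF pos_root[OF b], of 0]] nn[OF affine_rootI[OF neg_root[OF pos_root[OF b]], of 1]] i
      by simp
  qed
qed

text \<open>An affine root has one sign on the whole alcove, so the position of the single point \<open>\<sigma> a0\<close> decides that of
  the image of the alcove. The same argument for the inverse turns the inclusion into an equality.\<close>

lemma stabilizer_iff: "\<sigma> \<in> \<Sigma> \<longleftrightarrow> \<sigma> \<in> We \<and> interior (\<sigma> a0)"
proof
  assume "\<sigma> \<in> \<Sigma>"
  then have s: "\<sigma> \<in> We" "\<sigma> ` fund_alcove \<Phi> \<alpha> = fund_alcove \<Phi> \<alpha>" by (auto simp: alcove_stabilizer_def)
  then have a: "\<sigma> a0 \<in> fund_alcove \<Phi> \<alpha>" using a0_alcove by blast
  have "interior (\<sigma> a0)"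
    unfolding interior_def
  proof
    fix \<beta> assume b: "\<beta> \<in> P"
    have "\<sigma> a0 \<bullet> \<beta> \<noteq> 0" "\<sigma> a0 \<bullet> \<beta> \<noteq> 1"
      using affine_root_nz_orbit[OF affine_rootI[OF pos_root[OF b], of 0] s(1) interior_a0]
        affine_root_nz_orbit[OF affine_rootI[OF pos_root[OF b], of "-1"] s(1) interior_a0] by auto
    then show "0 < \<sigma> a0 \<bullet> \<beta> \<and> \<sigma> a0 \<bullet> \<beta> < 1"
      using a b unfolding fund_alcove_def by fastforce
  qed
  then show "\<sigma> \<in> We \<and> interior (\<sigma> a0)" using s by blast
next
  assume s: "\<sigma> \<in> We \<and> interior (\<sigma> a0)"
  then have w: "\<sigma> \<in> We" and i: "interior (\<sigma> a0)" by auto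
  have "inv \<sigma> ` fund_alcove \<Phi> \<alpha> \<subseteq> fund_alcove \<Phi> \<alpha>"
    by (rule alcove_subset[OF ext_inv[OF w] interior_inv[OF w i]])
  then have "\<sigma> ` inv \<sigma> ` fund_alcove \<Phi> \<alpha> \<subseteq> \<sigma> ` fund_alcove \<Phi> \<alpha>" by (rule image_mono)
  moreover have "\<sigma> ` inv \<sigma> ` fund_alcove \<Phi> \<alpha> = fund_alcove \<Phi> \<alpha>"
    by (rule image_f_inv_f[OF bij_is_surj[OF ext_bij[OF w]]])
  ultimately have "\<sigma> ` fund_alcove \<Phi> \<alpha> = fund_alcove \<Phi> \<alpha>"
    using alcove_subset[OF w i] by (intro equalityI) simp_all
  then show "\<sigma> \<in> \<Sigma>" using w by (simp add: alcove_stabilizer_def)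
qed

lemma stab_ext: "\<sigma> \<in> \<Sigma> \<Longrightarrow> \<sigma> \<in> We"
  by (simp add: stabilizer_iff)

lemma id_ext: "id \<in> We"
  using W0_ext[OF parabolic_id] .

lemma stab_id: "id \<in> \<Sigma>"
  using id_ext by (simp add: alcove_stabilizer_def)

lemma stab_comp: "\<sigma> \<in> \<Sigma> \<Longrightarrow> \<tau> \<in> \<Sigma> \<Longrightarrow> \<sigma> \<circ> \<tau> \<in> \<Sigma>"
  using ext_comp[of \<sigma> \<tau>] image_comp[of \<sigma> \<tau> "fund_alcove \<Phi> \<alpha>"]
  unfolding alcove_stabilizer_def mem_Collect_eq by metis

lemma stab_inv: "\<sigma> \<in> \<Sigma> \<Longrightarrow> inv \<sigma> \<in> \<Sigma>"
  unfolding stabilizer_iff by (simp add: ext_inv interior_inv)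

section \<open>Words and length\<close>

lemma coroot_scale: "coroot (c *\<^sub>R x) = (1 / c) *\<^sub>R coroot x"
  by (cases "c = 0") (simp_all add: coroot_def)

lemma coroot_W0: "z \<in> W0 \<Longrightarrow> coroot (z x) = z (coroot x)"
  using W0_inner[of z x x] linear_scale[OF W0_linear, of z] by (simp add: coroot_def)

text \<open>Proportional affine roots define the same reflection.\<close>

lemma wall_conj:
  assumes w: "w \<in> We" and c: "0 < c" "wall i \<circ> w = (\<lambda>x. c * wall k x)"
  shows "s i \<circ> w = w \<circ> s k"
proof -
  let ?z = "linear_part w"
  have z: "?z \<in> W0" using ext_weyl_form(2)[OF w] .
  obtain n :: int where n: "\<And>x. wall k x = w x \<bullet> ?z (grad k) + of_int n" using wall_pull[OF w] by blast
  have "y \<bullet> grad i + of_int (snd (affine_simple_root \<Phi> \<alpha> i)) = c * (y \<bullet> ?z (grad k) + of_int n)" for y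
    using fun_cong[OF c(2), of "inv w y"] n[of "inv w y"] f_inv_f'[OF ext_bij[OF w], of y]
    by (simp add: wall_def[of i])
  then have g: "grad i = c *\<^sub>R ?z (grad k)" by (rule affine_functional_unique)
  have wi: "wall i (w x) = c * wall k x" for x using fun_cong[OF c(2), of x] by simp
  show ?thesis
  proof
    fix x
    have "(s i \<circ> w) x = w x - (c * wall k x) *\<^sub>R coroot (grad i)" by (simp add: gen_eq wi)
    also have "\<dots> = w x - wall k x *\<^sub>R ?z (coroot (grad k))"
      using c(1) by (simp add: g coroot_scale coroot_W0[OF z])
    also have "\<dots> = w (s k x)"
      using ext_weyl_form(3)[OF w, of x] ext_weyl_form(3)[OF w, of "s k x"]
      by (simp add: gen_eq[of k] linear_diff[OF W0_linear[OF z]] linear_scale[OF W0_linear[OF z]])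
    finally show "(s i \<circ> w) x = (w \<circ> s k) x" by simp
  qed
qed

abbreviation "word \<equiv> word_prod \<Phi> \<alpha>"

lemma word_simps [simp]: "word [] = id" "word (i # ks) = s i \<circ> word ks"
  by (simp_all add: word_prod_def)

lemma word_append: "word (ks @ js) = word ks \<circ> word js"
  by (induction ks) (simp_all add: o_assoc)

lemma word_ext: "word js \<in> We"
proof (induction js)
  case Nil show ?case unfolding word_simps by (rule id_ext)
next
  case (Cons i js) then show ?case unfolding word_simps by (intro ext_comp gen_ext)
qed

lemma inv_gen: "inv (s i) = s i"
  by (rule inv_unique_comp) (rule gen_gen_comp)+

lemma word_rev: "inv (word ks) = word (rev ks)"
proof (induction ks)
  case (Cons i ks)
  have "inv (s i \<circ> word ks) = inv (word ks) \<circ> inv (s i)"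
    by (rule o_inv_distrib[OF ext_bij[OF gen_ext] ext_bij[OF word_ext]])
  then show ?case using Cons by (simp only: inv_gen word_append rev.simps word_simps comp_id)
qed (simp only: rev.simps word_simps inv_id)

text \<open>The exchange condition. The walk along the word starts on the positive side of the wall of \<open>s i\<close> and
  ends on the negative side. At the step that crosses this wall, \<open>s i\<close> passes through the preceding
  part of the word and cancels the letter. The starting point \<open>x\<close> may be any interior point, as words
  will be followed by elements of the alcove stabiliser.\<close>

lemma delete_letter:
  assumes x: "interior x"
  shows "wall i (word ks x) < 0 \<Longrightarrow> \<exists>js. length js + 1 = length ks \<and> set js \<subseteq> set ks \<and> s i \<circ> word ks = word js"
proof (induction ks rule: rev_induct)
  case Nil
  then show ?case using x interior_iff_walls[of x] by (auto dest: less_asym)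
next
  case (snoc k ks)
  show ?case
  proof (cases "wall i (word ks x) < 0")
    case True
    then obtain js where "length js + 1 = length ks" "set js \<subseteq> set ks" "s i \<circ> word ks = word js"
      using snoc.IH by blast
    then show ?thesis
      by (intro exI[of _ "js @ [k]"]) (auto simp only: word_append o_assoc word_simps length_append set_append list.size)
  next
    case False
    then have "0 < (wall i \<circ> word ks) x"
      using affine_root_nz_orbit[OF affine_root_wall word_ext x, of i ks] by simp
    moreover have "(wall i \<circ> word ks) (s k x) < 0" using snoc.prems by (simp add: word_append)
    ultimately obtain c where "0 < c" "wall i \<circ> word ks = (\<lambda>x. c * wall k x)"
      using single_wall_crossed[OF affine_root_comp[OF affine_root_wall word_ext] x] by blast
    then have "s i \<circ> word ks = word ks \<circ> s k" by (rule wall_conj[OF word_ext])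
    then have "s i \<circ> word (ks @ [k]) = word ks"
      using gen_gen_comp[of k] by (simp add: word_append o_assoc) (simp add: o_assoc[symmetric])
    then show ?thesis by (intro exI[of _ ks]) auto
  qed
qed

text \<open>The reflection \<open>\<sigma> s\<^sub>i \<sigma>\<inverse>\<close> moves the fundamental alcove, so some wall \<open>i'\<close> separates the alcove from
  its image; but the only separating hyperplane is the image of the wall \<open>i\<close>.\<close>

lemma stab_conj:
  assumes "\<sigma> \<in> \<Sigma>"
  obtains i' c where "0 < c" "wall i' \<circ> \<sigma> = (\<lambda>x. c * wall i x)" "\<sigma> \<circ> s i = s i' \<circ> \<sigma>"
proof -
  have s: "\<sigma> \<in> We" and b: "interior (inv \<sigma> a0)"
    using assms stabilizer_iff interior_inv by blast+
  let ?b = "inv \<sigma> a0"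
  let ?y = "\<sigma> (s i ?b)"
  have f: "affine_root (wall i \<circ> inv \<sigma>)" using affine_root_comp[OF affine_root_wall ext_inv[OF s]] .
  have wb: "0 < wall i ?b" using b interior_iff_walls by blast
  then have "(wall i \<circ> inv \<sigma>) ?y < 0" "0 < (wall i \<circ> inv \<sigma>) a0"
    using inv_f_f'[OF ext_bij[OF s]] by (simp_all add: wall_gen)
  then have "\<not> interior ?y" using affine_root_pos_iff[OF f interior_a0, of ?y] by linarith
  then obtain i' where i': "\<not> 0 < wall i' ?y" using interior_iff_walls by blast
  moreover have "wall i' ?y \<noteq> 0"
    using affine_root_nz_orbit[OF affine_root_wall ext_comp[OF s gen_ext] b, of i' i] by simp
  ultimately have "(wall i' \<circ> \<sigma>) (s i ?b) < 0" by simp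
  moreover have "0 < (wall i' \<circ> \<sigma>) ?b" using f_inv_f'[OF ext_bij[OF s]] wall_a0 by simp
  ultimately obtain c where "0 < c" "wall i' \<circ> \<sigma> = (\<lambda>x. c * wall i x)"
    using single_wall_crossed[OF affine_root_comp[OF affine_root_wall s] b] by blast
  then show thesis using that wall_conj[OF s] by metis
qed

text \<open>The affine roots that separate the fundamental alcove from \<open>w A\<^sub>0\<close>; they serve as the
  termination measure for writing \<open>w\<close> as a word. In a nonreduced root system one hyperplane may be counted
  twice, so the cardinality is not the length.\<close>

definition inversions :: "('v \<Rightarrow> 'v) \<Rightarrow> ('v \<Rightarrow> real) set" where
  "inversions w = {f. affine_root f \<and> 0 < f a0 \<and> f (w a0) < 0}"

lemma finite_inversions: "finite (inversions w)"
proof -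
  \<comment> \<open>the sign at \<open>a0\<close> forces \<open>k \<ge> 0\<close> and the sign at \<open>w a0\<close> forces \<open>k \<le> M\<close>\<close>
  define M where "M = (\<Sum>\<gamma>\<in>\<Phi>. \<bar>w a0 \<bullet> \<gamma>\<bar>)"
  have "inversions w \<subseteq> (\<lambda>(\<gamma>, k). (\<lambda>x. x \<bullet> \<gamma> + of_int k)) ` (\<Phi> \<times> {0..\<lceil>M\<rceil>})"
  proof
    fix f assume "f \<in> inversions w"
    then obtain \<gamma> and k :: int where f: "\<gamma> \<in> \<Phi>" "f = (\<lambda>x. x \<bullet> \<gamma> + of_int k)" "0 < f a0" "f (w a0) < 0"
      by (auto simp: inversions_def affine_root_def)
    have "\<bar>w a0 \<bullet> \<gamma>\<bar> \<le> M" unfolding M_def using finite_roots f(1) by (intro member_le_sum) auto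
    then have "of_int k \<le> M" using f(4) unfolding f(2) by linarith
    then have "k \<le> \<lceil>M\<rceil>" by linarith
    moreover have "(-1::real) < of_int k" using f(3) interior_reflect_bound(2)[OF interior_a0 f(1)] unfolding f(2) by linarith
    ultimately show "f \<in> (\<lambda>(\<gamma>, k). (\<lambda>x. x \<bullet> \<gamma> + of_int k)) ` (\<Phi> \<times> {0..\<lceil>M\<rceil>})"
      using f(1,2) by (auto intro!: image_eqI[of _ _ "(\<gamma>, k)"])
  qed
  then show ?thesis using finite_roots by (auto intro: finite_subset)
qed

lemma inversions_decrease:
  assumes w: "w \<in> We" and "wall i (inv w a0) < 0"
  shows "inversions (w \<circ> s i) \<subset> inversions w"
proof (rule psubsetI)
  have ww: "inv w (w x) = x" for x using inv_f_f'[OF ext_bij[OF w]] by simp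
  show "inversions (w \<circ> s i) \<subseteq> inversions w"
  proof
    fix f assume f: "f \<in> inversions (w \<circ> s i)"
    then have fa: "affine_root f" "0 < f a0" "(f \<circ> w) (s i a0) < 0" by (auto simp: inversions_def)
    have "\<not> 0 < (f \<circ> w) a0"
    proof
      assume "0 < (f \<circ> w) a0"
      then obtain c where c: "0 < c" "f \<circ> w = (\<lambda>y. c * wall i y)"
        using single_wall_crossed[OF affine_root_comp[OF fa(1) w] interior_a0 _ fa(3)] by blast
      have "f a0 = c * wall i (inv w a0)"
        using fun_cong[OF c(2), of "inv w a0"] f_inv_f'[OF ext_bij[OF w]] by simp
      then have "f a0 < 0" using assms(2) c(1) by (simp add: mult_pos_neg)
      then show False using fa(2) by simp
    qed
    then have "f (w a0) < 0" using affine_root_nz_orbit[OF fa(1) w interior_a0] by simp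
    then show "f \<in> inversions w" using fa by (simp add: inversions_def)
  qed
  let ?g = "\<lambda>x. - (wall i \<circ> inv w) x"
  have g: "affine_root ?g" by (rule affine_root_neg[OF affine_root_comp[OF affine_root_wall ext_inv[OF w]]])
  have "?g \<in> inversions w" using g assms(2) wall_a0 by (simp add: inversions_def ww)
  moreover have "?g \<notin> inversions (w \<circ> s i)" using wall_a0[of i] by (simp add: inversions_def ww wall_gen)
  ultimately show "inversions (w \<circ> s i) \<noteq> inversions w" by blast
qed

lemma descent_or_stab:
  assumes "w \<in> We" "w \<notin> \<Sigma>" shows "\<exists>i. wall i (inv w a0) < 0"
proof -
  have "\<not> interior (inv w a0)"
  proof
    assume "interior (inv w a0)"
    then have "inv w \<in> \<Sigma>" using stabilizer_iff ext_inv[OF assms(1)] by blast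
    then have "inv (inv w) \<in> \<Sigma>" by (rule stab_inv)
    then show False using assms inv_inv_eq[OF ext_bij[OF assms(1)]] by simp
  qed
  then obtain i where "\<not> 0 < wall i (inv w a0)" using interior_iff_walls by blast
  then show ?thesis
    using affine_root_nz_orbit[OF affine_root_wall ext_inv[OF assms(1)] interior_a0, of i] by (intro exI[of _ i]) simp
qed

text \<open>Crossing a wall of \<open>w A\<^sub>0\<close> that separates it from the fundamental alcove removes inversions, and if
  there is no such wall, then \<open>w\<close> stabilises the alcove.\<close>

lemma ex_word: "w \<in> We \<Longrightarrow> \<exists>ks \<sigma>. \<sigma> \<in> \<Sigma> \<and> w = word ks \<circ> \<sigma>"
proof (induction "card (inversions w)" arbitrary: w rule: less_induct)
  case less
  show ?case
  proof (cases "w \<in> \<Sigma>")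
    case True
    then show ?thesis by (intro exI[of _ "[]"] exI[of _ w]) simp
  next
    case False
    then obtain i where "wall i (inv w a0) < 0" using descent_or_stab[OF less.prems] by blast
    then have "card (inversions (w \<circ> s i)) < card (inversions w)"
      using inversions_decrease[OF less.prems] finite_inversions by (intro psubset_card_mono)
    then obtain ks \<sigma> where jw: "\<sigma> \<in> \<Sigma>" "w \<circ> s i = word ks \<circ> \<sigma>"
      using less.hyps ext_comp[OF less.prems gen_ext] by blast
    obtain i' where i': "\<sigma> \<circ> s i = s i' \<circ> \<sigma>" using stab_conj[OF jw(1)] by metis
    have "w = w \<circ> s i \<circ> s i" by (simp add: o_assoc[symmetric] gen_gen_comp)
    also have "\<dots> = word (ks @ [i']) \<circ> \<sigma>" by (simp only: jw(2) word_append word_simps comp_id o_assoc[symmetric] i')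
    finally show ?thesis using jw(1) by blast
  qed
qed

abbreviation "ell \<equiv> len \<Phi> \<alpha>"

lemma len_le: "\<sigma> \<in> \<Sigma> \<Longrightarrow> ell (word ks \<circ> \<sigma>) \<le> length ks"
  unfolding len_def by (rule Least_le) blast

lemma len_ex: assumes "w \<in> We" obtains ks \<sigma> where "length ks = ell w" "\<sigma> \<in> \<Sigma>" "w = word ks \<circ> \<sigma>"
proof -
  have "\<exists>k. \<exists>ks \<sigma>. length ks = k \<and> \<sigma> \<in> \<Sigma> \<and> w = word ks \<circ> \<sigma>" using ex_word[OF assms] by blast
  from LeastI_ex[OF this] show thesis using that unfolding len_def by blast
qed

lemma len_gen_le: assumes "w \<in> We" shows "ell (w \<circ> s i) \<le> ell w + 1"
proof -
  obtain ks \<sigma> where jw: "length ks = ell w" "\<sigma> \<in> \<Sigma>" "w = word ks \<circ> \<sigma>" using len_ex[OF assms] .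
  obtain i' where i': "\<sigma> \<circ> s i = s i' \<circ> \<sigma>" using stab_conj[OF jw(2)] by metis
  have "w \<circ> s i = word (ks @ [i']) \<circ> \<sigma>" by (simp only: jw(3) word_append word_simps comp_id o_assoc[symmetric] i')
  then show ?thesis using len_le[OF jw(2), of "ks @ [i']"] jw(1) by simp
qed

lemma len_gen_less:
  assumes w: "w \<in> We" and "wall i (inv w a0) < 0" shows "ell (w \<circ> s i) < ell w"
proof -
  obtain ks \<sigma> where jw: "length ks = ell w" "\<sigma> \<in> \<Sigma>" "w = word ks \<circ> \<sigma>" using len_ex[OF w] .
  obtain i' c where i': "0 < c" "wall i' \<circ> \<sigma> = (\<lambda>x. c * wall i x)" "\<sigma> \<circ> s i = s i' \<circ> \<sigma>"
    using stab_conj[OF jw(2)] by blast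
  have "inv w = inv \<sigma> \<circ> inv (word ks)"
    unfolding jw(3) by (rule o_inv_distrib[OF ext_bij[OF word_ext] ext_bij[OF stab_ext[OF jw(2)]]])
  then have "\<sigma> (inv w a0) = word (rev ks) a0"
    using f_inv_f'[OF ext_bij[OF stab_ext[OF jw(2)]]] by (simp add: word_rev)
  then have "wall i' (word (rev ks) a0) = c * wall i (inv w a0)" using fun_cong[OF i'(2), of "inv w a0"] by simp
  then have "wall i' (word (rev ks) a0) < 0" using i'(1) assms(2) by (simp add: mult_pos_neg)
  then obtain js where js: "length js + 1 = length (rev ks)" "s i' \<circ> word (rev ks) = word js"
    using delete_letter[OF interior_a0] by blast
  have "inv (s i' \<circ> word (rev ks)) = inv (word (rev ks)) \<circ> inv (s i')"
    by (rule o_inv_distrib[OF ext_bij[OF gen_ext] ext_bij[OF word_ext]])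
  then have "word ks \<circ> s i' = word (rev js)" by (simp only: js(2) word_rev rev_rev_ident inv_gen)
  then have "w \<circ> s i = word (rev js) \<circ> \<sigma>" by (simp only: jw(3) o_assoc[symmetric] i'(3)) (simp only: o_assoc)
  then show ?thesis using len_le[OF jw(2), of "rev js"] js(1) jw(1) by simp
qed

text \<open>The sign of the wall \<open>i\<close> at \<open>w\<inverse> a0\<close> tells whether the wall between \<open>w A\<^sub>0\<close> and \<open>w s\<^sub>i A\<^sub>0\<close>
  separates \<open>w A\<^sub>0\<close> from the fundamental alcove.\<close>

lemma len_descent:
  assumes w: "w \<in> We" and "wall i (inv w a0) < 0" shows "ell w = ell (w \<circ> s i) + 1"
proof -
  have "ell ((w \<circ> s i) \<circ> s i) \<le> ell (w \<circ> s i) + 1" by (rule len_gen_le[OF ext_comp[OF w gen_ext]])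
  then have "ell w \<le> ell (w \<circ> s i) + 1" by (simp add: o_assoc[symmetric] gen_gen_comp)
  then show ?thesis using len_gen_less[OF assms] by simp
qed

lemma len_ascent:
  assumes w: "w \<in> We" and "0 < wall i (inv w a0)" shows "ell (w \<circ> s i) = ell w + 1"
proof -
  have "inv (w \<circ> s i) = s i \<circ> inv w"
    using o_inv_distrib[OF ext_bij[OF w] ext_bij[OF gen_ext[of i]]] by (simp only: inv_gen)
  then have "wall i (inv (w \<circ> s i) a0) < 0" using assms(2) by (simp add: wall_gen)
  then have "ell (w \<circ> s i) = ell ((w \<circ> s i) \<circ> s i) + 1" by (rule len_descent[OF ext_comp[OF w gen_ext]])
  then show ?thesis by (simp add: o_assoc[symmetric] gen_gen_comp)
qed

lemma len_comp_stab: assumes "w \<in> We" "\<sigma> \<in> \<Sigma>" shows "ell (w \<circ> \<sigma>) = ell w"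
proof -
  have le: "ell (w \<circ> \<sigma>) \<le> ell w" if w: "w \<in> We" and s: "\<sigma> \<in> \<Sigma>" for w \<sigma>
  proof -
    obtain ks \<tau> where jw: "length ks = ell w" "\<tau> \<in> \<Sigma>" "w = word ks \<circ> \<tau>" using len_ex[OF w] .
    have "ell (word ks \<circ> (\<tau> \<circ> \<sigma>)) \<le> length ks" by (rule len_le[OF stab_comp[OF jw(2) s]])
    then show ?thesis using jw(1) by (simp only: jw(3) o_assoc)
  qed
  have "w \<circ> \<sigma> \<circ> inv \<sigma> = w"
    using f_inv_f'[OF ext_bij[OF stab_ext[OF assms(2)]]] by (auto simp: fun_eq_iff)
  then show ?thesis
    using le[OF assms] le[OF ext_comp[OF assms(1) stab_ext[OF assms(2)]] stab_inv[OF assms(2)]] by simp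
qed

lemma len_stab: "\<sigma> \<in> \<Sigma> \<Longrightarrow> ell \<sigma> = 0"
  using len_le[of \<sigma> "[]"] by simp

lemma len_gen: "ell (s i) = 1"
  using len_ascent[OF id_ext, of i] wall_a0[of i] len_stab[OF stab_id] by simp

section \<open>Minimal coset representatives\<close>

abbreviation "PJ J \<equiv> parabolic \<alpha> J"
abbreviation "MR J \<equiv> min_reps \<Phi> \<alpha> J"
abbreviation "RJ J \<equiv> roots_J \<Phi> \<alpha> J"

lemma len_left_less:
  assumes "w \<in> We" "wall i (w a0) < 0" shows "ell (s i \<circ> w) < ell w"
proof -
  obtain ks \<sigma> where ks: "length ks = ell w" "\<sigma> \<in> \<Sigma>" "w = word ks \<circ> \<sigma>" using len_ex[OF assms(1)] .
  have "interior (\<sigma> a0)" using ks(2) stabilizer_iff by blast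
  moreover have "wall i (word ks (\<sigma> a0)) < 0" using assms(2) by (simp add: ks(3))
  ultimately obtain js where js: "length js + 1 = length ks" "s i \<circ> word ks = word js"
    using delete_letter by blast
  have "s i \<circ> w = word js \<circ> \<sigma>" by (simp only: ks(3) o_assoc js(2))
  then show ?thesis using len_le[OF ks(2), of js] js(1) ks(1) by simp
qed

lemma min_reps_W0: "u \<in> MR J \<Longrightarrow> u \<in> W0"
  by (simp add: min_reps_def)

text \<open>Otherwise \<open>s\<^sub>j u\<close> would be a shorter element of the coset.\<close>

lemma min_reps_pos_simple:
  assumes u: "u \<in> MR J" and j: "j \<in> J" shows "inv u (\<alpha> j) \<in> P"
proof (rule ccontr)
  assume n: "inv u (\<alpha> j) \<notin> P"
  have W: "u \<in> W0" using min_reps_W0[OF u] .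
  have "inv u (\<alpha> j) \<in> \<Phi>" using W0_root[OF parabolic_inv[OF W] simple_in] .
  then have "- inv u (\<alpha> j) \<in> P" using n not_pos_iff by blast
  then have "0 < a0 \<bullet> - inv u (\<alpha> j)" using interior_a0 unfolding interior_def by blast
  then have "wall (Some j) (u a0) < 0" by (simp add: W0_adjoint[OF W])
  then have "ell (s (Some j) \<circ> u) < ell u" by (rule len_left_less[OF W0_ext[OF W]])
  moreover have "ell u \<le> ell (reflect (\<alpha> j) \<circ> u)"
    using u parabolic_gen[OF j] unfolding min_reps_def by blast
  ultimately show False by simp
qed

lemma positive_on_parabolic_roots:
  assumes W: "u \<in> W0" and p: "\<And>j. j \<in> J \<Longrightarrow> inv u (\<alpha> j) \<in> P" and b: "\<beta> \<in> RJ J" "\<beta> \<in> P"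
  shows "inv u \<beta> \<in> P"
proof -
  have nn: "0 \<le> (\<beta> \<bullet> \<omega> i) * (u \<rho> \<bullet> \<alpha> i)" for i
  proof (cases "i \<in> J")
    case True
    then have "0 \<le> u \<rho> \<bullet> \<alpha> i" using rho_pos[OF p[OF True]] by (simp add: W0_adjoint[OF W])
    then show ?thesis using pos_coord[OF b(2)] by simp
  next
    case False
    then show ?thesis using b(1) by (simp add: roots_J_def span_J_iff)
  qed
  obtain i where i: "0 < \<beta> \<bullet> \<omega> i" using ex_simple_pos_inner[OF b(2)] by blast
  then have iJ: "i \<in> J" using b(1) by (auto simp: roots_J_def span_J_iff)
  have "0 < u \<rho> \<bullet> \<alpha> i" using rho_pos[OF p[OF iJ]] by (simp add: W0_adjoint[OF W])
  then have "0 < (\<Sum>i\<in>UNIV. (\<beta> \<bullet> \<omega> i) * (u \<rho> \<bullet> \<alpha> i))"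
    using i nn by (intro sum_pos2[of _ i]) auto
  then have "0 < u \<rho> \<bullet> \<beta>" by (simp only: inner_coords[symmetric])
  then have "0 < \<rho> \<bullet> inv u \<beta>" by (simp add: W0_adjoint[OF W])
  then show ?thesis using pos_by_rho[OF W0_root[OF parabolic_inv[OF W] pos_root[OF b(2)]]] by blast
qed

lemma min_reps_pos: "u \<in> MR J \<Longrightarrow> \<beta> \<in> RJ J \<Longrightarrow> \<beta> \<in> P \<Longrightarrow> inv u \<beta> \<in> P"
  by (rule positive_on_parabolic_roots[OF min_reps_W0 min_reps_pos_simple])

lemma parabolic_word: "x \<in> PJ J \<Longrightarrow> \<exists>ks. set ks \<subseteq> Some ` J \<and> x = word ks"
proof (induction rule: parabolic_induct)
  case id show ?case by (intro exI[of _ "[]"]) simp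
next
  case (step w j)
  then obtain ks where "set ks \<subseteq> Some ` J" "w = word ks" by blast
  then show ?case using step.hyps(2)
    by (intro exI[of _ "ks @ [Some j]"]) (simp add: word_append)
qed

text \<open>If the word is not empty, its first letter is a wall separating the fundamental alcove from the image
  of the remaining word. This gives a shorter word for the same element.\<close>

lemma word_trivial:
  "set ks \<subseteq> Some ` J \<Longrightarrow> \<forall>j\<in>J. 0 < wall (Some j) (word ks a0) \<Longrightarrow> word ks = id"
proof (induction "length ks" arbitrary: ks rule: less_induct)
  case less
  show ?case
  proof (cases ks)
    case (Cons i ks')
    then obtain j where j: "j \<in> J" "i = Some j" using less.prems(1) by auto
    have "0 < wall i (word ks a0)" using less.prems(2) j by blast
    then have "wall i (word ks' a0) < 0" unfolding Cons by (simp add: wall_gen del: wall_simps gen.simps)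
    then obtain js where js: "length js + 1 = length ks'" "set js \<subseteq> set ks'" "s i \<circ> word ks' = word js"
      using delete_letter[OF interior_a0] by blast
    have e: "word ks = word js" unfolding Cons word_simps js(3) ..
    have "word js = id"
    proof (rule less.hyps)
      show "length js < length ks" "set js \<subseteq> Some ` J" using js(1,2) less.prems(1) by (auto simp: Cons)
      show "\<forall>j\<in>J. 0 < wall (Some j) (word js a0)" using less.prems(2) unfolding e .
    qed
    then show ?thesis using e by simp
  qed simp
qed

lemma parabolic_trivial:
  assumes x: "x \<in> PJ J" and p: "\<And>j. j \<in> J \<Longrightarrow> inv x (\<alpha> j) \<in> P" shows "x = id"
proof -
  obtain ks where ks: "set ks \<subseteq> Some ` J" "x = word ks" using parabolic_word[OF x] by blast
  have "0 < wall (Some j) (word ks a0)" if "j \<in> J" for j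
  proof -
    have "0 < a0 \<bullet> inv x (\<alpha> j)" using interior_a0 p[OF that] unfolding interior_def by blast
    then show ?thesis by (simp add: W0_adjoint[OF parabolic_W0[OF x]] flip: ks(2))
  qed
  then show ?thesis using word_trivial[OF ks(1)] ks(2) by blast
qed

text \<open>If \<open>x\<close> were not the identity, its inverse would make some simple root of \<open>J\<close> negative. The negative of
  this image is a positive root of \<open>\<Phi>\<^sub>J\<close>, which \<open>u\<inverse>\<close> keeps positive, against the positivity for \<open>x u\<close>.\<close>

lemma coset_rep_unique:
  assumes u: "u \<in> W0" "\<And>j. j \<in> J \<Longrightarrow> inv u (\<alpha> j) \<in> P"
    and u': "\<And>j. j \<in> J \<Longrightarrow> inv (x \<circ> u) (\<alpha> j) \<in> P" and x: "x \<in> PJ J"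
  shows "x = id"
proof (rule parabolic_trivial[OF x], rule ccontr)
  fix j assume j: "j \<in> J" and n: "inv x (\<alpha> j) \<notin> P"
  have "\<alpha> j \<in> RJ J" using j simple_in by (auto simp: roots_J_def intro: span_base)
  then have r: "inv x (\<alpha> j) \<in> RJ J" using parabolic_roots_J[OF parabolic_inv[OF x]] by blast
  then have rr: "inv x (\<alpha> j) \<in> \<Phi>" "- inv x (\<alpha> j) \<in> RJ J" using neg_root span_neg by (auto simp: roots_J_def)
  then have "- inv x (\<alpha> j) \<in> P" using not_pos_iff n by blast
  then have "inv u (- inv x (\<alpha> j)) \<in> P" using positive_on_parabolic_roots[OF u rr(2)] by blast
  moreover have "inv (x \<circ> u) (\<alpha> j) = inv u (inv x (\<alpha> j))"
    using o_inv_distrib[OF W0_bij[OF parabolic_W0[OF x]] W0_bij[OF u(1)]] by simp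
  moreover have "inv u (- inv x (\<alpha> j)) = - inv u (inv x (\<alpha> j))"
    using linear_neg[OF W0_linear[OF parabolic_inv[OF u(1)]]] .
  ultimately have "- inv (x \<circ> u) (\<alpha> j) \<in> P" by simp
  then show False using u'[OF j] not_pos_iff[of "inv (x \<circ> u) (\<alpha> j)"] pos_root by blast
qed

lemma coset_rep_exists:
  assumes "w \<in> W0" obtains x u where "x \<in> PJ J" "u \<in> MR J" "w = x \<circ> u"
proof -
  obtain x where x: "x \<in> PJ J" and m: "\<And>y. y \<in> PJ J \<Longrightarrow> ell (x \<circ> w) \<le> ell (y \<circ> w)"
    using ex_has_least_nat[of "\<lambda>x. x \<in> PJ J" id "\<lambda>x. ell (x \<circ> w)"] parabolic_id by blast
  have "x \<circ> w \<in> MR J"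
    unfolding min_reps_def
  proof (intro CollectI conjI ballI)
    show "x \<circ> w \<in> W0" by (rule parabolic_comp[OF parabolic_W0[OF x] assms])
    fix y assume "y \<in> PJ J"
    then show "ell (x \<circ> w) \<le> ell (y \<circ> (x \<circ> w))" using m[OF parabolic_comp[OF _ x]] by (simp only: o_assoc)
  qed
  moreover have "w = inv x \<circ> (x \<circ> w)"
    using inv_f_f'[OF W0_bij[OF parabolic_W0[OF x]]] by (auto simp: fun_eq_iff)
  ultimately show thesis using that parabolic_inv[OF x] by blast
qed

lemma min_repsI:
  assumes u: "u \<in> W0" "\<And>j. j \<in> J \<Longrightarrow> inv u (\<alpha> j) \<in> P" shows "u \<in> MR J"
proof -
  obtain x u' where x: "x \<in> PJ J" "u' \<in> MR J" "u = x \<circ> u'" using coset_rep_exists[OF u(1)] .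
  have "x = id"
    by (rule coset_rep_unique[OF min_reps_W0[OF x(2)] min_reps_pos_simple[OF x(2)] _ x(1)])
      (use u(2) x(3) in auto)
  then show ?thesis using x by simp
qed

lemma id_min_rep: "id \<in> MR J"
  by (rule min_repsI) (auto simp: parabolic_id simple_pos)

lemma theta_repI:
  assumes "u \<in> MR J" "x \<in> PJ J" "linear_part w = x \<circ> u" shows "theta_rep \<Phi> \<alpha> J w = u"
  unfolding theta_rep_def
proof (rule the_equality)
  show "u \<in> MR J \<and> (\<exists>x\<in>PJ J. linear_part w = x \<circ> u)" using assms by blast
  fix u' assume "u' \<in> MR J \<and> (\<exists>x\<in>PJ J. linear_part w = x \<circ> u')"
  then obtain y where y: "u' \<in> MR J" "y \<in> PJ J" "linear_part w = y \<circ> u'" by blast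
  have "inv x \<circ> (x \<circ> u) = u"
    using inv_f_f'[OF W0_bij[OF parabolic_W0[OF assms(2)]]] by (auto simp: fun_eq_iff)
  then have e: "u = (inv x \<circ> y) \<circ> u'" using assms(3) y(3) by (simp only: o_assoc[symmetric])
  have p: "inv ((inv x \<circ> y) \<circ> u') (\<alpha> j) \<in> P" if "j \<in> J" for j
    unfolding e[symmetric] by (rule min_reps_pos_simple[OF assms(1) that])
  have "inv x \<circ> y = id"
    by (rule coset_rep_unique[OF min_reps_W0[OF y(1)] min_reps_pos_simple[OF y(1)] p
          parabolic_comp[OF parabolic_inv[OF assms(2)] y(2)]])
  then show "u' = u" using e by simp
qed

lemma theta_rep:
  assumes "w \<in> We"
  obtains x where "x \<in> PJ J" "theta_rep \<Phi> \<alpha> J w \<in> MR J" "linear_part w = x \<circ> theta_rep \<Phi> \<alpha> J w"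
proof -
  obtain x u where "x \<in> PJ J" "u \<in> MR J" "linear_part w = x \<circ> u"
    using coset_rep_exists[OF ext_weyl_form(2)[OF assms]] .
  then show thesis using that theta_repI by metis
qed

lemma theta_rep_min_rep: "u \<in> MR J \<Longrightarrow> theta_rep \<Phi> \<alpha> J u = u"
  by (rule theta_repI[OF _ parabolic_id]) (simp_all add: linear_part_W0 min_reps_W0)

lemma W0_wall: "u \<in> W0 \<Longrightarrow> wall (Some i) (inv u x) = x \<bullet> u (\<alpha> i)"
  using W0_adjoint[OF parabolic_inv, of u x "\<alpha> i"] inv_inv_eq[OF W0_bij, of u] by simp

text \<open>Remove a last letter \<open>i\<close> of \<open>u\<close>, that is, one with \<open>u (\<alpha> i)\<close> negative. The shorter element is again a
  minimal representative, and the wall crossed in the last step does not belong to \<open>\<Phi>\<^sub>J\<close>.\<close>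

lemma min_rep_predecessor:
  assumes u: "u \<in> MR J" and ne: "u \<noteq> id"
  obtains i u' where "u' \<in> MR J" "u = u' \<circ> s (Some i)" "u' (\<alpha> i) \<in> P" "u' (\<alpha> i) \<notin> RJ J" "ell u' < ell u"
proof -
  have W: "u \<in> W0" using min_reps_W0[OF u] .
  have "inv u \<noteq> id" using ne inv_inv_eq[OF W0_bij[OF W]] by (metis inv_id)
  moreover have "inv (inv u) = u" using inv_inv_eq[OF W0_bij[OF W]] .
  ultimately obtain i where i: "u (\<alpha> i) \<notin> P"
    using parabolic_trivial[OF parabolic_inv[OF W]] by metis
  define u' where "u' = u \<circ> s (Some i)"
  have W': "u' \<in> W0" unfolding u'_def by (rule parabolic_comp[OF W gen_Some_W0])
  have neg: "- u (\<alpha> i) \<in> P" using i not_pos_iff[OF W0_root[OF W simple_in]] by blast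
  have inv': "inv u' = s (Some i) \<circ> inv u"
    unfolding u'_def using o_inv_distrib[OF W0_bij[OF W] W0_bij[OF gen_Some_W0[of i]]] by (simp only: inv_gen)
  have MR': "u' \<in> MR J"
  proof (rule min_repsI[OF W'], rule ccontr)
    fix j assume j: "j \<in> J" and "inv u' (\<alpha> j) \<notin> P"
    then have "reflect (\<alpha> i) (inv u (\<alpha> j)) \<notin> P" by (simp add: inv')
    then obtain c where c: "0 < c" "inv u (\<alpha> j) = c *\<^sub>R \<alpha> i"
      using pos_refl_neg[OF min_reps_pos_simple[OF u j]] by blast
    have "\<alpha> j = u (c *\<^sub>R \<alpha> i)" using c(2) f_inv_f'[OF W0_bij[OF W], of "\<alpha> j"] by simp
    then have "c *\<^sub>R u (\<alpha> i) \<in> P" using simple_pos[of j] linear_scale[OF W0_linear[OF W]] by simp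
    then show False using pos_scale[OF c(1)] i W0_root[OF W simple_in] by blast
  qed
  have e: "u' (\<alpha> i) = - u (\<alpha> i)"
    unfolding u'_def using linear_neg[OF W0_linear[OF W]] refl_self[OF simple_nz[of i]] by simp
  have nJ: "u' (\<alpha> i) \<notin> RJ J"
  proof
    assume "u' (\<alpha> i) \<in> RJ J"
    then have "inv u (- u (\<alpha> i)) \<in> P" using min_reps_pos[OF u] neg e by simp
    moreover have "inv u (- u (\<alpha> i)) = - \<alpha> i"
      using linear_neg[OF W0_linear[OF parabolic_inv[OF W]]] inv_f_f'[OF W0_bij[OF W]] by simp
    ultimately show False using not_pos_iff[OF simple_in[of i]] simple_pos[of i] by simp
  qed
  have "0 < a0 \<bullet> - u (\<alpha> i)" using interior_a0 neg unfolding interior_def by blast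
  then have "wall (Some i) (inv u a0) < 0" unfolding W0_wall[OF W] by simp
  then have "ell u' < ell u" unfolding u'_def by (rule len_gen_less[OF W0_ext[OF W]])
  moreover have "u = u' \<circ> s (Some i)" unfolding u'_def by (simp only: o_assoc[symmetric] gen_gen_comp comp_id)
  moreover have "u' (\<alpha> i) \<in> P" using e neg by simp
  ultimately show thesis using that MR' nJ by blast
qed

lemma min_rep_induct [consumes 1, case_names id step]:
  assumes "u \<in> MR J" and id: "Q id"
    and step: "\<And>u i. u \<in> MR J \<Longrightarrow> u \<circ> s (Some i) \<in> MR J \<Longrightarrow> u (\<alpha> i) \<in> P \<Longrightarrow> u (\<alpha> i) \<notin> RJ J \<Longrightarrow> Q u
      \<Longrightarrow> Q (u \<circ> s (Some i))"
  shows "Q u"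
  using assms(1)
proof (induction "ell u" arbitrary: u rule: less_induct)
  case less
  show ?case
  proof (cases "u = id")
    case False
    obtain i u' where u': "u' \<in> MR J" "u = u' \<circ> s (Some i)" "u' (\<alpha> i) \<in> P" "u' (\<alpha> i) \<notin> RJ J" "ell u' < ell u"
      using min_rep_predecessor[OF less.prems False] .
    show ?thesis using step[OF u'(1) _ u'(3,4) less.hyps[OF u'(5,1)]] less.prems unfolding u'(2)[symmetric] by blast
  qed (simp add: id)
qed

lemma min_rep_alcove:
  assumes u: "u \<in> MR J" and b: "\<beta> \<in> RJ J" "\<beta> \<in> P" shows "0 < u a0 \<bullet> \<beta>" "u a0 \<bullet> \<beta> < 1"
  using interior_a0 min_reps_pos[OF u b] W0_adjoint[OF min_reps_W0[OF u], of a0 \<beta>]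
  unfolding interior_def by simp_all

text \<open>The strip is bounded by the hyperplanes of \<open>\<Phi>\<^sub>J\<close> and none of these cuts its interior, so a step leaves the
  strip exactly when the wall it crosses is parallel to a hyperplane of \<open>\<Phi>\<^sub>J\<close>.\<close>

lemma strip_iff:
  assumes u: "u \<in> MR J"
  shows "u \<circ> s i \<in> strip_elements \<Phi> \<alpha> J \<longleftrightarrow> u (grad i) \<notin> RJ J"
proof
  have W: "u \<in> W0" and U: "u \<in> We" using min_reps_W0[OF u] W0_ext by auto
  have lu: "linear_part u = u" using linear_part_W0[OF W] .
  have us: "u \<circ> s i \<in> We" using ext_comp[OF U gen_ext] .
  {
    assume st: "u \<circ> s i \<in> strip_elements \<Phi> \<alpha> J"
    have bound: "0 \<le> u (s i a0) \<bullet> \<beta>" "u (s i a0) \<bullet> \<beta> \<le> 1" if "\<beta> \<in> RJ J" "\<beta> \<in> P" for \<beta>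
      using st a0_alcove that unfolding strip_elements_def strip_J_def by fastforce+
    show "u (grad i) \<notin> RJ J"
    proof
      assume r: "u (grad i) \<in> RJ J"
      obtain k :: int where k: "\<And>x. wall i x = u x \<bullet> u (grad i) + of_int k" using wall_pull[OF U, of i] unfolding lu by blast
      have k1: "0 < u a0 \<bullet> u (grad i) + of_int k" "u (s i a0) \<bullet> u (grad i) + of_int k < 0"
        using wall_a0[of i] wall_gen[of i a0] k[of a0] k[of "s i a0"] by auto
      show False
      proof (cases "u (grad i) \<in> P")
        case True
        have "-1 < (of_int k :: real)" using k1(1) min_rep_alcove(2)[OF u r True] by linarith
        then have "0 \<le> (of_int k :: real)" by simp
        then show False using bound(1)[OF r True] k1(2) by linarith
      next
        case False
        then have p: "- u (grad i) \<in> P" using not_pos_iff r by (auto simp: roots_J_def)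
        have r': "- u (grad i) \<in> RJ J" using r neg_root span_neg by (auto simp: roots_J_def)
        have "0 < (of_int k :: real)" using k1(1) min_rep_alcove(1)[OF u r' p] by simp
        then have "1 \<le> (of_int k :: real)" by simp
        then show False using bound(2)[OF r' p] k1(2) by simp
      qed
    qed
  }
  assume nr: "u (grad i) \<notin> RJ J"
  have key: "0 \<le> u (s i a) \<bullet> \<gamma> + of_int k"
    if a: "a \<in> fund_alcove \<Phi> \<alpha>" and g: "\<gamma> \<in> RJ J" and p: "0 < u a0 \<bullet> \<gamma> + of_int k" for a \<gamma> and k :: int
  proof -
    have f: "affine_root (\<lambda>y. y \<bullet> \<gamma> + of_int k)" using g by (intro affine_rootI) (simp add: roots_J_def)
    have "\<not> u (s i a0) \<bullet> \<gamma> + of_int k \<le> 0"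
    proof
      assume "u (s i a0) \<bullet> \<gamma> + of_int k \<le> 0"
      then obtain c where c: "0 < c" "\<gamma> = c *\<^sub>R u (grad i)"
        using crossing_gradient[OF U f, of i] p unfolding lu by auto
      have "(1 / c) *\<^sub>R \<gamma> \<in> span (\<alpha> ` J)" using g by (intro span_scale) (simp add: roots_J_def)
      then have "u (grad i) \<in> RJ J" using c W0_root[OF W grad_root] by (simp add: roots_J_def)
      then show False using nr by blast
    qed
    then have "0 < ((\<lambda>y. y \<bullet> \<gamma> + of_int k) \<circ> (u \<circ> s i)) a0" by simp
    then have "0 \<le> ((\<lambda>y. y \<bullet> \<gamma> + of_int k) \<circ> (u \<circ> s i)) a"
      using affine_root_sign_interior[OF affine_root_comp[OF f us] interior_a0] a by (auto dest: less_asym)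
    then show ?thesis by simp
  qed
  show "u \<circ> s i \<in> strip_elements \<Phi> \<alpha> J"
    unfolding strip_elements_def strip_J_def
  proof (intro CollectI conjI subsetI ballI us)
    fix y \<beta> assume "y \<in> (u \<circ> s i) ` fund_alcove \<Phi> \<alpha>" and b: "\<beta> \<in> RJ J \<inter> P"
    then obtain a where a: "a \<in> fund_alcove \<Phi> \<alpha>" "y = u (s i a)" by auto
    have nb: "- \<beta> \<in> RJ J" using b neg_root span_neg by (auto simp: roots_J_def)
    have bb: "\<beta> \<in> RJ J" "\<beta> \<in> P" using b by auto
    show "0 \<le> y \<bullet> \<beta>" using key[OF a(1) bb(1), of 0] min_rep_alcove[OF u bb] a(2) by simp
    show "y \<bullet> \<beta> \<le> 1" using key[OF a(1) nb, of 1] min_rep_alcove[OF u bb] a(2) by simp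
  qed
qed

text \<open>The roots span the space, so a Weyl group element is determined by its permutation of the roots.\<close>

lemma finite_W0: "finite W0"
proof -
  have "inj_on (\<lambda>w. restrict w \<Phi>) W0"
  proof (rule inj_onI)
    fix w w' assume w: "w \<in> W0" "w' \<in> W0" "restrict w \<Phi> = restrict w' \<Phi>"
    have "w \<beta> = w' \<beta>" if "\<beta> \<in> \<Phi>" for \<beta> using fun_cong[OF w(3), of \<beta>] that by simp
    then have "w x = w' x" for x
      using linear_eq_on_span[OF W0_linear[OF w(1)] W0_linear[OF w(2)], of \<Phi> x] span_roots by auto
    then show "w = w'" by (rule ext)
  qed
  moreover have "(\<lambda>w. restrict w \<Phi>) ` W0 \<subseteq> (\<Pi>\<^sub>E \<beta>\<in>\<Phi>. \<Phi>)" using W0_root by auto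
  moreover have "finite (\<Pi>\<^sub>E \<beta>\<in>\<Phi>. \<Phi>)" using finite_roots by (intro finite_PiE) auto
  ultimately show ?thesis using finite_subset finite_imageD by blast
qed

lemma finite_min_reps: "finite (MR J)"
  by (rule finite_subset[OF _ finite_W0]) (auto simp: min_reps_def)

section \<open>Alcove walks in the dominant chamber\<close>

lemma rho_lattice: "of_nat k *\<^sub>R \<rho> \<in> coweight_lattice \<alpha>"
  unfolding lattice_iff
proof
  fix \<beta> assume b: "\<beta> \<in> \<Phi>"
  have "\<rho> \<bullet> \<beta> \<in> \<int>" unfolding rho_inner by (intro Ints_sum Ints_coord[OF b])
  then show "of_nat k *\<^sub>R \<rho> \<bullet> \<beta> \<in> \<int>" by (simp add: Ints_mult)
qed

abbreviation tt :: "nat \<Rightarrow> 'v \<Rightarrow> 'v" where "tt k \<equiv> translation (of_nat k *\<^sub>R \<rho>)"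

lemma tt_ext: "tt k \<in> We"
  by (rule translation_ext[OF rho_lattice])

text \<open>The translate of \<open>w A\<^sub>0\<close> by \<open>k \<rho>\<close> lies inside the dominant chamber.\<close>

definition deep :: "nat \<Rightarrow> ('v \<Rightarrow> 'v) \<Rightarrow> bool" where
  "deep k w \<longleftrightarrow> (\<forall>\<beta>\<in>P. 0 < tt k (w a0) \<bullet> \<beta>)"

lemma finite_pos: "finite P"
  using finite_subset[OF _ finite_roots] pos_root by blast

lemma eventually_deep: "\<forall>\<^sub>F k in sequentially. deep k w"
  unfolding deep_def
proof (subst eventually_ball_finite_distrib[OF finite_pos], rule ballI)
  fix \<beta> assume b: "\<beta> \<in> P"
  show "\<forall>\<^sub>F k in sequentially. 0 < tt k (w a0) \<bullet> \<beta>"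
  \<comment> \<open>heights are at least \<open>1\<close>, so it suffices that \<open>k\<close> exceeds the absolute value of \<open>w a0 \<bullet> \<beta>\<close>\<close>
  proof (rule eventually_sequentiallyI[of "nat \<lceil>\<bar>w a0 \<bullet> \<beta>\<bar>\<rceil> + 1"])
    fix k assume "nat \<lceil>\<bar>w a0 \<bullet> \<beta>\<bar>\<rceil> + 1 \<le> k"
    then have "\<bar>w a0 \<bullet> \<beta>\<bar> < real k" by linarith
    moreover have "real k * 1 \<le> real k * (\<rho> \<bullet> \<beta>)" using rho_pos[OF b] by (intro mult_left_mono) auto
    ultimately show "0 < tt k (w a0) \<bullet> \<beta>" by (simp add: translation_def inner_left_distrib)
  qed
qed

lemma linear_part_tt: "w \<in> We \<Longrightarrow> linear_part (tt k \<circ> w) = linear_part w"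
  by (simp add: linear_part_comp tt_ext linear_part_translation)

text \<open>A hyperplane that separates two alcoves of the dominant chamber has the fundamental alcove on the side
  where the values of its positive root are smaller. The crossing is therefore positive exactly when
  it leads away from the fundamental alcove, and this increases the length.\<close>

lemma deep_crossing:
  assumes w: "w \<in> We" and d: "deep k w" "deep k (w \<circ> s i)"
  shows "if positive_crossing \<Phi> \<alpha> w i then ell (tt k \<circ> w \<circ> s i) = ell (tt k \<circ> w) + 1
    else ell (tt k \<circ> w) = ell (tt k \<circ> w \<circ> s i) + 1"
proof -
  let ?y = "tt k \<circ> w"
  let ?g = "linear_part w (grad i)"
  have y: "?y \<in> We" by (rule ext_comp[OF tt_ext w])
  have g: "?g \<in> \<Phi>" using lin_grad_root[OF w] .
  obtain n :: int where n: "\<And>x. wall i x = ?y x \<bullet> ?g + of_int n"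
    using wall_pull[OF y, of i] unfolding linear_part_tt[OF w] by blast
  have e: "wall i (inv ?y a0) = a0 \<bullet> ?g + of_int n"
    using n[of "inv ?y a0"] f_inv_f'[OF ext_bij[OF y], of a0] by simp
  show ?thesis
  proof (cases "?g \<in> P")
    case True
    have "?y (s i a0) \<bullet> ?g + of_int n < 0" using n[of "s i a0"] wall_gen[of i a0] wall_a0[of i] by simp
    moreover have "0 < ?y (s i a0) \<bullet> ?g" using d(2) True by (simp add: deep_def)
    ultimately have "of_int n < (0::real)" by linarith
    then have "of_int n \<le> (-1::real)" by simp
    then have "wall i (inv ?y a0) < 0" using e interior_reflect_bound(2)[OF interior_a0 g] by linarith
    then show ?thesis using len_descent[OF y] positive_crossing_iff[OF w] True by simp
  next
    case False
    then have m: "- ?g \<in> P" using not_pos_iff[OF g] by blast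
    have "0 < ?y a0 \<bullet> ?g + of_int n" using n[of a0] wall_a0[of i] by simp
    moreover have "0 < ?y a0 \<bullet> - ?g" using d(1) m unfolding deep_def comp_apply by blast
    ultimately have "(0::real) < of_int n" by simp
    then have "(1::real) \<le> of_int n" by simp
    then have "0 < wall i (inv ?y a0)" using e interior_reflect_bound(1)[OF interior_a0 g] by linarith
    then show ?thesis using len_ascent[OF y] positive_crossing_iff[OF w] False by simp
  qed
qed

end

section \<open>The Hecke algebra and the elements X\<close>

locale hecke = based_roots \<Phi> \<alpha>
  for \<Phi> :: "'v::euclidean_space set" and \<alpha> :: "'i::{finite,linorder} \<Rightarrow> 'v" +
  fixes cls :: "'i option \<Rightarrow> 'c" and scaleH :: "'c qring \<Rightarrow> 'h::ring_1 \<Rightarrow> 'h" and T :: "('v \<Rightarrow> 'v) \<Rightarrow> 'h"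
  assumes hecke: "hecke_algebra \<Phi> \<alpha> cls scaleH T"
begin

sublocale H: module scaleH
  using hecke by (simp add: hecke_algebra_def)

lemma scale_left: "scaleH r (x * y) = scaleH r x * y" and scale_right: "scaleH r (x * y) = x * scaleH r y"
  using hecke unfolding hecke_algebra_def by blast+

lemma span_T: "H.span (T ` We) = UNIV"
  using hecke by (simp add: hecke_algebra_def free_basis_def)

lemma T_comp: "w \<in> We \<Longrightarrow> x \<in> We \<Longrightarrow> ell (w \<circ> x) = ell w + ell x \<Longrightarrow> T w * T x = T (w \<circ> x)"
  using hecke unfolding hecke_algebra_def by blast

definition \<xi> :: "'i option \<Rightarrow> 'c qring" where "\<xi> i = qpar cls i - qpar_inv cls i"

lemma T_quadratic:
  "w \<in> We \<Longrightarrow> ell w = ell (w \<circ> s i) + 1 \<Longrightarrow> T w * T (s i) = T (w \<circ> s i) + scaleH (\<xi> i) (T w)"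
  using hecke unfolding hecke_algebra_def \<xi>_def by blast

text \<open>The element \<open>T id\<close> acts as a left identity on the basis, hence on \<open>1\<close>.\<close>

lemma T_id: "T id = 1"
proof -
  have "T id * h = h" for h
  proof -
    have "h \<in> H.span (T ` We)" using span_T by simp
    then show ?thesis
    proof (rule H.span_induct)
      show "H.subspace {h. T id * h = h}"
        by (auto simp: H.subspace_def distrib_left scale_right[symmetric])
      fix x assume "x \<in> T ` We"
      then obtain w where w: "w \<in> We" "x = T w" by blast
      then show "T id * x = x" using T_comp[OF id_ext w(1)] len_stab[OF stab_id] by simp
    qed
  qed
  from this[of 1] show ?thesis by simp
qed

lemma T_ascent: "w \<in> We \<Longrightarrow> ell (w \<circ> s i) = ell w + 1 \<Longrightarrow> T w * T (s i) = T (w \<circ> s i)"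
  by (rule T_comp) (simp_all add: gen_ext len_gen del: gen.simps)

lemma gen_cancel: "w \<circ> s i \<circ> s i = w"
  by (simp only: o_assoc[symmetric] gen_gen_comp comp_id)

lemma T_descent: "w \<in> We \<Longrightarrow> ell w = ell (w \<circ> s i) + 1 \<Longrightarrow> T (w \<circ> s i) * T (s i) = T w"
  using T_ascent[OF ext_comp[OF _ gen_ext], of w i i] by (simp only: gen_cancel)

lemma T_stab: "w \<in> We \<Longrightarrow> \<sigma> \<in> \<Sigma> \<Longrightarrow> T w * T \<sigma> = T (w \<circ> \<sigma>)"
  by (rule T_comp) (simp_all add: stab_ext len_stab len_comp_stab)

definition Tinv :: "'i option \<Rightarrow> 'h" where "Tinv i = T (s i) - scaleH (\<xi> i) 1"

lemma T_square: "T (s i) * T (s i) = 1 + scaleH (\<xi> i) (T (s i))"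
  using T_quadratic[OF gen_ext, of i i] len_gen[of i] len_stab[OF stab_id] by (simp only: gen_gen_comp T_id)

lemma T_Tinv: "T (s i) * Tinv i = 1" "Tinv i * T (s i) = 1"
  using T_square[of i] scale_right[of "\<xi> i" "T (s i)" 1] scale_left[of "\<xi> i" 1 "T (s i)"]
  by (simp_all add: Tinv_def algebra_simps del: gen.simps)

lemma ring_inverse_T: "ring_inverse (T (s i)) = Tinv i"
  unfolding ring_inverse_def
proof (rule the_equality)
  fix y assume y: "T (s i) * y = 1 \<and> y * T (s i) = 1"
  have "y = (Tinv i * T (s i)) * y" using T_Tinv by simp
  also have "\<dots> = Tinv i" using y by (simp only: mult.assoc mult_1_right)
  finally show "y = Tinv i" .
qed (simp add: T_Tinv del: gen.simps)

text \<open>By a reduced word, from the inverses of the \<open>T (s i)\<close> and of the \<open>T \<sigma>\<close>.\<close>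

lemma T_left_inverse: "w \<in> We \<Longrightarrow> \<exists>y. y * T w = 1"
proof (induction "ell w" arbitrary: w rule: less_induct)
  case less
  show ?case
  proof (cases "w \<in> \<Sigma>")
    case True
    have "T (inv w) * T w = 1"
      using T_stab[OF ext_inv[OF less.prems] True] bij_is_inj[OF ext_bij[OF less.prems]] T_id by simp
    then show ?thesis by blast
  next
    case False
    then obtain i where i: "wall i (inv w a0) < 0" using descent_or_stab[OF less.prems] by blast
    note l = len_descent[OF less.prems i]
    obtain y where y: "y * T (w \<circ> s i) = 1" using less.hyps[of "w \<circ> s i"] l ext_comp[OF less.prems gen_ext] by auto
    have "Tinv i * y * T w = Tinv i * (y * T (w \<circ> s i)) * T (s i)"
      using T_descent[OF less.prems l] by (simp only: mult.assoc)
    then have "Tinv i * y * T w = 1" using y T_Tinv by simp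
    then show ?thesis by blast
  qed
qed

lemma T_left_cancel: "w \<in> We \<Longrightarrow> T w * x = T w * y \<Longrightarrow> x = y"
  using T_left_inverse by (metis mult.assoc mult_1_left)

text \<open>The factor that a step of an alcove walk contributes.\<close>

definition crossing_factor :: "('v \<Rightarrow> 'v) \<Rightarrow> 'i option \<Rightarrow> 'h" where
  "crossing_factor w i = (if positive_crossing \<Phi> \<alpha> w i then T (s i) else Tinv i)"

lemma crossing_factor_eq: "w \<in> We \<Longrightarrow> crossing_factor w i = (if linear_part w (grad i) \<in> P then Tinv i else T (s i))"
  by (simp add: crossing_factor_def positive_crossing_iff del: gen.simps)

lemma deep_step:
  assumes w: "w \<in> We" and d: "deep k w" "deep k (w \<circ> s i)"
  shows "T (tt k \<circ> w) * crossing_factor w i = T (tt k \<circ> (w \<circ> s i))"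
proof -
  have y: "tt k \<circ> w \<in> We" by (rule ext_comp[OF tt_ext w])
  show ?thesis
  proof (cases "positive_crossing \<Phi> \<alpha> w i")
    case True
    then show ?thesis using deep_crossing[OF assms] T_ascent[OF y, of i]
      by (simp add: crossing_factor_def o_assoc del: gen.simps)
  next
    case False
    then have "T (tt k \<circ> w \<circ> s i) * T (s i) = T (tt k \<circ> w)"
      using deep_crossing[OF assms] T_descent[OF y, of i] by simp
    then have "T (tt k \<circ> w) * Tinv i = T (tt k \<circ> w \<circ> s i) * (T (s i) * Tinv i)"
      by (simp only: mult.assoc[symmetric])
    then show ?thesis using False T_Tinv(1)[of i] by (simp add: crossing_factor_def o_assoc del: gen.simps)
  qed
qed

text \<open>The characterisation of \<open>X\<^sub>w\<close> by a deep translate. All computations with \<open>X\<^sub>w\<close> go through it, so that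
  the braid relations are not visible.\<close>

definition is_X :: "('v \<Rightarrow> 'v) \<Rightarrow> 'h \<Rightarrow> bool" where
  "is_X w x \<longleftrightarrow> (\<forall>\<^sub>F k in sequentially. T (tt k) * x = T (tt k \<circ> w))"

lemma is_X_unique: assumes "is_X w x" "is_X w y" shows "x = y"
proof -
  have "\<forall>\<^sub>F k in sequentially. T (tt k) * x = T (tt k) * y"
    using assms unfolding is_X_def by eventually_elim simp
  then obtain k where "T (tt k) * x = T (tt k) * y" by (auto simp: eventually_sequentially)
  then show ?thesis by (rule T_left_cancel[OF tt_ext])
qed

lemma is_X_id: "is_X id 1"
  by (simp add: is_X_def)

lemma is_X_step: assumes "w \<in> We" "is_X w x" shows "is_X (w \<circ> s i) (x * crossing_factor w i)"
  using assms(2) eventually_deep[of w] eventually_deep[of "w \<circ> s i"] unfolding is_X_def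
proof eventually_elim
  case (elim k)
  then show ?case using deep_step[OF assms(1), of k i] by (simp only: mult.assoc[symmetric])
qed

lemma is_X_stab: assumes "w \<in> We" "is_X w x" "\<sigma> \<in> \<Sigma>" shows "is_X (w \<circ> \<sigma>) (x * T \<sigma>)"
  using assms(2) unfolding is_X_def
proof eventually_elim
  case (elim k)
  then show ?case using T_stab[OF ext_comp[OF tt_ext assms(1)] assms(3), of k]
    by (simp only: mult.assoc[symmetric] o_assoc)
qed

abbreviation "walkT \<equiv> walk \<Phi> \<alpha> T"
abbreviation "X \<equiv> X_elt \<Phi> \<alpha> T"

lemma walk_Cons: "walkT w (i # ks) = crossing_factor w i * walkT (w \<circ> s i) ks"
  by (simp add: crossing_factor_def ring_inverse_T del: gen.simps)

lemma is_X_walk: "w \<in> We \<Longrightarrow> is_X w x \<Longrightarrow> is_X (w \<circ> word ks) (x * walkT w ks)"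
proof (induction ks arbitrary: w x)
  case (Cons i ks)
  show ?case
    using Cons.IH[OF ext_comp[OF Cons.prems(1) gen_ext[of i]] is_X_step[OF Cons.prems, of i]]
    by (simp only: walk_Cons word_simps o_assoc mult.assoc)
qed simp

text \<open>All words of \<open>w\<close> yield solutions of the characterising identity, and these coincide.\<close>

lemma X_elt_walk: assumes "\<sigma> \<in> \<Sigma>" shows "X (word ks \<circ> \<sigma>) = walkT id ks * T \<sigma>"
    and is_X_elt_walk: "is_X (word ks \<circ> \<sigma>) (walkT id ks * T \<sigma>)"
proof -
  have isX: "is_X (word ks \<circ> \<sigma>) (walkT id ks * T \<sigma>)" if "\<sigma> \<in> \<Sigma>" for ks \<sigma>
    using is_X_stab[OF word_ext _ that] is_X_walk[OF id_ext is_X_id, of ks] by (simp only: id_comp mult_1_left)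
  show "is_X (word ks \<circ> \<sigma>) (walkT id ks * T \<sigma>)" by (rule isX[OF assms])
  show "X (word ks \<circ> \<sigma>) = walkT id ks * T \<sigma>"
    unfolding X_elt_def
  proof (rule the_equality)
    fix x assume "\<exists>js \<tau>. \<tau> \<in> \<Sigma> \<and> word ks \<circ> \<sigma> = word js \<circ> \<tau> \<and> x = walkT id js * T \<tau>"
    then obtain js \<tau> where j: "\<tau> \<in> \<Sigma>" "word ks \<circ> \<sigma> = word js \<circ> \<tau>" "x = walkT id js * T \<tau>" by blast
    then have "is_X (word ks \<circ> \<sigma>) x" using isX[OF j(1), of js] by simp
    then show "x = walkT id ks * T \<sigma>" using is_X_unique isX[OF assms] by blast
  qed (use assms in blast)
qed

lemma is_X_X: "w \<in> We \<Longrightarrow> is_X w (X w)"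
  using ex_word X_elt_walk is_X_elt_walk by metis

lemma X_eqI: "w \<in> We \<Longrightarrow> is_X w x \<Longrightarrow> X w = x"
  using is_X_unique is_X_X by blast

lemma X_id: "X id = 1"
  by (rule X_eqI[OF id_ext is_X_id])

lemma X_step: "w \<in> We \<Longrightarrow> X (w \<circ> s i) = X w * crossing_factor w i"
  by (rule X_eqI[OF ext_comp[OF _ gen_ext] is_X_step[OF _ is_X_X]])

lemma X_stab: "w \<in> We \<Longrightarrow> \<sigma> \<in> \<Sigma> \<Longrightarrow> X (w \<circ> \<sigma>) = X w * T \<sigma>"
  by (rule X_eqI[OF ext_comp[OF _ stab_ext] is_X_stab[OF _ is_X_X]])

lemma X_word: "w \<in> We \<Longrightarrow> X (w \<circ> word ks) = X w * walkT w ks"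
  by (rule X_eqI[OF ext_comp[OF _ word_ext] is_X_walk[OF _ is_X_X]])

lemma walk_cong: "w \<in> We \<Longrightarrow> w' \<in> We \<Longrightarrow> linear_part w = linear_part w' \<Longrightarrow> walkT w ks = walkT w' ks"
proof (induction ks arbitrary: w w')
  case (Cons i ks)
  have "walkT (w \<circ> s i) ks = walkT (w' \<circ> s i) ks"
    by (rule Cons.IH[OF ext_comp[OF Cons.prems(1) gen_ext] ext_comp[OF Cons.prems(2) gen_ext]])
      (simp only: linear_part_comp[OF Cons.prems(1) gen_ext] linear_part_comp[OF Cons.prems(2) gen_ext] Cons.prems(3))
  then show ?case using Cons.prems by (simp only: walk_Cons crossing_factor_eq)
qed simp

text \<open>The signs of the crossings of a walk are invariant under translation.\<close>

lemma X_translation: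
  assumes m: "\<mu> \<in> coweight_lattice \<alpha>" and w: "w \<in> We"
  shows "X (translation \<mu> \<circ> w) = X (translation \<mu>) * X w"
proof -
  obtain ks \<sigma> where ks: "\<sigma> \<in> \<Sigma>" "w = word ks \<circ> \<sigma>" using ex_word[OF w] by blast
  have t: "translation \<mu> \<in> We" by (rule translation_ext[OF m])
  have lid: "linear_part (id :: 'v \<Rightarrow> 'v) = id" by (rule linear_part_W0[OF parabolic_id])
  have "X (translation \<mu> \<circ> word ks \<circ> \<sigma>) = X (translation \<mu>) * walkT (translation \<mu>) ks * T \<sigma>"
    by (simp only: X_stab[OF ext_comp[OF t word_ext] ks(1)] X_word[OF t])
  also have "walkT (translation \<mu>) ks = walkT id ks"
    by (rule walk_cong[OF t id_ext]) (simp only: linear_part_translation lid)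
  finally show ?thesis by (simp only: ks(2) o_assoc X_elt_walk[OF ks(1)] mult.assoc)
qed

abbreviation "LJ J \<equiv> levi \<Phi> \<alpha> J scaleH T"

lemma levi_T: "j \<in> J \<Longrightarrow> T (s (Some j)) \<in> LJ J"
  unfolding levi_def by (rule generated_subalgebra.intros) blast

lemma levi_X: "\<mu> \<in> coweight_lattice \<alpha> \<Longrightarrow> X (translation \<mu>) \<in> LJ J"
  unfolding levi_def by (rule generated_subalgebra.intros) blast

lemma levi_one: "1 \<in> LJ J" and levi_scale: "x \<in> LJ J \<Longrightarrow> scaleH r x \<in> LJ J"
  and levi_add: "x \<in> LJ J \<Longrightarrow> y \<in> LJ J \<Longrightarrow> x + y \<in> LJ J"
  and levi_mult: "x \<in> LJ J \<Longrightarrow> y \<in> LJ J \<Longrightarrow> x * y \<in> LJ J"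
  unfolding levi_def by (auto intro: generated_subalgebra.intros)

lemma levi_Tinv: assumes "j \<in> J" shows "Tinv (Some j) \<in> LJ J"
proof -
  have "T (s (Some j)) + scaleH (- \<xi> (Some j)) 1 \<in> LJ J"
    by (rule levi_add[OF levi_T[OF assms] levi_scale[OF levi_one]])
  then show ?thesis by (simp add: Tinv_def del: gen.simps)
qed

lemma X_parabolic: "x \<in> PJ J \<Longrightarrow> X x \<in> LJ J"
proof (induction rule: parabolic_induct)
  case id show ?case unfolding X_id by (rule levi_one)
next
  case (step w j)
  have "X (w \<circ> s (Some j)) = X w * crossing_factor w (Some j)"
    by (rule X_step[OF W0_ext[OF parabolic_W0[OF step.hyps(1)]]])
  moreover have "crossing_factor w (Some j) \<in> LJ J"
    using levi_T[OF step.hyps(2)] levi_Tinv[OF step.hyps(2)] by (simp add: crossing_factor_def)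
  ultimately have "X (w \<circ> s (Some j)) \<in> LJ J" using levi_mult[OF step.IH] by metis
  then show ?case by (simp only: gen.simps)
qed

lemma crossing_factor_neg: "w \<in> W0 \<Longrightarrow> w (\<alpha> i) \<in> P \<Longrightarrow> crossing_factor w (Some i) = Tinv (Some i)"
  by (simp add: crossing_factor_eq W0_ext linear_part_W0)

lemma X_min_rep_step: "u \<in> W0 \<Longrightarrow> u (\<alpha> i) \<in> P \<Longrightarrow> X (u \<circ> s (Some i)) = X u * Tinv (Some i)"
  using X_step[OF W0_ext, of u "Some i"] crossing_factor_neg[of u i] by simp

text \<open>A reduced word of \<open>u\<close> crosses no hyperplane of \<open>\<Phi>\<^sub>J\<close>. All its crossings are negative, and \<open>x\<close> preserves
  their signs.\<close>

lemma X_parabolic_min_rep: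
  assumes x: "x \<in> PJ J" and u: "u \<in> MR J" shows "X (x \<circ> u) = X x * X u"
  using u
proof (induction rule: min_rep_induct)
  case id show ?case by (simp only: comp_id X_id mult_1_right)
next
  case (step u i)
  have W: "u \<in> W0" by (rule min_reps_W0[OF step.hyps(1)])
  have "x (u (\<alpha> i)) \<in> P"
    using parabolic_pos_iff[OF x W0_root[OF W simple_in] step.hyps(4)] step.hyps(3) by blast
  then have "X ((x \<circ> u) \<circ> s (Some i)) = X (x \<circ> u) * Tinv (Some i)"
    by (intro X_min_rep_step[OF parabolic_comp[OF parabolic_W0[OF x] W]]) simp
  also have "\<dots> = X x * (X u * Tinv (Some i))" by (simp only: step.IH mult.assoc)
  also have "X u * Tinv (Some i) = X (u \<circ> s (Some i))"
    by (rule X_min_rep_step[OF W step.hyps(3), symmetric])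
  finally show ?case by (simp only: o_assoc)
qed

text \<open>Decompose \<open>w\<close> into a translation, an element of \<open>W\<^sub>J\<close> and a minimal representative; the first two
  contribute elements of the Levi subalgebra.\<close>

lemma X_factor:
  assumes w: "w \<in> We" shows "\<exists>l\<in>LJ J. X w = l * X (theta_rep \<Phi> \<alpha> J w)"
proof -
  obtain x where x: "x \<in> PJ J" "theta_rep \<Phi> \<alpha> J w \<in> MR J" "linear_part w = x \<circ> theta_rep \<Phi> \<alpha> J w"
    using theta_rep[OF w] .
  let ?u = "theta_rep \<Phi> \<alpha> J w"
  note f = ext_weyl_form[OF w]
  have "X w = X (translation (wt w) \<circ> linear_part w)" by (simp only: ext_weyl_decomp[OF w, symmetric])
  also have "\<dots> = X (translation (wt w)) * X (linear_part w)" by (rule X_translation[OF f(1) W0_ext[OF f(2)]])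
  also have "X (linear_part w) = X x * X ?u" unfolding x(3) by (rule X_parabolic_min_rep[OF x(1,2)])
  finally have "X w = (X (translation (wt w)) * X x) * X ?u" by (simp only: mult.assoc)
  then show ?thesis using levi_mult[OF levi_X[OF f(1)] X_parabolic[OF x(1)]] by blast
qed

text \<open>The factor \<open>T (s i)\<close> and its inverse differ by a scalar, so right multiplication by \<open>T (s i)\<close> preserves the
  span of the \<open>X\<^sub>w\<close>. The span contains \<open>1\<close>, and every \<open>T w\<close> is a product along a reduced word.\<close>

lemma span_X: "H.span (X ` We) = UNIV"
proof -
  let ?S = "H.span (X ` We)"
  have mult: "h * k \<in> ?S" if "\<And>w. w \<in> We \<Longrightarrow> X w * k \<in> ?S" "h \<in> ?S" for h k
    using that(2)
  proof (rule H.span_induct)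
    show "H.subspace {h. h * k \<in> ?S}"
      by (auto simp: H.subspace_def distrib_right scale_left[symmetric] H.span_zero H.span_add H.span_scale)
  qed (use that(1) in blast)
  have XS: "X w \<in> ?S" if "w \<in> We" for w using that by (intro H.span_base) blast
  have gen: "X w * T (s i) \<in> ?S" if w: "w \<in> We" for w i
  proof -
    \<comment> \<open>the first case is a positive crossing, the second a negative one\<close>
    have "X w * T (s i) = X (w \<circ> s i) \<or> X w * T (s i) = X (w \<circ> s i) + scaleH (\<xi> i) (X w)"
      using X_step[OF w, of i] scale_right[of "\<xi> i" "X w" 1]
      by (simp add: crossing_factor_def Tinv_def algebra_simps del: gen.simps)
    moreover have "X (w \<circ> s i) \<in> ?S" "scaleH (\<xi> i) (X w) \<in> ?S"
      using XS[OF ext_comp[OF w gen_ext]] XS[OF w] H.span_scale by auto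
    ultimately show ?thesis using H.span_add by metis
  qed
  have "T w \<in> ?S" if "w \<in> We" for w
    using that
  proof (induction "ell w" arbitrary: w rule: less_induct)
    case less
    show ?case
    proof (cases "w \<in> \<Sigma>")
      case True
      then show ?thesis using X_stab[OF id_ext True] XS[OF less.prems] by (simp add: X_id)
    next
      case False
      then obtain i where i: "wall i (inv w a0) < 0" using descent_or_stab[OF less.prems] by blast
      note l = len_descent[OF less.prems i]
      have h: "T (w \<circ> s i) \<in> ?S" using less.hyps[of "w \<circ> s i"] l ext_comp[OF less.prems gen_ext] by auto
      have "T (w \<circ> s i) * T (s i) \<in> ?S" by (rule mult[OF gen h])
      then show ?thesis using T_descent[OF less.prems l] by simp
    qed
  qed
  then have "H.span (T ` We) \<subseteq> ?S" by (intro H.span_minimal H.subspace_span) blast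
  then show ?thesis using span_T by auto
qed

end

section \<open>The Levi subalgebra acting on the module M\<close>

locale comparison = hecke \<Phi> \<alpha> cls scaleH T
  for \<Phi> :: "'v::euclidean_space set" and \<alpha> :: "'i::{finite,linorder} \<Rightarrow> 'v"
    and cls :: "'i option \<Rightarrow> 'c" and scaleH :: "'c qring \<Rightarrow> 'h::ring_1 \<Rightarrow> 'h" and T :: "('v \<Rightarrow> 'v) \<Rightarrow> 'h" +
  fixes J :: "'i set" and v :: "'v \<Rightarrow> 'c qring"
    and \<pi> :: "('i, 'c) zring \<Rightarrow> 'z::comm_ring_1"
    and scaleM :: "'z \<Rightarrow> 'm::ab_group_add \<Rightarrow> 'm" and actM :: "'m \<Rightarrow> 'h \<Rightarrow> 'm" and m :: "('v \<Rightarrow> 'v) \<Rightarrow> 'm"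
  assumes pi_one: "\<pi> 1 = 1"
    and module_M: "module_M \<Phi> \<alpha> cls J v scaleH T \<pi> scaleM actM m"
begin

lemma right_module_M: "right_module scaleH (zconst \<pi>) scaleM actM"
  and basis_M: "free_basis scaleM (MR J) m"
  using module_M by (simp_all add: module_M_def)

sublocale M: module scaleM
  using basis_M by (simp add: free_basis_def)

lemma act_add_left: "actM (x + y) h = actM x h + actM y h"
  and act_add_right: "actM x (h + k) = actM x h + actM x k"
  and act_mult: "actM x (h * k) = actM (actM x h) k"
  and act_one: "actM x 1 = x"
  and act_scale: "actM (scaleM z x) h = scaleM z (actM x h)"
  and act_scaleH: "actM x (scaleH r h) = scaleM (zconst \<pi> r) (actM x h)"
  using right_module_M unfolding right_module_def by blast+

lemma act_Tinv: "actM x (Tinv i) = actM x (T (s i)) - scaleM (zconst \<pi> (\<xi> i)) x"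
proof -
  have "T (s i) = Tinv i + scaleH (\<xi> i) 1" by (simp add: Tinv_def del: gen.simps)
  then have "actM x (T (s i)) = actM x (Tinv i) + scaleM (zconst \<pi> (\<xi> i)) x"
    by (simp only: act_add_right act_scaleH act_one)
  then show ?thesis by simp
qed

lemma basis_independent:
  assumes z: "(\<Sum>u\<in>MR J. scaleM (c u) (m u)) = 0" and u: "u \<in> MR J" shows "c u = 0"
proof -
  have b: "inj_on m (MR J)" "M.independent (m ` MR J)" using basis_M by (auto simp: free_basis_def)
  have "(\<Sum>x\<in>m ` MR J. scaleM (c (inv_into (MR J) m x)) x) = (\<Sum>u\<in>MR J. scaleM (c u) (m u))"
    using b(1) by (simp add: sum.reindex)
  then have "c (inv_into (MR J) m (m u)) = 0"
    using M.independentD[OF b(2) _ subset_refl, of "\<lambda>x. c (inv_into (MR J) m x)" "m u"] z u finite_min_reps by simp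
  then show ?thesis using b(1) u by simp
qed

lemma act_stab:
  assumes "u \<in> MR J" "\<sigma> \<in> \<Sigma>"
  shows "actM (m u) (T \<sigma>) = scaleM (\<pi> (zeta \<alpha> (wt (u \<circ> \<sigma>)))) (m (theta_rep \<Phi> \<alpha> J (u \<circ> \<sigma>)))"
  using module_M assms unfolding module_M_def by blast

lemma act_gen:
  assumes "u \<in> MR J"
  shows "u \<circ> s i \<in> strip_elements \<Phi> \<alpha> J \<Longrightarrow> positive_crossing \<Phi> \<alpha> u i \<Longrightarrow>
      actM (m u) (T (s i)) = scaleM (\<pi> (zeta \<alpha> (wt (u \<circ> s i)))) (m (theta_rep \<Phi> \<alpha> J (u \<circ> s i)))"
    and "u \<circ> s i \<in> strip_elements \<Phi> \<alpha> J \<Longrightarrow> negative_crossing \<Phi> \<alpha> u i \<Longrightarrow>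
      actM (m u) (T (s i)) = scaleM (\<pi> (zeta \<alpha> (wt (u \<circ> s i)))) (m (theta_rep \<Phi> \<alpha> J (u \<circ> s i))) +
        scaleM (zconst \<pi> (\<xi> i)) (m u)"
    and "u \<circ> s i \<notin> strip_elements \<Phi> \<alpha> J \<Longrightarrow> \<exists>c. actM (m u) (T (s i)) = scaleM c (m u)"
  using module_M assms unfolding module_M_def \<xi>_def by blast+

text \<open>The additional term in the action of \<open>T\<^sub>i\<close> at a negative crossing is the difference between \<open>T\<^sub>i\<close> and its
  inverse. So the crossing factor acts by the same formula for both signs.\<close>

lemma crossing_within:
  assumes u: "u \<in> MR J" and n: "u (grad i) \<notin> RJ J"
  shows "actM (m u) (crossing_factor u i) = scaleM (\<pi> (zeta \<alpha> (wt (u \<circ> s i)))) (m (theta_rep \<Phi> \<alpha> J (u \<circ> s i)))"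
proof -
  have W: "u \<in> W0" and U: "u \<in> We" using min_reps_W0[OF u] W0_ext by auto
  have st: "u \<circ> s i \<in> strip_elements \<Phi> \<alpha> J" using strip_iff[OF u] n by blast
  show ?thesis
  proof (cases "u (grad i) \<in> P")
    case True
    then have "negative_crossing \<Phi> \<alpha> u i" using negative_crossing_iff[OF U] linear_part_W0[OF W] by simp
    then show ?thesis using act_gen(2)[OF u st] True
      by (simp add: crossing_factor_eq[OF U] linear_part_W0[OF W] act_Tinv del: gen.simps)
  next
    case False
    then have "positive_crossing \<Phi> \<alpha> u i" using positive_crossing_iff[OF U] linear_part_W0[OF W] by simp
    then show ?thesis using act_gen(1)[OF u st] False
      by (simp add: crossing_factor_eq[OF U] linear_part_W0[OF W] del: gen.simps)
  qed
qed

lemma fold_at_wall: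
  assumes u: "u \<in> MR J" and r: "u (grad i) \<in> RJ J"
  shows "\<exists>c. actM (m u) (crossing_factor w i) = scaleM c (m u)"
proof -
  have "u \<circ> s i \<notin> strip_elements \<Phi> \<alpha> J" using strip_iff[OF u] r by blast
  then obtain c where "actM (m u) (T (s i)) = scaleM c (m u)" using act_gen(3)[OF u] by blast
  then have "actM (m u) (crossing_factor w i) = scaleM (if positive_crossing \<Phi> \<alpha> w i then c else c - zconst \<pi> (\<xi> i)) (m u)"
    by (simp add: crossing_factor_def act_Tinv M.scale_left_diff_distrib del: gen.simps)
  then show ?thesis by blast
qed

abbreviation "\<theta> \<equiv> theta_rep \<Phi> \<alpha> J"

lemma theta_comp:
  assumes w: "w \<in> We" and w': "w' \<in> We" shows "\<theta> (w \<circ> w') = \<theta> (\<theta> w \<circ> w')"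
proof -
  obtain x where x: "x \<in> PJ J" "\<theta> w \<in> MR J" "linear_part w = x \<circ> \<theta> w" using theta_rep[OF w] .
  have W: "\<theta> w \<in> W0" and U: "\<theta> w \<in> We" using min_reps_W0[OF x(2)] W0_ext by auto
  obtain y where y: "y \<in> PJ J" "\<theta> (\<theta> w \<circ> w') \<in> MR J" "linear_part (\<theta> w \<circ> w') = y \<circ> \<theta> (\<theta> w \<circ> w')"
    using theta_rep[OF ext_comp[OF U w']] .
  have "linear_part (w \<circ> w') = x \<circ> linear_part (\<theta> w \<circ> w')"
    by (simp only: linear_part_comp[OF w w'] linear_part_comp[OF U w'] x(3) linear_part_W0[OF W] o_assoc)
  then have "linear_part (w \<circ> w') = (x \<circ> y) \<circ> \<theta> (\<theta> w \<circ> w')" by (simp only: y(3) o_assoc)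
  then show ?thesis by (rule theta_repI[OF y(2) parabolic_comp[OF x(1) y(1)]])
qed

text \<open>A step across a wall of \<open>\<Phi>\<^sub>J\<close> multiplies the linear part on the left by a reflection of \<open>W\<^sub>J\<close>.\<close>

lemma theta_fold:
  assumes u: "u \<in> MR J" and r: "u (grad i) \<in> RJ J" shows "\<theta> (u \<circ> s i) = u"
proof (rule theta_repI[OF u reflection_parabolic[OF r]])
  have W: "u \<in> W0" using min_reps_W0[OF u] .
  have "linear_part (u \<circ> s i) = u \<circ> reflect (grad i)"
    by (simp only: linear_part_comp[OF W0_ext[OF W] gen_ext] linear_part_W0[OF W] linear_part_gen)
  also have "\<dots> = reflect (u (grad i)) \<circ> u"
    using reflect_conj[OF W0_orthogonal[OF W], of "grad i"] by (auto simp: fun_eq_iff)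
  finally show "linear_part (u \<circ> s i) = reflect (u (grad i)) \<circ> u" .
qed

text \<open>The crossing takes place at \<open>w\<close>, while the action is known at the representative of \<open>w\<close>. The two differ
  by an element of \<open>W\<^sub>J\<close>, which preserves the sign of a root outside \<open>\<Phi>\<^sub>J\<close>. For a root in \<open>\<Phi>\<^sub>J\<close> the sign is
  irrelevant, as both factors act by a scalar.\<close>

lemma act_crossing:
  assumes w: "w \<in> We" shows "\<exists>c. actM (m (\<theta> w)) (crossing_factor w i) = scaleM c (m (\<theta> (w \<circ> s i)))"
proof -
  obtain x where x: "x \<in> PJ J" "\<theta> w \<in> MR J" "linear_part w = x \<circ> \<theta> w" using theta_rep[OF w] .
  let ?u = "\<theta> w"
  have W: "?u \<in> W0" using min_reps_W0[OF x(2)] .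
  have t: "\<theta> (w \<circ> s i) = \<theta> (?u \<circ> s i)" by (rule theta_comp[OF w gen_ext])
  show ?thesis
  proof (cases "?u (grad i) \<in> RJ J")
    case True
    then show ?thesis using fold_at_wall[OF x(2) True] theta_fold[OF x(2) True] t by simp
  next
    case False
    have "x (?u (grad i)) \<in> P \<longleftrightarrow> ?u (grad i) \<in> P" by (rule parabolic_pos_iff[OF x(1) W0_root[OF W grad_root] False])
    then have "crossing_factor w i = crossing_factor ?u i"
      by (simp add: crossing_factor_eq[OF w] crossing_factor_eq[OF W0_ext[OF W]] linear_part_W0[OF W] x(3) del: gen.simps)
    then show ?thesis using crossing_within[OF x(2) False] t by (metis (no_types))
  qed
qed

lemma theta_in: "w \<in> We \<Longrightarrow> \<theta> w \<in> MR J"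
  using theta_rep by blast

lemma act_X_word: "\<exists>c. actM (m id) (X (word ks)) = scaleM c (m (\<theta> (word ks)))"
proof (induction ks rule: rev_induct)
  case Nil
  have "actM (m id) (X (word [])) = scaleM 1 (m (\<theta> (word [])))"
    by (simp only: word_simps X_id act_one M.scale_one theta_rep_min_rep[OF id_min_rep])
  then show ?case by blast
next
  case (snoc i ks)
  then obtain c where c: "actM (m id) (X (word ks)) = scaleM c (m (\<theta> (word ks)))" by blast
  have e: "word (ks @ [i]) = word ks \<circ> s i" by (simp only: word_append word_simps comp_id)
  obtain d where "actM (m (\<theta> (word ks))) (crossing_factor (word ks) i) = scaleM d (m (\<theta> (word ks \<circ> s i)))"
    using act_crossing[OF word_ext] by blast
  then have "actM (m id) (X (word (ks @ [i]))) = scaleM (c * d) (m (\<theta> (word (ks @ [i]))))"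
    by (simp only: e X_step[OF word_ext] act_mult c act_scale M.scale_scale)
  then show ?case by blast
qed

lemma act_X: assumes "w \<in> We" shows "\<exists>c. actM (m id) (X w) = scaleM c (m (\<theta> w))"
proof -
  obtain ks \<sigma> where k: "\<sigma> \<in> \<Sigma>" "w = word ks \<circ> \<sigma>" using ex_word[OF assms] by blast
  obtain c where c: "actM (m id) (X (word ks)) = scaleM c (m (\<theta> (word ks)))" using act_X_word by blast
  have "actM (m id) (X w) = scaleM (c * \<pi> (zeta \<alpha> (wt (\<theta> (word ks) \<circ> \<sigma>)))) (m (\<theta> (\<theta> (word ks) \<circ> \<sigma>)))"
    by (simp only: k(2) X_stab[OF word_ext k(1)] act_mult c act_scale act_stab[OF theta_in[OF word_ext] k(1)] M.scale_scale)
  then show ?thesis by (simp only: k(2) theta_comp[OF word_ext stab_ext[OF k(1)]]) blast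
qed

text \<open>A translation has representative \<open>id\<close>, so \<open>X\<close> of a translation maps \<open>m id\<close> to a multiple of itself; for
  \<open>T\<^sub>j\<close> the step from the fundamental alcove leaves the strip.\<close>

lemma levi_stable: assumes "l \<in> LJ J" shows "\<exists>c. actM (m id) l = scaleM c (m id)"
  using assms unfolding levi_def
proof (induction rule: generated_subalgebra.induct)
  case 1
  show ?case by (rule exI[of _ 1]) (simp add: act_one)
next
  case (2 g)
  then consider j where "j \<in> J" "g = T (s (Some j))" | \<mu> where "\<mu> \<in> coweight_lattice \<alpha>" "g = X (translation \<mu>)" by blast
  then show ?case
  proof cases
    case (1 j)
    have "\<alpha> j \<in> RJ J" using 1(1) simple_in by (auto simp: roots_J_def intro: span_base)
    then have "id \<circ> s (Some j) \<notin> strip_elements \<Phi> \<alpha> J"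
      using strip_iff[OF id_min_rep, of "Some j" J] by (simp only: id_apply grad_simps) simp
    then show ?thesis unfolding 1(2) by (rule act_gen(3)[OF id_min_rep])
  next
    case (2 \<mu>)
    have "\<theta> (translation \<mu>) = id"
      by (rule theta_repI[OF id_min_rep parabolic_id]) (simp only: linear_part_translation comp_id)
    then show ?thesis using act_X[OF translation_ext[OF 2(1)]] unfolding 2(2) by metis
  qed
next
  case (3 x r)
  then show ?case by (metis act_scaleH M.scale_scale)
next
  case (4 x y)
  then show ?case by (metis act_add_right M.scale_left_distrib)
next
  case (5 x y)
  then show ?case by (metis act_mult act_scale M.scale_scale)
qed

abbreviation "\<psi> \<equiv> psi scaleM actM m"

lemma scale_cancel: assumes "scaleM c (m id) = scaleM d (m id)" shows "c = d"
proof -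
  have "(\<Sum>u\<in>MR J. scaleM (if u = id then c - d else 0) (m u)) = (\<Sum>u\<in>MR J. if u = id then scaleM (c - d) (m u) else 0)"
    by (rule sum.cong) auto
  also have "\<dots> = scaleM (c - d) (m id)" using finite_min_reps id_min_rep by simp
  also have "\<dots> = 0" using assms by (simp add: M.scale_left_diff_distrib)
  finally have "(if (id :: 'v \<Rightarrow> 'v) = id then c - d else 0) = 0" by (rule basis_independent) (rule id_min_rep)
  then show ?thesis by simp
qed

text \<open>The scalar is unique because \<open>m id\<close> belongs to a basis, so the description that defines \<open>\<psi>\<close> is met.\<close>

lemma act_levi: assumes "l \<in> LJ J" shows "actM (m id) l = scaleM (\<psi> l) (m id)"
proof -
  obtain c where c: "actM (m id) l = scaleM c (m id)" using levi_stable[OF assms] by blast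
  then have "\<psi> l = c" unfolding psi_def by (intro the_equality) (auto dest: scale_cancel)
  then show ?thesis using c by simp
qed

lemma zeta_zero: "zeta \<alpha> 0 = 1"
  by (simp add: zeta_def)

text \<open>All steps of the walk stay in \<open>W\<^sub>0\<close>, so no weight is picked up, and by induction all elements reached are
  minimal representatives themselves.\<close>

lemma act_X_min_rep: "u \<in> MR J \<Longrightarrow> actM (m id) (X u) = m u"
proof (induction rule: min_rep_induct)
  case id show ?case by (simp only: X_id act_one)
next
  case (step u i)
  have W: "u \<in> W0" by (rule min_reps_W0[OF step.hyps(1)])
  have "wt (u \<circ> s (Some i)) = 0"
    using W0_zero[OF parabolic_comp[OF W gen_Some_W0[of i]]] unfolding wt_def .
  then have "actM (m u) (crossing_factor u (Some i)) = m (u \<circ> s (Some i))"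
    using crossing_within[OF step.hyps(1), of "Some i"] step.hyps(4)
    by (simp only: grad_simps zeta_zero pi_one M.scale_one theta_rep_min_rep[OF step.hyps(2)] simp_thms)
  then show ?case by (simp only: X_step[OF W0_ext[OF W]] act_mult step.IH)
qed

end

section \<open>Comparison with the induced module\<close>

locale induction_comparison = comparison \<Phi> \<alpha> cls scaleH T J v \<pi> scaleM actM m
  for \<Phi> :: "'v::euclidean_space set" and \<alpha> :: "'i::{finite,linorder} \<Rightarrow> 'v"
    and cls :: "'i option \<Rightarrow> 'c" and scaleH :: "'c qring \<Rightarrow> 'h::ring_1 \<Rightarrow> 'h" and T :: "('v \<Rightarrow> 'v) \<Rightarrow> 'h"
    and J :: "'i set" and v :: "'v \<Rightarrow> 'c qring"
    and \<pi> :: "('i, 'c) zring \<Rightarrow> 'z::comm_ring_1"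
    and scaleM :: "'z \<Rightarrow> 'm::ab_group_add \<Rightarrow> 'm" and actM :: "'m \<Rightarrow> 'h \<Rightarrow> 'm" and m :: "('v \<Rightarrow> 'v) \<Rightarrow> 'm" +
  fixes scaleM' :: "'z \<Rightarrow> 't::ab_group_add \<Rightarrow> 't" and actM' :: "'t \<Rightarrow> 'h \<Rightarrow> 't" and \<tau> :: "'z \<Rightarrow> 'h \<Rightarrow> 't"
  assumes induced: "induced_module (levi \<Phi> \<alpha> J scaleH T) (psi scaleM actM m) scaleM' actM' \<tau>"
begin

lemma tensor: "is_tensor_product (LJ J) (\<lambda>z l. z * \<psi> l) \<tau>"
  and scale'_additive: "Modules.additive (scaleM' z)"
  and scale'_tensor: "scaleM' z (\<tau> z' h) = \<tau> (z * z') h"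
  and act'_additive: "Modules.additive (\<lambda>x. actM' x h)"
  and act'_tensor: "actM' (\<tau> z h) h' = \<tau> z (h * h')"
  using induced by (simp_all add: induced_module_def)

definition presentation :: "(('z \<times> 'h) \<Rightarrow>\<^sub>0 int) \<Rightarrow> 't" where
  "presentation = (SOME F. Modules.additive F \<and> (\<forall>n h. F (Poly_Mapping.single (n, h) 1) = \<tau> n h) \<and> surj F \<and>
     {x. F x = 0} = group_closure (tensor_relations (LJ J) (\<lambda>z l. z * \<psi> l)))"

lemma presentation: "Modules.additive presentation" "presentation (Poly_Mapping.single (z, h) 1) = \<tau> z h" "surj presentation"
  "presentation x = 0 \<longleftrightarrow> x \<in> group_closure (tensor_relations (LJ J) (\<lambda>z l. z * \<psi> l))"
  using someI_ex[OF tensor[unfolded is_tensor_product_def], folded presentation_def] by auto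

lemma presentation_diff: "presentation (x - y) = presentation x - presentation y" and presentation_zero: "presentation 0 = 0"
  using presentation(1) by (simp_all add: additive.diff additive.zero)

lemma tensor_induct:
  assumes "\<And>z h. Q (\<tau> z h)" "\<And>x y. Q x \<Longrightarrow> Q y \<Longrightarrow> Q (x - y)" shows "Q t"
proof -
  have Q0: "Q 0" using assms(2)[OF assms(1) assms(1), of 0 0 0 0] by simp
  have "Q (presentation p)" for p
    by (rule frag_induction[OF subset_UNIV[of "Poly_Mapping.keys p"]])
      (auto simp: presentation_zero presentation_diff Q0 presentation(2) assms)
  then show ?thesis using presentation(3) by (metis surjD)
qed

lemma tensor_add_left: "\<tau> (z + z') h = \<tau> z h + \<tau> z' h"
  and tensor_add_right: "\<tau> z (h + h') = \<tau> z h + \<tau> z h'"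
  and tensor_levi: "l \<in> LJ J \<Longrightarrow> \<tau> (z * \<psi> l) h = \<tau> z (l * h)"
proof -
  have rel: "presentation x = 0" if "x \<in> tensor_relations (LJ J) (\<lambda>z l. z * \<psi> l)" for x
    using that presentation(4) by (auto intro: group_closure.base)
  let ?single = "\<lambda>z h. Poly_Mapping.single (z, h) (1::int)"
  have "presentation (?single (z + z') h - ?single z h - ?single z' h) = 0"
    by (rule rel) (unfold tensor_relations_def Let_def, blast)
  then have "\<tau> (z + z') h - \<tau> z h - \<tau> z' h = 0" by (simp only: presentation_diff presentation(2))
  then show "\<tau> (z + z') h = \<tau> z h + \<tau> z' h" by (simp add: algebra_simps)
  have "presentation (?single z (h + h') - ?single z h - ?single z h') = 0"
    by (rule rel) (unfold tensor_relations_def Let_def, blast)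
  then have "\<tau> z (h + h') - \<tau> z h - \<tau> z h' = 0" by (simp only: presentation_diff presentation(2))
  then show "\<tau> z (h + h') = \<tau> z h + \<tau> z h'" by (simp add: algebra_simps)
  show "\<tau> (z * \<psi> l) h = \<tau> z (l * h)" if "l \<in> LJ J"
  proof -
    have "presentation (?single (z * \<psi> l) h - ?single z (l * h)) = 0"
      by (rule rel) (use that in \<open>unfold tensor_relations_def Let_def, blast\<close>)
    then show ?thesis by (simp add: presentation_diff presentation(2))
  qed
qed

text \<open>The additive extension of \<open>(z, h) \<mapsto> z m\<^sub>e h\<close> to the free abelian group of the tensor product. An integer
  acts through its image in the ring of scalars.\<close>

definition presentation_to_M :: "(('z \<times> 'h) \<Rightarrow>\<^sub>0 int) \<Rightarrow> 'm" where
  "presentation_to_M p = (\<Sum>q\<in>Poly_Mapping.keys p. scaleM (of_int (Poly_Mapping.lookup p q)) (scaleM (fst q) (actM (m id) (snd q))))"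

lemma presentation_to_M_superset: "finite K \<Longrightarrow> Poly_Mapping.keys p \<subseteq> K \<Longrightarrow>
    presentation_to_M p = (\<Sum>q\<in>K. scaleM (of_int (Poly_Mapping.lookup p q)) (scaleM (fst q) (actM (m id) (snd q))))"
  unfolding presentation_to_M_def by (rule sum.mono_neutral_left) (auto simp: in_keys_iff)

lemma presentation_to_M_diff: "presentation_to_M (p - q) = presentation_to_M p - presentation_to_M q"
proof -
  let ?K = "Poly_Mapping.keys p \<union> Poly_Mapping.keys q"
  have "Poly_Mapping.keys (p - q) \<subseteq> ?K" by (auto simp: in_keys_iff lookup_minus)
  then show ?thesis
    using presentation_to_M_superset[of ?K p] presentation_to_M_superset[of ?K q] presentation_to_M_superset[of ?K "p - q"]
    by (simp add: lookup_minus M.scale_left_diff_distrib left_diff_distrib sum_subtractf)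
qed

lemma presentation_to_M_single: "presentation_to_M (Poly_Mapping.single (z, h) 1) = scaleM z (actM (m id) h)"
  by (simp add: presentation_to_M_def)

text \<open>Balancedness over the Levi subalgebra is where the stability of the line of \<open>m id\<close> enters.\<close>

lemma presentation_to_M_relations: assumes "x \<in> group_closure (tensor_relations (LJ J) (\<lambda>z l. z * \<psi> l))" shows "presentation_to_M x = 0"
  using assms
proof induction
  case (base x)
  then show ?case
    by (auto simp: tensor_relations_def Let_def presentation_to_M_diff presentation_to_M_single M.scale_left_distrib M.scale_right_distrib
        act_add_right act_mult act_levi act_scale presentation_to_M_def[of 0])
next
  case (diff x y)
  then show ?case by (simp add: presentation_to_M_diff)
qed

text \<open>The induced map. The value does not depend on the preimage, since \<open>presentation_to_M\<close> kills the kernel of \<open>presentation\<close>.\<close>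

definition to_M :: "'t \<Rightarrow> 'm" where "to_M t = presentation_to_M (inv presentation t)"

lemma to_M_presentation: "to_M (presentation x) = presentation_to_M x"
proof -
  have "presentation (inv presentation (presentation x) - x) = 0" using presentation(3) by (simp add: presentation_diff surj_f_inv_f)
  then have "presentation_to_M (inv presentation (presentation x) - x) = 0" using presentation(4) presentation_to_M_relations by blast
  then show ?thesis by (simp add: to_M_def presentation_to_M_diff)
qed

lemma to_M_tensor: "to_M (\<tau> z h) = scaleM z (actM (m id) h)"
  using to_M_presentation[of "Poly_Mapping.single (z, h) 1"] by (simp add: presentation(2) presentation_to_M_single)

lemma to_M_diff: "to_M (x - y) = to_M x - to_M y"
proof -
  obtain p q where "x = presentation p" "y = presentation q" using presentation(3) by (metis surjD)
  then show ?thesis by (simp add: to_M_presentation presentation_to_M_diff flip: presentation_diff)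
qed

lemma to_M_zero: "to_M 0 = 0" and to_M_add: "to_M (x + y) = to_M x + to_M y"
proof -
  show 0: "to_M 0 = 0" using to_M_diff[of 0 0] by simp
  show "to_M (x + y) = to_M x + to_M y" using to_M_diff[of x "0 - y"] to_M_diff[of 0 y] 0 by simp
qed

lemma to_M_scale: "to_M (scaleM' z t) = scaleM z (to_M t)"
proof (induction t rule: tensor_induct)
  case (1 z' h)
  then show ?case by (simp add: scale'_tensor to_M_tensor)
next
  case (2 x y)
  then show ?case by (simp add: additive.diff[OF scale'_additive] to_M_diff M.scale_right_diff_distrib)
qed

lemma act_diff_left: "actM (x - y) h = actM x h - actM y h"
  using act_add_left[of "x - y" y h] by simp

lemma to_M_act: "to_M (actM' t h) = actM (to_M t) h"
proof (induction t rule: tensor_induct)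
  case (1 z' k)
  then show ?case by (simp add: act'_tensor to_M_tensor act_mult act_scale)
next
  case (2 x y)
  then show ?case by (simp add: additive.diff[OF act'_additive] to_M_diff act_diff_left)
qed

lemma tensor_zero: "\<tau> 0 h = 0"
  using tensor_add_left[of 0 0 h] by simp

lemma tensor_diff_left: "\<tau> (z - z') h = \<tau> z h - \<tau> z' h"
  using tensor_add_left[of "z - z'" z' h] by simp

text \<open>Expand \<open>h\<close> in the \<open>X\<^sub>w\<close>, split off the Levi factor and move it across the tensor sign.\<close>

lemma tensor_spanned: "\<exists>c. t = (\<Sum>u\<in>MR J. \<tau> (c u) (X u))"
proof (induction t rule: tensor_induct)
  case (1 z h)
  have add: "\<exists>c. x + y = (\<Sum>u\<in>MR J. \<tau> (c u) (X u))"
    if "\<exists>c. x = (\<Sum>u\<in>MR J. \<tau> (c u) (X u))" "\<exists>c. y = (\<Sum>u\<in>MR J. \<tau> (c u) (X u))" for x y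
  proof -
    from that obtain c d where "x = (\<Sum>u\<in>MR J. \<tau> (c u) (X u))" "y = (\<Sum>u\<in>MR J. \<tau> (d u) (X u))" by blast
    then have "x + y = (\<Sum>u\<in>MR J. \<tau> (c u + d u) (X u))" by (simp add: tensor_add_left sum.distrib)
    then show ?thesis by (rule exI[of _ "\<lambda>u. c u + d u"])
  qed
  have "h \<in> H.span (X ` We)" using span_X by simp
  then show ?case
  proof (induction rule: H.span_induct_alt)
    case base
    have "\<tau> z 0 = 0" using tensor_add_right[of z 0 0] by simp
    then show ?case by (intro exI[of _ "\<lambda>u. 0"]) (simp add: tensor_zero)
  next
    case (step r x y)
    then obtain w where w: "w \<in> We" "x = X w" by blast
    obtain l where l: "l \<in> LJ J" "X w = l * X (\<theta> w)" using X_factor[OF w(1)] by blast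
    have "\<tau> z (scaleH r x) = \<tau> z (scaleH r l * X (\<theta> w))" by (simp only: w(2) l(2) scale_left)
    also have "\<dots> = \<tau> (z * \<psi> (scaleH r l)) (X (\<theta> w))" using tensor_levi[OF levi_scale[OF l(1)]] by simp
    also have "\<dots> = (\<Sum>u\<in>MR J. if u = \<theta> w then \<tau> (z * \<psi> (scaleH r l)) (X u) else 0)"
      using theta_in[OF w(1)] finite_min_reps by simp
    also have "\<dots> = (\<Sum>u\<in>MR J. \<tau> (if u = \<theta> w then z * \<psi> (scaleH r l) else 0) (X u))"
      by (rule sum.cong) (auto simp: tensor_zero)
    finally have "\<exists>c. \<tau> z (scaleH r x) = (\<Sum>u\<in>MR J. \<tau> (c u) (X u))"
      by (rule exI[of _ "\<lambda>u. if u = \<theta> w then z * \<psi> (scaleH r l) else 0"])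
    then show ?case unfolding tensor_add_right using step by (intro add)
  qed
next
  case (2 x y)
  then obtain c d where "x = (\<Sum>u\<in>MR J. \<tau> (c u) (X u))" "y = (\<Sum>u\<in>MR J. \<tau> (d u) (X u))" by blast
  then have "x - y = (\<Sum>u\<in>MR J. \<tau> (c u - d u) (X u))" by (simp add: tensor_diff_left sum_subtractf)
  then show ?case by (rule exI[of _ "\<lambda>u. c u - d u"])
qed

lemma to_M_sum: "to_M (sum b A) = (\<Sum>a\<in>A. to_M (b a))"
  by (induction A rule: infinite_finite_induct) (auto simp: to_M_zero to_M_add)

text \<open>The induced module is spanned by elements whose images form a basis, so no nonzero combination of them
  can vanish in \<open>M\<close>.\<close>

lemma inj_to_M: "inj to_M"
proof (rule injI)
  fix x y assume "to_M x = to_M y"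
  then have z: "to_M (x - y) = 0" by (simp add: to_M_diff)
  obtain c where c: "x - y = (\<Sum>u\<in>MR J. \<tau> (c u) (X u))" using tensor_spanned by blast
  have "(\<Sum>u\<in>MR J. scaleM (c u) (m u)) = 0"
    using z unfolding c by (simp add: to_M_sum to_M_tensor act_X_min_rep)
  then have "c u = 0" if "u \<in> MR J" for u using basis_independent that by blast
  then have "x - y = 0" unfolding c by (simp add: tensor_zero)
  then show "x = y" by simp
qed

lemma to_M_basis: "u \<in> MR J \<Longrightarrow> to_M (\<tau> 1 (X u)) = m u"
  by (simp add: to_M_tensor act_X_min_rep)

lemma surj_to_M: "surj to_M"
proof -
  have "M.subspace (range to_M)"
    unfolding M.subspace_def by (auto simp: to_M_zero[symmetric] to_M_add[symmetric] to_M_scale[symmetric])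
  moreover have "m ` MR J \<subseteq> range to_M" using to_M_basis by (metis image_subsetI rangeI)
  ultimately have "M.span (m ` MR J) \<subseteq> range to_M" by (intro M.span_minimal)
  then show ?thesis using basis_M by (auto simp: free_basis_def)
qed

lemma module_induced: "module scaleM'"
  by unfold_locales (rule injD[OF inj_to_M], simp add: to_M_scale to_M_add M.scale_right_distrib M.scale_left_distrib)+

sublocale M': module scaleM' by (rule module_induced)

definition of_M :: "'m \<Rightarrow> 't" where "of_M = inv to_M"

lemma of_M_to_M: "of_M (to_M t) = t" and to_M_of_M: "to_M (of_M x) = x"
  using inj_to_M surj_to_M by (simp_all add: of_M_def surj_f_inv_f)

lemma of_M_eqI: "x = to_M t \<Longrightarrow> of_M x = t"
  by (simp add: of_M_to_M)

lemma of_M_add: "of_M (x + y) = of_M x + of_M y" by (rule of_M_eqI) (simp add: to_M_add to_M_of_M)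
lemma of_M_scale: "of_M (scaleM z x) = scaleM' z (of_M x)" by (rule of_M_eqI) (simp add: to_M_scale to_M_of_M)
lemma of_M_act: "of_M (actM x h) = actM' (of_M x) h" by (rule of_M_eqI) (simp add: to_M_act to_M_of_M)
lemma of_M_basis: "u \<in> MR J \<Longrightarrow> of_M (m u) = \<tau> 1 (X u)" by (rule of_M_eqI) (simp add: to_M_basis)

lemma bij_of_M: "bij of_M"
  by (rule o_bij[of to_M]) (auto simp: of_M_to_M to_M_of_M)

lemma of_M_iso: "right_module_iso actM actM' of_M"
  unfolding right_module_iso_def by (auto simp: of_M_add of_M_act bij_of_M intro: additive.intro)

sublocale of_M: module_hom scaleM scaleM' of_M
  by unfold_locales (simp_all add: of_M_add of_M_scale)

lemma induced_basis: "free_basis scaleM' (MR J) (\<lambda>u. \<tau> 1 (X u))"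
proof -
  have b: "inj_on m (MR J)" "M.independent (m ` MR J)" "M.span (m ` MR J) = UNIV"
    using basis_M by (auto simp: free_basis_def)
  have im: "(\<lambda>u. \<tau> 1 (X u)) ` MR J = of_M ` m ` MR J" using of_M_basis by force
  have "inj_on (of_M \<circ> m) (MR J)" using b(1) bij_of_M by (intro comp_inj_on) (auto intro: inj_on_subset bij_is_inj)
  then have "inj_on (\<lambda>u. \<tau> 1 (X u)) (MR J)" by (rule inj_on_cong[THEN iffD1, rotated]) (simp add: of_M_basis)
  moreover have "M'.independent (of_M ` m ` MR J)"
    using of_M.dependent_inj_imageD[of "m ` MR J"] b(2) bij_is_inj[OF bij_of_M] by (auto intro: inj_on_subset)
  moreover have "M'.span (of_M ` m ` MR J) = UNIV"
    unfolding of_M.span_image b(3) using bij_of_M by (simp add: bij_is_surj)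
  ultimately show ?thesis unfolding free_basis_def im using module_induced by blast
qed

text \<open>A row of a matrix is defined by a description, and the isomorphism makes the two described conditions
  equivalent.\<close>

lemma matrix_entries:
  assumes u: "u \<in> MR J"
  shows "matrix_entry scaleM actM (MR J) m h u = matrix_entry scaleM' actM' (MR J) (\<lambda>u. \<tau> 1 (X u)) h u"
proof -
  have "actM (m u) h = (\<Sum>w\<in>MR J. scaleM (c w) (m w)) \<longleftrightarrow>
      actM' (\<tau> 1 (X u)) h = (\<Sum>w\<in>MR J. scaleM' (c w) (\<tau> 1 (X w)))" (is "?l = ?r \<longleftrightarrow> _") for c
  proof -
    have "?l = ?r \<longleftrightarrow> of_M ?l = of_M ?r" using bij_of_M by (simp add: bij_is_inj inj_eq)
    moreover have "of_M ?l = actM' (\<tau> 1 (X u)) h" by (simp add: of_M_act of_M_basis[OF u])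
    moreover have "of_M ?r = (\<Sum>w\<in>MR J. scaleM' (c w) (\<tau> 1 (X w)))"
      by (simp add: of_M.sum of_M_scale of_M_basis)
    ultimately show ?thesis by simp
  qed
  then show ?thesis unfolding matrix_entry_def by simp
qed

end

theorem theorem5p20:
  fixes \<Phi> :: "'v::euclidean_space set"
    and \<alpha> :: "'i::{finite,linorder} \<Rightarrow> 'v"
    and J :: "'i set"
    and cls :: "'i option \<Rightarrow> 'c"
    and v :: "'v \<Rightarrow> 'c qring"
    and scaleH :: "'c qring \<Rightarrow> 'h::ring_1 \<Rightarrow> 'h"
    and T :: "('v \<Rightarrow> 'v) \<Rightarrow> 'h"
    and \<pi> :: "('i, 'c) zring \<Rightarrow> 'z::comm_ring_1"
    and scaleM :: "'z \<Rightarrow> 'm::ab_group_add \<Rightarrow> 'm"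
    and actM :: "'m \<Rightarrow> 'h \<Rightarrow> 'm"
    and m :: "('v \<Rightarrow> 'v) \<Rightarrow> 'm"
    and scaleM' :: "'z \<Rightarrow> 't::ab_group_add \<Rightarrow> 't"
    and actM' :: "'t \<Rightarrow> 'h \<Rightarrow> 't"
    and \<tau> :: "'z \<Rightarrow> 'h \<Rightarrow> 't"
  assumes "based_root_system \<Phi> \<alpha>"
    and "class_map \<Phi> \<alpha> cls"
    and "hecke_algebra \<Phi> \<alpha> cls scaleH T"
    and "parameter_system \<Phi> \<alpha> cls J v"
    and "zeta_quotient \<Phi> \<alpha> J \<pi>"
    and "module_M \<Phi> \<alpha> cls J v scaleH T \<pi> scaleM actM m"
    and "induced_module (levi \<Phi> \<alpha> J scaleH T) (psi scaleM actM m) scaleM' actM' \<tau>"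
  shows "(\<exists>f. right_module_iso actM actM' f \<and> (\<forall>z x. f (scaleM z x) = scaleM' z (f x))) \<and>
    free_basis scaleM' (min_reps \<Phi> \<alpha> J) (\<lambda>u. \<tau> 1 (X_elt \<Phi> \<alpha> T u)) \<and>
    (\<forall>h. \<forall>u\<in>min_reps \<Phi> \<alpha> J. \<forall>w\<in>min_reps \<Phi> \<alpha> J.
       matrix_entry scaleM actM (min_reps \<Phi> \<alpha> J) m h u w =
       matrix_entry scaleM' actM' (min_reps \<Phi> \<alpha> J) (\<lambda>u. \<tau> 1 (X_elt \<Phi> \<alpha> T u)) h u w)"
proof -
  interpret induction_comparison \<Phi> \<alpha> cls scaleH T J v \<pi> scaleM actM m scaleM' actM' \<tau>
    using assms(1,3,5,6,7) by unfold_locales (simp_all add: zeta_quotient_def)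
  show ?thesis using of_M_iso of_M_scale induced_basis matrix_entries by auto
qed

end
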